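(* Let $p\in(\frac{n}{n+1},1]$. (i) Assume that $\Omega\subset\mathbf{R}^n$ is a bounded domain with uniformly $q$-fat complement for some $q<p$. Then the domain $\Omega$ carries the $p$-Hardy inequality, i.e. there is a finite constant $C=C(p,n,\Omega)$ such that every $u\in C_0^\infty(\Omega)$ satisfies $$\int_\Omega\left(\frac{|u(x)|}{d(x,\partial\Omega)}\right)^p dx\leq C\sum_{j=1}^n\|D_ju\|^p_{H^p(\mathbf{R}^n)}.\quad( * )$$ (ii) Assume that $\Omega\subsetneq\mathbf{R}^n$ is a domain whose complement is thick in the sense of $(n-q)$-Hausdorff content with some $q<p$. Then the domain $\Omega$ carries the $p$-Hardy inequality $( * )$.
   Context: Here $d(x,\partial\Omega)$ is the distance from $x$ to $\partial\Omega$, $\Omega^c=\mathbf{R}^n\setminus\Omega$, and $u\in C_0^\infty(\Omega)$ is extended by zero to $\mathbf{R}^n$; $D_j$ is the $j$-th partial derivative. Hardy space: fix $\psi\in C_0^\infty(\mathbf{R}^n)$ with $\int\psi=1$ and $\operatorname{supp}\psi\subset\{x:|x|\leq 1\}$, and put $\psi_t(y)=t^{-n}\psi(y/t)$. For any exponent $s>0$, a tempered distribution $f$ belongs to $H^s(\mathbf{R}^n)$ iff $\mathcal{M}_\psi f(x):=\sup_{t>0}|f*\psi_t(x)|$ is in $L^s(\mathbf{R}^n)$, with $\|f\|_{H^s(\mathbf{R}^n)}:=\|\mathcal{M}_\psi f\|_{L^s}$. Hardy capacity: for a bounded open set $U\subset\mathbf{R}^n$, an exponent $q\in(0,1]$ and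 a compact set $E\subset U$, $$\mathrm{cap}_{H^{1,q}}(E;U):=\inf\Big\{\sum_{k=1}^n\|D_k\varphi\|^q_{H^q(\mathbf{R}^n)} : \varphi\in C_0^\infty(U),\ \varphi(x)\geq1\text{ for }x\in E\Big\}.$$ For $q\in(0,1]$, the complement of a domain $\Omega$ is uniformly $q$-fat if there is a constant $c>0$ such that for each $x\in\Omega^c$ and $r>0$ one has $\mathrm{cap}_{H^{1,q}}(\Omega^c\cap\overline{B}(x,r);B(x,2r))\geq c\,r^{n-q}$, where $B(x,r)$ is the ball with center $x$ and radius $r$. For $s>0$ the $s$-Hausdorff content of $E\subset\mathbf{R}^n$ is $\mathcal{H}^s_\infty(E):=c_0\inf\sum_{k=1}^\infty r_k^s$, where $c_0>0$ is a fixed normalizing constant and the infimum is over all denumerable coverings of $E$ by balls with radii $r_k$. The complement $\Omega^c$ is thick in the sense of $s$-Hausdorff content if there is $c>0$ such that for each $x\in\Omega^c$ and $r>0$ one has $\mathcal{H}^s_\infty(\Omega^c\cap B(x,r))\geq c\,r^s$. *)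

theory Defs
  imports "HOL-Analysis.Analysis"
begin

definition domain :: "(real^'n) set \<Rightarrow> bool" where
  "domain \<Omega> \<longleftrightarrow> open \<Omega> \<and> connected \<Omega> \<and> \<Omega> \<noteq> {}"

definition partial :: "'n \<Rightarrow> (real^'n \<Rightarrow> real) \<Rightarrow> real^'n \<Rightarrow> real" where
  "partial j f x = frechet_derivative f (at x) (axis j 1)"

fun C_k :: "nat \<Rightarrow> (real^'n \<Rightarrow> real) \<Rightarrow> bool" where
  "C_k 0 f \<longleftrightarrow> continuous_on UNIV f"
| "C_k (Suc k) f \<longleftrightarrow> (\<forall>x. f differentiable (at x)) \<and> (\<forall>j. C_k k (partial j f))"

definition supp :: "(real^'n \<Rightarrow> real) \<Rightarrow> (real^'n) set" where
  "supp f = closure {x. f x \<noteq> 0}"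

text \<open>The space \<open>C\<^sub>0\<^sup>\<infinity>(U)\<close>, its elements being identified with their
  extensions by zero to the whole space.\<close>

definition test_function :: "(real^'n) set \<Rightarrow> (real^'n \<Rightarrow> real) \<Rightarrow> bool" where
  "test_function U f \<longleftrightarrow> (\<forall>k. C_k k f) \<and> compact (supp f) \<and> supp f \<subseteq> U"

text \<open>Real powers on \<open>[0, \<infinity>]\<close>, meant for exponents \<open>a > 0\<close>; here
  \<open>0\<close> is mapped to \<open>0\<close> and \<open>\<infinity>\<close> to \<open>\<infinity>\<close>.\<close>

definition epowr :: "ennreal \<Rightarrow> real \<Rightarrow> ennreal" where
  "epowr x a = (if x = \<infinity> then \<infinity> else ennreal (enn2real x powr a))"

definition dilate :: "(real^'n \<Rightarrow> real) \<Rightarrow> real \<Rightarrow> real^'n \<Rightarrow> real" where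
  "dilate \<psi> t y = \<psi> (y /\<^sub>R t) / t ^ CARD('n)"

definition convolve :: "(real^'n \<Rightarrow> real) \<Rightarrow> (real^'n \<Rightarrow> real) \<Rightarrow> real^'n \<Rightarrow> real" where
  "convolve f g x = (LINT y|lborel. f y * g (x - y))"

definition maximal :: "(real^'n \<Rightarrow> real) \<Rightarrow> (real^'n \<Rightarrow> real) \<Rightarrow> real^'n \<Rightarrow> ennreal" where
  "maximal \<psi> f x = (SUP t\<in>{0<..}. ennreal \<bar>convolve f (dilate \<psi> t) x\<bar>)"

text \<open>The quasi-norm of \<open>H\<^sup>s\<close>, with value \<open>\<infinity>\<close> exactly when \<open>f\<close> is not
  in \<open>H\<^sup>s\<close>. It is needed only for derivatives of test functions, so \<open>f\<close> is a function
  here rather than a general tempered distribution.\<close>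

definition hardy_norm :: "(real^'n \<Rightarrow> real) \<Rightarrow> real \<Rightarrow> (real^'n \<Rightarrow> real) \<Rightarrow> ennreal" where
  "hardy_norm \<psi> s f = epowr (\<integral>\<^sup>+x. epowr (maximal \<psi> f x) s \<partial>lborel) (1 / s)"

definition hardy_cap ::
  "(real^'n \<Rightarrow> real) \<Rightarrow> real \<Rightarrow> (real^'n) set \<Rightarrow> (real^'n) set \<Rightarrow> ennreal" where
  "hardy_cap \<psi> q E U =
     (INF \<phi>\<in>{\<phi>. test_function U \<phi> \<and> (\<forall>x\<in>E. \<phi> x \<ge> 1)}.
        \<Sum>k\<in>UNIV. epowr (hardy_norm \<psi> q (partial k \<phi>)) q)"

definition uniformly_fat_complement ::
  "(real^'n \<Rightarrow> real) \<Rightarrow> real \<Rightarrow> (real^'n) set \<Rightarrow> bool" where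
  "uniformly_fat_complement \<psi> q \<Omega> \<longleftrightarrow>
     (\<exists>c>0. \<forall>x\<in>-\<Omega>. \<forall>r>0.
        hardy_cap \<psi> q (-\<Omega> \<inter> cball x r) (ball x (2 * r))
          \<ge> ennreal (c * r powr (real CARD('n) - q)))"

text \<open>The parameter \<open>c\<^sub>0\<close> is the normalizing constant.\<close>

definition hausdorff_content :: "real \<Rightarrow> real \<Rightarrow> (real^'n) set \<Rightarrow> ennreal" where
  "hausdorff_content c\<^sub>0 s E = ennreal c\<^sub>0 *
     (INF (a, r)\<in>{(a :: nat \<Rightarrow> real^'n, r :: nat \<Rightarrow> real).
                   (\<forall>k. r k > 0) \<and> E \<subseteq> (\<Union>k. ball (a k) (r k))}.
        \<Sum>k. ennreal (r k powr s))"

definition content_thick_complement :: "real \<Rightarrow> real \<Rightarrow> (real^'n) set \<Rightarrow> bool" where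
  "content_thick_complement c\<^sub>0 s \<Omega> \<longleftrightarrow>
     (\<exists>c>0. \<forall>x\<in>-\<Omega>. \<forall>r>0.
        hausdorff_content c\<^sub>0 s (-\<Omega> \<inter> ball x r) \<ge> ennreal (c * r powr s))"

definition carries_hardy_inequality ::
  "(real^'n \<Rightarrow> real) \<Rightarrow> real \<Rightarrow> (real^'n) set \<Rightarrow> bool" where
  "carries_hardy_inequality \<psi> p \<Omega> \<longleftrightarrow>
     (\<exists>C :: real. \<forall>u. test_function \<Omega> u \<longrightarrow>
        (\<integral>\<^sup>+x\<in>\<Omega>. ennreal ((\<bar>u x\<bar> / infdist x (frontier \<Omega>)) powr p) \<partial>lborel)
          \<le> ennreal C * (\<Sum>j\<in>UNIV. epowr (hardy_norm \<psi> p (partial j u)) p))"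

end

theory Submission
  imports Defs
begin

text \<open>Write \<open>m\<close> for the sum of the maximal functions of the derivatives of \<open>u\<close> and \<open>M\<close>
  for the Hardy--Littlewood operator. Since \<open>\<integral>\<psi> = 1\<close>, the kernel \<open>\<psi>\<^sub>t\<close> is a rapidly convergent series of
  kernels \<open>\<psi>\<^sub>s * \<Psi>\<close> with \<open>s = t/2, t/4, \<dots>\<close>; inserting this into a derivative \<open>D\<^sub>ju * \<psi>\<^sub>t\<close> and taking
  suprema shows that all mollified gradients near \<open>x\<close> are bounded by \<open>C (M(m\<^sup>q)(x))\<close> to the power \<open>1/q\<close>, for every
  \<open>q > 0\<close>; a function in \<open>C\<^sub>0\<^sup>\<infinity>\<close> makes the supremum finite a priori.

  If \<open>u\<close> vanishes on a content-thick set near \<open>x\<close>, a Vitali covering argument finds a point of that set at which the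
  increments \<open>u * \<psi>\<^sub>t - u * \<psi>\<^sub>t\<^sub>/\<^sub>2\<close> sum to at most \<open>C d(x)\<close> times the power \<open>1/q\<close> of \<open>M(M(m\<^sup>q))(x)\<close>.
  Integrating the resulting pointwise bound with the maximal theorem in exponent \<open>p/q > 1\<close> gives (ii).

  For (i), fatness implies content thickness with a slightly larger exponent above \<open>n/(n+1)\<close>: a cover by small balls
  yields an admissible function as a sum of bumps. Its maximal function is summable with the larger exponent near
  the cover, and with the possibly very small exponent \<open>q\<close> far away once enough moments are killed by
  subtracting translates of the bumps that lie off the covered set.\<close>

section \<open>Convolution of continuous functions with bounded support\<close>

text \<open>The gap below \<open>p\<close> is spent twice in (ii). Thickness holds for some
  \<open>q0\<close>, the estimates use \<open>q\<close> with \<open>q0 < q < p\<close>: the ratio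
  \<open>q0 / q < 1\<close> makes the increments decay geometrically over dyadic scales, and
  \<open>p / q > 1\<close> is what the maximal theorem needs. Two maximal operators arise because
  mollified gradients are controlled on whole small balls around points of the complement, and these
  balls are then averaged around \<open>x\<close>.

  The bound n/(n+1) < p is the range in which the derivative of one bump has a maximal function with
  integrable p-th power: having integral zero, it decays like |z|^(-n-1), in general no faster. In
  (i) the capacity exponent \<open>q\<close> may lie far below this range, so sums of plain bumps
  may have infinite energy; hence the corrections. Translates along a single axis suffice, because
  on each line parallel to the axis the kernel is a function of one variable and has a Taylor
  expansion there. They must avoid the covered set, since their weights can have either sign and
  could spoil the condition that the competitor is at least 1 there; this forces extrapolation from
  remote nodes.\<close>

lemma nn_integral_lborel_affine:
  fixes f :: "'a::euclidean_space \<Rightarrow> ennreal"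
  assumes [measurable]: "f \<in> borel_measurable borel" and c: "c \<noteq> 0"
  shows "(\<integral>\<^sup>+x. f x \<partial>lborel) = ennreal (\<bar>c\<bar> ^ DIM('a)) * (\<integral>\<^sup>+x. f (t + c *\<^sub>R x) \<partial>lborel)"
  by (subst lborel_affine[OF c, of t])
     (simp add: nn_integral_density nn_integral_distr nn_integral_cmult)

lemma integral_lborel_affine:
  fixes f :: "'a::euclidean_space \<Rightarrow> real"
  assumes [measurable]: "f \<in> borel_measurable borel" and c: "c \<noteq> 0"
  shows "(\<integral>x. f x \<partial>lborel) = \<bar>c\<bar> ^ DIM('a) * (\<integral>x. f (t + c *\<^sub>R x) \<partial>lborel)"
  by (subst lborel_affine[OF c, of t])
     (simp add: integral_density integral_distr)

text \<open>The support is recorded by a radius about the origin rather than as a compact set: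
  convolution then adds radii and dilation multiplies them. Smoothness is kept separate because most
  convolution identities need continuity only.\<close>

definition cont_supp :: "real \<Rightarrow> (real^'n \<Rightarrow> real) \<Rightarrow> bool" where
  "cont_supp r f \<longleftrightarrow> continuous_on UNIV f \<and> (\<forall>x. f x \<noteq> 0 \<longrightarrow> norm x \<le> r)"

lemma cont_supp_continuous: "cont_supp r f \<Longrightarrow> continuous_on A f"
  by (auto simp: cont_supp_def intro: continuous_on_subset)

lemma cont_supp_alt: "cont_supp r f \<longleftrightarrow> continuous_on UNIV f \<and> (\<forall>x. r < norm x \<longrightarrow> f x = 0)"
  by (auto simp: cont_supp_def not_less)

lemma cont_supp_zero: "cont_supp r f \<Longrightarrow> r < norm x \<Longrightarrow> f x = 0"
  by (force simp: cont_supp_def)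

lemma cont_supp_measurable [measurable_dest]: "cont_supp r f \<Longrightarrow> f \<in> borel_measurable borel"
  by (auto simp: cont_supp_def intro: borel_measurable_continuous_onI)

lemma cont_supp_mono: "cont_supp r f \<Longrightarrow> r \<le> s \<Longrightarrow> cont_supp s f"
  by (force simp: cont_supp_def)

lemma cont_supp_integrable:
  assumes "cont_supp r f" shows "integrable lborel f"
proof -
  have "integrable lborel (\<lambda>x. indicator (cball 0 r) x *\<^sub>R f x)"
    by (intro borel_integrable_compact compact_cball cont_supp_continuous[OF assms])
  also have "(\<lambda>x. indicator (cball 0 r) x *\<^sub>R f x) = f"
    using cont_supp_zero[OF assms] by (force simp: indicator_def)
  finally show ?thesis .
qed

lemma cont_supp_bounded:
  assumes "cont_supp r f" obtains B where "B \<ge> 0" "\<And>x. \<bar>f x\<bar> \<le> B"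
proof -
  have "compact (f ` cball 0 r)"
    by (intro compact_continuous_image cont_supp_continuous[OF assms] compact_cball)
  then obtain B where B: "\<And>y. y \<in> f ` cball 0 r \<Longrightarrow> \<bar>y\<bar> \<le> B"
    using compact_imp_bounded bounded_real by metis
  show ?thesis
  proof (rule that)
    show "max B 0 \<ge> 0" by simp
    show "\<bar>f x\<bar> \<le> max B 0" for x
      using B[of "f x"] cont_supp_zero[OF assms, of x] by (cases "norm x \<le> r") force+
  qed
qed

lemma cont_supp_mult: "cont_supp r f \<Longrightarrow> continuous_on UNIV g \<Longrightarrow> cont_supp r (\<lambda>x. f x * g x)"
  by (auto simp: cont_supp_def intro!: continuous_intros)

lemma cont_supp_cmult: "cont_supp r f \<Longrightarrow> cont_supp r (\<lambda>x. c * f x)"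
  by (auto simp: cont_supp_alt intro!: continuous_intros)

lemma cont_supp_diff: "cont_supp r f \<Longrightarrow> cont_supp r g \<Longrightarrow> cont_supp r (\<lambda>x. f x - g x)"
  by (auto simp: cont_supp_alt intro!: continuous_intros)

lemma cont_supp_sum: "(\<And>i. i \<in> A \<Longrightarrow> cont_supp r (f i)) \<Longrightarrow> cont_supp r (\<lambda>x. \<Sum>i\<in>A. f i x)"
  by (auto simp: cont_supp_alt intro!: continuous_intros sum.neutral)

lemma cont_supp_conv_integrand:
  "cont_supp r f \<Longrightarrow> continuous_on UNIV g \<Longrightarrow> cont_supp r (\<lambda>y. f y * g (x - y))"
  by (rule cont_supp_mult) (auto intro!: continuous_on_compose2[of UNIV g] continuous_intros)

lemma conv_integrable:
  "cont_supp r f \<Longrightarrow> continuous_on UNIV g \<Longrightarrow> integrable lborel (\<lambda>y. f y * g (x - y))"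
  by (rule cont_supp_integrable[OF cont_supp_conv_integrand])

lemma cont_supp_dilate:
  assumes "cont_supp r f" "t > 0" shows "cont_supp (t * r) (dilate f t)"
  using assms unfolding cont_supp_def dilate_def
  by (auto intro!: continuous_on_compose2[of UNIV f] continuous_intros simp: field_simps)

lemma integral_dilate:
  fixes f :: "real^'n \<Rightarrow> real"
  assumes [measurable]: "f \<in> borel_measurable borel" and "t > 0"
  shows "(LINT x|lborel. dilate f t x) = (LINT x|lborel. f x)"
proof -
  have "dilate f t \<in> borel_measurable borel" unfolding dilate_def by measurable
  then have "(LINT x|lborel. dilate f t x) = t ^ CARD('n) * (LINT x|lborel. dilate f t (0 + t *\<^sub>R x))"
    using integral_lborel_affine[of "dilate f t" t 0] \<open>t > 0\<close> by simp
  also have "\<dots> = (LINT x|lborel. f x)"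
    using \<open>t > 0\<close> by (simp add: dilate_def)
  finally show ?thesis .
qed

lemma abs_dilate: "t > 0 \<Longrightarrow> \<bar>dilate f t x\<bar> = dilate (\<lambda>x. \<bar>f x\<bar>) t x"
  by (simp add: dilate_def)

lemma integral_reflect:
  fixes f :: "real^'n \<Rightarrow> real"
  assumes "f \<in> borel_measurable borel"
  shows "(LINT y|lborel. f (x - y)) = (LINT y|lborel. f y)"
  using integral_lborel_affine[OF assms, of "-1" x] by simp

lemma convolve_commute:
  fixes f g :: "real^'n \<Rightarrow> real"
  assumes "f \<in> borel_measurable borel" "g \<in> borel_measurable borel"
  shows "convolve f g = convolve g f"
proof
  fix x
  have [measurable]: "f \<in> borel_measurable borel" "g \<in> borel_measurable borel" by fact+
  have "(LINT y|lborel. f y * g (x - y)) = (LINT y|lborel. f (x - y) * g (x - (x - y)))"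
    by (subst integral_reflect[of "\<lambda>y. f y * g (x - y)" x]) auto
  then show "convolve f g x = convolve g f x" by (simp add: convolve_def mult.commute)
qed

lemma convolve_bound:
  assumes f: "cont_supp r f" and g: "continuous_on UNIV g"
    and B: "\<And>y. norm y \<le> r \<Longrightarrow> \<bar>g (x - y)\<bar> \<le> B"
  shows "\<bar>convolve f g x\<bar> \<le> B * (LINT y|lborel. \<bar>f y\<bar>)"
proof -
  have "\<bar>convolve f g x\<bar> \<le> (LINT y|lborel. \<bar>f y * g (x - y)\<bar>)"
    unfolding convolve_def by (rule integral_abs_bound)
  also have "\<dots> \<le> (LINT y|lborel. B * \<bar>f y\<bar>)"
  proof (rule integral_mono)
    show "integrable lborel (\<lambda>y. \<bar>f y * g (x - y)\<bar>)"
      using conv_integrable[OF f g] by (rule integrable_abs)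
    show "integrable lborel (\<lambda>y. B * \<bar>f y\<bar>)"
      using cont_supp_integrable[OF f] by simp
    show "\<bar>f y * g (x - y)\<bar> \<le> B * \<bar>f y\<bar>" for y
      using B[of y] cont_supp_zero[OF f, of y] 
      by (cases "norm y \<le> r") (auto simp: abs_mult mult.commute[of "\<bar>f y\<bar>"] intro: mult_right_mono)
  qed
  finally show ?thesis by simp
qed

lemma cont_supp_uniformly_continuous:
  fixes f :: "real^'n \<Rightarrow> real"
  assumes "cont_supp r f" "e > 0"
  obtains d where "d > 0" "\<And>x y. norm (x - y) < d \<Longrightarrow> \<bar>f x - f y\<bar> < e"
proof -
  have "uniformly_continuous_on (cball 0 (r + 1)) f"
    by (intro compact_uniformly_continuous cont_supp_continuous[OF assms(1)] compact_cball)
  then obtain d where d: "d > 0" "\<And>x y. x \<in> cball 0 (r + 1) \<Longrightarrow> y \<in> cball 0 (r + 1) \<Longrightarrow>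
      dist y x < d \<Longrightarrow> dist (f y) (f x) < e"
    using \<open>e > 0\<close> unfolding uniformly_continuous_on_def by metis
  show ?thesis
  proof (rule that[of "min d 1"])
    show "min d 1 > 0" using d by simp
    fix x y :: "real^'n" assume xy: "norm (x - y) < min d 1"
    show "\<bar>f x - f y\<bar> < e"
    proof (cases "norm x \<le> r + 1 \<and> norm y \<le> r + 1")
      case True
      then show ?thesis using d(2)[of y x] xy by (auto simp: dist_norm dist_real_def)
    next
      case False
      have "\<bar>norm x - norm y\<bar> < 1"
        using norm_triangle_ineq3[of x y] xy by linarith
      then have "f x = 0" "f y = 0" using False cont_supp_zero[OF assms(1)] by force+
      then show ?thesis using \<open>e > 0\<close> by simp
    qed
  qed
qed

lemma cont_supp_convolve:
  fixes f g :: "real^'n \<Rightarrow> real"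
  assumes f: "cont_supp r f" and g: "cont_supp s g"
  shows "cont_supp (r + s) (convolve f g)"
  unfolding cont_supp_def
proof safe
  let ?I = "LINT y|lborel. \<bar>f y\<bar>"
  have I: "?I \<ge> 0" by simp
  show "continuous_on UNIV (convolve f g)"
    unfolding continuous_on_iff
  proof safe
    fix x :: "real^'n" and e :: real assume e: "e > 0"
    \<comment> \<open>The \<open>+ 1\<close> keeps the divisor positive when \<open>f\<close>
      vanishes identically, and later gives the strict inequality.\<close>
    obtain d where d: "d > 0" "\<And>x y. norm (x - y) < d \<Longrightarrow> \<bar>g x - g y\<bar> < e / (?I + 1)"
      using cont_supp_uniformly_continuous[OF g, of "e / (?I + 1)"] e I by (metis add_nonneg_pos divide_pos_pos zero_less_one)
    show "\<exists>d>0. \<forall>x'\<in>UNIV. dist x' x < d \<longrightarrow> dist (convolve f g x') (convolve f g x) < e"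
    proof (intro exI conjI ballI impI)
      fix x' assume x': "dist x' x < d"
      have "convolve f g x' - convolve f g x = convolve f (\<lambda>z. g (z + (x' - x)) - g z) x"
        unfolding convolve_def
        by (subst Bochner_Integration.integral_diff[symmetric])
           (use conv_integrable[OF f cont_supp_continuous[OF g]] in \<open>auto simp: algebra_simps\<close>)
      moreover have "\<bar>convolve f (\<lambda>z. g (z + (x' - x)) - g z) x\<bar> \<le> e / (?I + 1) * ?I"
      proof (rule convolve_bound[OF f])
        show "continuous_on UNIV (\<lambda>z. g (z + (x' - x)) - g z)"
          by (auto intro!: continuous_on_compose2[OF cont_supp_continuous[OF g, of UNIV]] cont_supp_continuous[OF g] continuous_intros)
        show "\<bar>g (x - y + (x' - x)) - g (x - y)\<bar> \<le> e / (?I + 1)" for y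
          using d(2)[of "x - y + (x' - x)" "x - y"] x' by (auto simp: dist_norm)
      qed
      moreover have "e / (?I + 1) * ?I < e"
        using e I add_nonneg_pos[OF I zero_less_one] by (simp add: divide_less_eq algebra_simps)
      ultimately show "dist (convolve f g x') (convolve f g x) < e"
        by (simp add: dist_real_def)
    qed (fact d(1))
  qed
next
  fix x assume nz: "convolve f g x \<noteq> 0"
  show "norm x \<le> r + s"
  proof (rule ccontr)
    assume x: "\<not> norm x \<le> r + s"
    have "f y * g (x - y) = 0" for y
    proof (cases "norm y \<le> r")
      case True
      then have "norm (x - y) > s" using x norm_triangle_ineq2[of x y] by linarith
      then show ?thesis using cont_supp_zero[OF g] by simp
    qed (use cont_supp_zero[OF f] in simp)
    then have "convolve f g x = (LINT y::real^'n|lborel. 0)"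
      by (simp only: convolve_def)
    then show False using nz by simp
  qed
qed

lemma convolve_assoc:
  fixes f g h :: "real^'n \<Rightarrow> real"
  assumes f: "cont_supp r f" and g: "cont_supp s g" and h: "cont_supp u h"
  shows "convolve (convolve f g) h = convolve f (convolve g h)"
proof
  fix x
  let ?F = "\<lambda>(y, z). f z * g (y - z) * h (x - y)"
  have cont: "continuous_on UNIV ?F"
    unfolding case_prod_beta
    by (intro continuous_intros continuous_on_compose2[OF cont_supp_continuous[OF f, of UNIV]]
        continuous_on_compose2[OF cont_supp_continuous[OF g, of UNIV]] continuous_on_compose2[OF cont_supp_continuous[OF h, of UNIV]]) auto
  \<comment> \<open>Fubini needs joint integrability. The integrand is continuous and vanishes off
    the product of balls, because \<open>f\<close> confines \<open>z\<close> and then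
    \<open>g\<close> confines \<open>y\<close>.\<close>
  have "integrable lborel (\<lambda>p. indicator (cball 0 (r + s) \<times> cball 0 r) p *\<^sub>R ?F p)"
    by (intro borel_integrable_compact compact_Times compact_cball continuous_on_subset[OF cont]) auto
  also have "(\<lambda>p. indicator (cball 0 (r + s) \<times> cball 0 r) p *\<^sub>R ?F p) = ?F"
  proof
    fix p :: "(real^'n) \<times> (real^'n)"
    obtain y z where p: "p = (y, z)" by (cases p)
    have "norm z \<le> r" "norm y \<le> r + s" if "f z \<noteq> 0" "g (y - z) \<noteq> 0"
    proof -
      show 1: "norm z \<le> r" using that f by (auto simp: cont_supp_def)
      have "norm (y - z) \<le> s" using that g by (auto simp: cont_supp_def)
      then show "norm y \<le> r + s" using 1 norm_triangle_ineq2[of y z] by linarith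
    qed
    then show "indicator (cball 0 (r + s) \<times> cball 0 r) p *\<^sub>R ?F p = ?F p"
      by (auto simp: p indicator_def)
  qed
  finally have int: "integrable (lborel \<Otimes>\<^sub>M lborel) ?F" by (simp add: lborel_prod)
  have "convolve (convolve f g) h x = (LINT y|lborel. LINT z|lborel. f z * g (y - z) * h (x - y))"
    unfolding convolve_def by simp
  also have "\<dots> = (LINT z|lborel. LINT y|lborel. f z * g (y - z) * h (x - y))"
    by (rule lborel_pair.Fubini_integral[OF int, symmetric])
  also have "\<dots> = (LINT z|lborel. f z * (LINT y|lborel. g y * h (x - z - y)))"
  proof (rule Bochner_Integration.integral_cong[OF refl])
    fix z
    have [measurable]: "g \<in> borel_measurable borel" "h \<in> borel_measurable borel"
      using g h by measurable
    have "(LINT y|lborel. g (y - z) * h (x - y)) = (LINT y|lborel. g y * h (x - z - y))"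
      using integral_lborel_affine[of "\<lambda>y. g (y - z) * h (x - y)" 1 z] by (simp add: diff_diff_eq)
    then show "(LINT y|lborel. f z * g (y - z) * h (x - y)) = f z * (LINT y|lborel. g y * h (x - z - y))"
      by (simp add: mult.assoc)
  qed
  finally show "convolve (convolve f g) h x = convolve f (convolve g h) x"
    by (simp add: convolve_def)
qed

lemma dilate_convolve:
  fixes f g :: "real^'n \<Rightarrow> real"
  assumes [measurable]: "f \<in> borel_measurable borel" "g \<in> borel_measurable borel" and t: "t > 0"
  shows "dilate (convolve f g) t = convolve (dilate f t) (dilate g t)"
proof
  fix x
  have "(LINT y|lborel. dilate f t y * dilate g t (x - y)) =
      t ^ CARD('n) * (LINT y|lborel. dilate f t (t *\<^sub>R y) * dilate g t (x - t *\<^sub>R y))"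
    using integral_lborel_affine[of "\<lambda>y. dilate f t y * dilate g t (x - y)" t 0] t
    by (simp add: dilate_def)
  also have "(\<lambda>y. dilate f t (t *\<^sub>R y) * dilate g t (x - t *\<^sub>R y)) =
      (\<lambda>y. (f y * g (x /\<^sub>R t - y)) / (t ^ CARD('n) * t ^ CARD('n)))"
    using t by (simp add: dilate_def scaleR_diff_right)
  finally show "dilate (convolve f g) t x = convolve (dilate f t) (dilate g t) x"
    using t by (simp add: dilate_def convolve_def)
qed

lemma dilate_dilate: "s > 0 \<Longrightarrow> t > 0 \<Longrightarrow> dilate (dilate f s) t = dilate f (s * t)"
  by (simp add: dilate_def fun_eq_iff power_mult_distrib mult.commute)

lemma dilate_diff: "dilate (\<lambda>x. f x - g x) t = (\<lambda>x. dilate f t x - dilate g t x)"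
  by (simp add: dilate_def fun_eq_iff diff_divide_distrib)

lemma convolve_diff_right:
  assumes "cont_supp r f" "continuous_on UNIV g" "continuous_on UNIV h"
  shows "convolve f (\<lambda>x. g x - h x) x = convolve f g x - convolve f h x"
  unfolding convolve_def
  by (subst Bochner_Integration.integral_diff[symmetric])
     (use assms conv_integrable in \<open>auto simp: right_diff_distrib\<close>)

lemma convolve_sum_left:
  assumes "\<And>i. i \<in> A \<Longrightarrow> cont_supp r (f i)" "continuous_on UNIV g"
  shows "convolve (\<lambda>y. \<Sum>i\<in>A. f i y) g x = (\<Sum>i\<in>A. convolve (f i) g x)"
  unfolding convolve_def sum_distrib_right
  by (rule Bochner_Integration.integral_sum) (use assms conv_integrable in blast)

lemma convolve_cmult_left: "convolve (\<lambda>y. c * f y) g x = c * convolve f g x"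
  unfolding convolve_def by (simp add: mult.assoc)

section \<open>Smooth functions\<close>

lemma partial_eq:
  assumes "(f has_derivative D) (at x)" shows "partial j f x = D (axis j 1)"
  using frechet_derivative_at[OF assms] by (simp add: partial_def)

lemma has_derivative_partial:
  fixes f :: "real^'n \<Rightarrow> real"
  assumes "f differentiable (at x)"
  shows "(f has_derivative (\<lambda>h. \<Sum>j\<in>UNIV. h $ j * partial j f x)) (at x)"
proof -
  let ?D = "frechet_derivative f (at x)"
  have D: "(f has_derivative ?D) (at x)"
    using assms frechet_derivative_works by blast
  interpret linear ?D by (rule has_derivative_linear[OF D])
  have "?D h = (\<Sum>j\<in>UNIV. h $ j * partial j f x)" for h
  proof -
    have "?D h = ?D (\<Sum>j\<in>UNIV. h $ j *\<^sub>R axis j 1)"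
      using basis_expansion[of h] by (simp add: scalar_mult_eq_scaleR)
    then show ?thesis by (simp add: sum scale partial_def)
  qed
  then show ?thesis using D by (metis (no_types, lifting) ext)
qed

lemma partial_add:
  "f differentiable (at x) \<Longrightarrow> g differentiable (at x) \<Longrightarrow>
    partial j (\<lambda>x. f x + g x) x = partial j f x + partial j g x"
  unfolding partial_def frechet_derivative_works
  by (subst frechet_derivative_at[symmetric], rule has_derivative_add) auto

lemma partial_cmult:
  "f differentiable (at x) \<Longrightarrow> partial j (\<lambda>x. c * f x) x = c * partial j f x"
  unfolding partial_def frechet_derivative_works
  by (subst frechet_derivative_at[symmetric], rule has_derivative_mult_right) auto

lemma partial_mult:
  "f differentiable (at x) \<Longrightarrow> g differentiable (at x) \<Longrightarrow>
    partial j (\<lambda>x. f x * g x) x = f x * partial j g x + partial j f x * g x"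
  unfolding partial_def frechet_derivative_works
  by (subst frechet_derivative_at[symmetric], rule has_derivative_mult) auto

lemma has_derivative_affine:
  assumes "(f has_derivative D) (at (b + c *\<^sub>R x))"
  shows "((\<lambda>x. f (b + c *\<^sub>R x)) has_derivative (\<lambda>h. D (c *\<^sub>R h))) (at x)"
proof -
  have "((\<lambda>x. b + c *\<^sub>R x) has_derivative (\<lambda>h. c *\<^sub>R h)) (at x)"
    by (auto intro!: derivative_eq_intros)
  from has_derivative_compose[OF this assms] show ?thesis .
qed

lemma partial_affine:
  fixes f :: "real^'n \<Rightarrow> real"
  assumes "f differentiable (at (b + c *\<^sub>R x))"
  shows "partial j (\<lambda>x. f (b + c *\<^sub>R x)) x = c * partial j f (b + c *\<^sub>R x)"
  using partial_eq[OF has_derivative_affine[OF has_derivative_partial[OF assms]], of j]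
  by (simp add: axis_def if_distrib if_distribR cong: if_cong)

text \<open>\<open>C_k (Suc k)\<close> does not mention continuity of \<open>f\<close> itself; at
  the base of the induction it is supplied by differentiability.\<close>

lemma C_k_SucD: "C_k (Suc k) f \<Longrightarrow> C_k k f"
proof (induction k arbitrary: f)
  case 0
  then show ?case
    by (auto intro!: differentiable_imp_continuous_on simp: differentiable_on_def)
next
  case (Suc k) then show ?case by auto
qed

lemma C_k_add: "C_k k f \<Longrightarrow> C_k k g \<Longrightarrow> C_k k (\<lambda>x. f x + g x)"
proof (induction k arbitrary: f g)
  case (Suc k)
  then have "partial j (\<lambda>x. f x + g x) = (\<lambda>x. partial j f x + partial j g x)" for j
    by (auto simp: partial_add)
  then show ?case using Suc by auto
qed (auto intro: continuous_intros)

lemma C_k_cmult: "C_k k f \<Longrightarrow> C_k k (\<lambda>x. c * f x)"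
proof (induction k arbitrary: f)
  case (Suc k)
  then have "partial j (\<lambda>x. c * f x) = (\<lambda>x. c * partial j f x)" for j
    by (auto simp: partial_cmult)
  then show ?case using Suc by auto
qed (auto intro: continuous_intros)

lemma C_k_mult: "C_k k f \<Longrightarrow> C_k k g \<Longrightarrow> C_k k (\<lambda>x. f x * g x)"
proof (induction k arbitrary: f g)
  case (Suc k)
  then have "partial j (\<lambda>x. f x * g x) = (\<lambda>x. f x * partial j g x + partial j f x * g x)" for j
    by (auto simp: partial_mult)
  moreover have "C_k k f" "C_k k g" using Suc.prems C_k_SucD by blast+
  ultimately show ?case using Suc by (auto intro!: C_k_add)
qed (auto intro: continuous_intros)

lemma differentiable_affine:
  "f differentiable (at (b + c *\<^sub>R x)) \<Longrightarrow> (\<lambda>x. f (b + c *\<^sub>R x)) differentiable (at x)"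
  unfolding differentiable_def using has_derivative_affine by blast

lemma C_k_affine: "C_k k f \<Longrightarrow> C_k k (\<lambda>x. f (b + c *\<^sub>R x))"
proof (induction k arbitrary: f)
  case 0
  then show ?case by (auto intro!: continuous_on_compose2[of UNIV f] continuous_intros)
next
  case (Suc k)
  then have "partial j (\<lambda>x. f (b + c *\<^sub>R x)) = (\<lambda>x. c * partial j f (b + c *\<^sub>R x))" for j
    by (auto simp: partial_affine)
  then show ?case using Suc by (auto intro!: C_k_cmult differentiable_affine)
qed

definition smooth :: "(real^'n \<Rightarrow> real) \<Rightarrow> bool" where
  "smooth f \<longleftrightarrow> (\<forall>k. C_k k f)"

lemma smooth_differentiable: "smooth f \<Longrightarrow> f differentiable (at x)"
  unfolding smooth_def by (metis C_k.simps(2))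

lemma smooth_partial: "smooth f \<Longrightarrow> smooth (partial j f)"
  unfolding smooth_def by (metis C_k.simps(2))

lemma smooth_continuous: "smooth f \<Longrightarrow> continuous_on A f"
  unfolding smooth_def by (metis C_k.simps(1) continuous_on_subset subset_UNIV)

lemma smooth_add: "smooth f \<Longrightarrow> smooth g \<Longrightarrow> smooth (\<lambda>x. f x + g x)"
  and smooth_cmult: "smooth f \<Longrightarrow> smooth (\<lambda>x. c * f x)"
  and smooth_mult: "smooth f \<Longrightarrow> smooth g \<Longrightarrow> smooth (\<lambda>x. f x * g x)"
  and smooth_affine: "smooth f \<Longrightarrow> smooth (\<lambda>x. f (b + c *\<^sub>R x))"
  by (auto simp: smooth_def C_k_add C_k_cmult C_k_mult C_k_affine)

lemma smooth_diff: "smooth f \<Longrightarrow> smooth g \<Longrightarrow> smooth (\<lambda>x. f x - g x)"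
  using smooth_add[of f "\<lambda>x. -1 * g x"] smooth_cmult[of g "-1"] by simp

lemma smooth_sum:
  fixes f :: "'i \<Rightarrow> real^'n \<Rightarrow> real"
  shows "finite A \<Longrightarrow> (\<And>i. i \<in> A \<Longrightarrow> smooth (f i)) \<Longrightarrow> smooth (\<lambda>x. \<Sum>i\<in>A. f i x)"
proof (induction A rule: finite_induct)
  case empty
  have "C_k k (\<lambda>x::real^'n. 0)" for k
  proof (induction k)
    case (Suc k)
    have "partial j (\<lambda>x::real^'n. 0) = (\<lambda>x. 0)" for j
      using partial_eq[OF has_derivative_const] by auto
    then show ?case using Suc by simp
  qed simp
  then show ?case by (simp add: smooth_def)
qed (auto intro: smooth_add)

lemma partial_sum:
  "finite A \<Longrightarrow> (\<And>i. i \<in> A \<Longrightarrow> smooth (f i)) \<Longrightarrow>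
    partial j (\<lambda>x. \<Sum>i\<in>A. f i x) x = (\<Sum>i\<in>A. partial j (f i) x)"
proof (induction A rule: finite_induct)
  case empty
  then show ?case using partial_eq[OF has_derivative_const] by auto
qed (auto simp: partial_add smooth_differentiable smooth_sum)

lemma cont_supp_partial:
  assumes "smooth f" "cont_supp r f" shows "cont_supp r (partial j f)"
  unfolding cont_supp_alt
proof safe
  show "continuous_on UNIV (partial j f)"
    using assms smooth_partial smooth_continuous by blast
  fix x :: "real^'a" assume x: "r < norm x"
  have "((\<lambda>x. 0) has_derivative (\<lambda>h. 0)) (at x)" by simp
  then have "(f has_derivative (\<lambda>h. 0)) (at x)"
    by (rule has_derivative_transform_within_open[where s = "- cball 0 r"])
       (use x cont_supp_zero[OF assms(2)] in \<open>auto simp: not_le\<close>)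
  then show "partial j f x = 0" by (rule partial_eq)
qed

section \<open>Mean value and Taylor estimates, differentiation of convolutions\<close>

lemma smooth_mvt:
  fixes f :: "real^'n \<Rightarrow> real"
  assumes "smooth f"
  obtains \<theta> where "0 < \<theta>" "\<theta> < 1"
    "f (x + h) - f x = (\<Sum>j\<in>UNIV. h $ j * partial j f (x + \<theta> *\<^sub>R h))"
proof -
  have D: "((\<lambda>\<theta>. f (x + \<theta> *\<^sub>R h)) has_real_derivative (\<Sum>j\<in>UNIV. h $ j * partial j f (x + \<theta> *\<^sub>R h))) (at \<theta>)" for \<theta>
  proof -
    have "((\<lambda>\<theta>. x + \<theta> *\<^sub>R h) has_derivative (\<lambda>s. s *\<^sub>R h)) (at \<theta>)"
      by (auto intro!: derivative_eq_intros)
    from has_derivative_compose[OF this has_derivative_partial[OF smooth_differentiable[OF assms]]]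
    show ?thesis
      unfolding has_field_derivative_def
      by (rule has_derivative_eq_rhs) (auto simp: fun_eq_iff sum_distrib_left mult_ac)
  qed
  have "\<exists>z>0. z < 1 \<and> f (x + 1 *\<^sub>R h) - f (x + 0 *\<^sub>R h) =
      (1 - 0) * (\<Sum>j\<in>UNIV. h $ j * partial j f (x + z *\<^sub>R h))"
    by (rule MVT2) (use D in auto)
  then show ?thesis using that by auto
qed

lemma sum_component_le:
  fixes h :: "real^'n"
  assumes "\<And>j. \<bar>a j\<bar> \<le> B"
  shows "\<bar>\<Sum>j\<in>UNIV. h $ j * a j\<bar> \<le> real CARD('n) * B * norm h"
proof -
  have "\<bar>\<Sum>j\<in>UNIV. h $ j * a j\<bar> \<le> (\<Sum>j\<in>(UNIV::'n set). norm h * B)"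
    by (rule order_trans[OF sum_abs], rule sum_mono)
       (auto simp: abs_mult component_le_norm_cart intro!: mult_mono assms)
  also have "\<dots> = real CARD('n) * B * norm h" by simp
  finally show ?thesis .
qed

lemma smooth_lipschitz:
  fixes f :: "real^'n \<Rightarrow> real"
  assumes "smooth f" and B: "\<And>j x. \<bar>partial j f x\<bar> \<le> B"
  shows "\<bar>f (x + h) - f x\<bar> \<le> real CARD('n) * B * norm h"
proof -
  obtain \<theta> where "f (x + h) - f x = (\<Sum>j\<in>UNIV. h $ j * partial j f (x + \<theta> *\<^sub>R h))"
    using smooth_mvt[OF assms(1)] by metis
  then show ?thesis using sum_component_le[of "\<lambda>j. partial j f (x + \<theta> *\<^sub>R h)" B h] B by simp
qed

lemma partials_bounded:
  fixes f :: "real^'n \<Rightarrow> real"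
  assumes "smooth f" "cont_supp r f"
  obtains B where "B \<ge> 0" "\<And>j x. \<bar>partial j f x\<bar> \<le> B"
proof -
  have "\<exists>B. \<forall>j. B j \<ge> 0 \<and> (\<forall>x. \<bar>partial j f x\<bar> \<le> B j)"
    by (rule choice) (metis assms cont_supp_bounded cont_supp_partial)
  then obtain B where B: "\<And>j. B j \<ge> 0" "\<And>j x. \<bar>partial j f x\<bar> \<le> B j" by blast
  show ?thesis
  proof (rule that)
    show "sum B UNIV \<ge> 0" by (simp add: B sum_nonneg)
    show "\<bar>partial j f x\<bar> \<le> sum B UNIV" for j x
      using B(2)[of j x] member_le_sum[of j UNIV B] B(1) by force
  qed
qed

text \<open>The mean value theorem is applied to \<open>f\<close> and a Lipschitz bound to its
  partial derivatives. What matters is that \<open>B\<close> is uniform in \<open>x\<close>: the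
  remainder can then be integrated against any kernel.\<close>

lemma taylor_quadratic:
  fixes f :: "real^'n \<Rightarrow> real"
  assumes f: "smooth f" "cont_supp r f"
  obtains B where "B \<ge> 0"
    "\<And>x h. \<bar>f (x + h) - f x - (\<Sum>j\<in>UNIV. h $ j * partial j f x)\<bar> \<le> B * (norm h)\<^sup>2"
proof -
  let ?n = "real CARD('n)"
  have "\<exists>B. \<forall>j. B j \<ge> 0 \<and> (\<forall>i x. \<bar>partial i (partial j f) x\<bar> \<le> B j)"
    by (rule choice) (metis f cont_supp_partial smooth_partial partials_bounded)
  then obtain B where B: "\<And>j. B j \<ge> 0" "\<And>j i x. \<bar>partial i (partial j f) x\<bar> \<le> B j" by blast
  define C where "C = sum B UNIV"
  have C: "C \<ge> 0" "B j \<le> C" for j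
    unfolding C_def using B(1) by (auto simp: sum_nonneg intro: member_le_sum)
  show ?thesis
  proof (rule that)
    show "?n * (?n * C) \<ge> 0" using C by simp
    fix x h
    obtain \<theta> where \<theta>: "0 < \<theta>" "\<theta> < 1" "f (x + h) - f x = (\<Sum>j\<in>UNIV. h $ j * partial j f (x + \<theta> *\<^sub>R h))"
      using smooth_mvt[OF f(1)] by metis
    have "\<bar>partial j f (x + \<theta> *\<^sub>R h) - partial j f x\<bar> \<le> ?n * C * norm h" for j
    proof -
      have "\<bar>partial j f (x + \<theta> *\<^sub>R h) - partial j f x\<bar> \<le> ?n * C * norm (\<theta> *\<^sub>R h)"
        by (rule smooth_lipschitz[OF smooth_partial[OF f(1)]]) (meson B(2) C(2) order_trans)
      also have "\<dots> \<le> ?n * C * norm h"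
        using \<theta> C by (intro mult_left_mono) (auto simp: mult_left_le_one_le)
      finally show ?thesis .
    qed
    then have "\<bar>\<Sum>j\<in>UNIV. h $ j * (partial j f (x + \<theta> *\<^sub>R h) - partial j f x)\<bar> \<le> ?n * (?n * C * norm h) * norm h"
      by (rule sum_component_le)
    then show "\<bar>f (x + h) - f x - (\<Sum>j\<in>UNIV. h $ j * partial j f x)\<bar> \<le> ?n * (?n * C) * (norm h)\<^sup>2"
      by (simp add: \<theta>(3) sum_subtractf right_diff_distrib power2_eq_square mult.assoc)
  qed
qed

text \<open>Convolving the uniform quadratic Taylor remainder of \<open>f\<close> with
  \<open>g\<close> leaves a remainder of order |h|^2, so no limit has to be exchanged with the
  integral. All derivatives fall on \<open>f\<close>, which is why continuity of \<open>g\<close> is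
  enough.\<close>

lemma convolve_has_derivative:
  fixes f g :: "real^'n \<Rightarrow> real"
  assumes f: "smooth f" "cont_supp r f" and g: "cont_supp s g"
  shows "(convolve f g has_derivative (\<lambda>h. \<Sum>j\<in>UNIV. h $ j * convolve (partial j f) g x)) (at x)"
proof -
  let ?I = "LINT y|lborel. \<bar>g y\<bar>"
  let ?D = "\<lambda>h. \<Sum>j\<in>UNIV. h $ j * convolve (partial j f) g x"
  obtain B where B: "B \<ge> 0"
    "\<And>x h. \<bar>f (x + h) - f x - (\<Sum>j\<in>UNIV. h $ j * partial j f x)\<bar> \<le> B * (norm h)\<^sup>2"
    using taylor_quadratic[OF f] by metis
  have comm: "convolve k g = convolve g k" if "continuous_on UNIV k" for k
    using convolve_commute[of k g] that cont_supp_measurable[OF g] borel_measurable_continuous_onI by blast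
  have cf: "continuous_on UNIV f" "continuous_on UNIV (partial j f)" for j
    using f smooth_partial smooth_continuous by blast+
  have est: "\<bar>convolve f g (x + h) - convolve f g x - ?D h\<bar> \<le> B * ?I * (norm h)\<^sup>2" for h
  proof -
    let ?k = "\<lambda>z. f (z + h) - f z - (\<Sum>j\<in>UNIV. h $ j * partial j f z)"
    have ck: "continuous_on UNIV ?k"
      by (intro continuous_intros cf continuous_on_compose2[OF cf(1)]) auto
    have "convolve g ?k x = (LINT y|lborel. g y * f (x + h - y) - g y * f (x - y) -
        (\<Sum>j\<in>UNIV. h $ j * (g y * partial j f (x - y))))"
      unfolding convolve_def
      by (intro Bochner_Integration.integral_cong) (auto simp: algebra_simps sum_distrib_left)
    also have "\<dots> = convolve g f (x + h) - convolve g f x - (\<Sum>j\<in>UNIV. h $ j * convolve g (partial j f) x)"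
      unfolding convolve_def using conv_integrable[OF g cf(1)] conv_integrable[OF g cf(2)] by simp
    finally have "convolve f g (x + h) - convolve f g x - ?D h = convolve g ?k x"
      using comm cf by simp
    moreover have "\<bar>convolve g ?k x\<bar> \<le> B * (norm h)\<^sup>2 * ?I"
      by (rule convolve_bound[OF g ck B(2)])
    ultimately show ?thesis by (simp add: mult.commute mult.left_commute)
  qed
  show ?thesis
    unfolding has_derivative_at
  proof
    show "bounded_linear ?D"
      by (intro bounded_linear_sum bounded_linear_mult_const bounded_linear_vec_nth)
    show "(\<lambda>h. norm (convolve f g (x + h) - convolve f g x - ?D h) / norm h) \<midarrow>0\<rightarrow> 0"
    proof (rule Lim_null_comparison)
      show "\<forall>\<^sub>F h in at 0. norm (norm (convolve f g (x + h) - convolve f g x - ?D h) / norm h) \<le> B * ?I * norm h"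
        unfolding eventually_at_filter
        by (rule always_eventually) (use est in \<open>auto simp: divide_le_eq power2_eq_square mult.assoc\<close>)
      show "((\<lambda>h::real^'n. B * ?I * norm h) \<longlongrightarrow> 0) (at 0)"
        by (auto intro!: tendsto_eq_intros)
    qed
  qed
qed

lemma partial_convolve:
  fixes f g :: "real^'n \<Rightarrow> real"
  assumes "smooth f" "cont_supp r f" "cont_supp s g"
  shows "partial j (convolve f g) x = convolve (partial j f) g x"
  using partial_eq[OF convolve_has_derivative[OF assms], of j]
  by (simp add: axis_def if_distrib if_distribR cong: if_cong)

text \<open>By commutativity both sides are the \<open>j\<close>-th derivative of the same
  convolution; this takes the place of integration by parts.\<close>

lemma convolve_partial_swap:
  fixes f g :: "real^'n \<Rightarrow> real"
  assumes "smooth f" "cont_supp r f" "smooth g" "cont_supp s g"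
  shows "convolve (partial j f) g = convolve f (partial j g)"
proof
  fix x
  have m: "f \<in> borel_measurable borel" "g \<in> borel_measurable borel" "partial j g \<in> borel_measurable borel"
    using assms cont_supp_measurable cont_supp_partial by blast+
  have "convolve (partial j f) g x = partial j (convolve g f) x"
    using partial_convolve[OF assms(1,2,4)] convolve_commute[OF m(1,2)] by simp
  also have "\<dots> = convolve f (partial j g) x"
    using partial_convolve[OF assms(3,4,2)] convolve_commute[OF m(3,1)] by simp
  finally show "convolve (partial j f) g x = convolve f (partial j g) x" .
qed

lemma smooth_dilate: "smooth f \<Longrightarrow> smooth (dilate f t)"
  using smooth_cmult[OF smooth_affine[of f 0 "inverse t"], of "1 / t ^ CARD('a)"]
  by (simp add: dilate_def[abs_def])

lemma partial_dilate:
  fixes f :: "real^'n \<Rightarrow> real"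
  assumes "smooth f" "t > 0"
  shows "partial j (dilate f t) = (\<lambda>x. dilate (partial j f) t x / t)"
proof
  fix x
  have "dilate f t = (\<lambda>x. (1 / t ^ CARD('n)) * f (0 + inverse t *\<^sub>R x))"
    by (simp add: dilate_def fun_eq_iff)
  then have "partial j (dilate f t) x = (1 / t ^ CARD('n)) * partial j (\<lambda>x. f (0 + inverse t *\<^sub>R x)) x"
    using partial_cmult differentiable_affine[OF smooth_differentiable[OF assms(1)]] by metis
  also have "\<dots> = (1 / t ^ CARD('n)) * (inverse t * partial j f (0 + inverse t *\<^sub>R x))"
    by (subst partial_affine) (use smooth_differentiable[OF assms(1)] in auto)
  finally show "partial j (dilate f t) x = dilate (partial j f) t x / t"
    by (simp add: dilate_def field_simps)
qed

lemma test_function_smooth: "test_function U f \<Longrightarrow> smooth f"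
  by (simp add: test_function_def smooth_def)

lemma supp_subset_iff: "closed S \<Longrightarrow> supp f \<subseteq> S \<longleftrightarrow> (\<forall>x. f x \<noteq> 0 \<longrightarrow> x \<in> S)"
  unfolding supp_def
  using closure_minimal[of "{x. f x \<noteq> 0}" S] closure_subset[of "{x. f x \<noteq> 0}"] by blast

lemma test_function_cc:
  assumes "test_function U f" obtains r where "r > 0" "cont_supp r f"
proof -
  have "bounded (supp f)" using assms compact_imp_bounded test_function_def by blast
  then obtain r where r: "r > 0" "supp f \<subseteq> cball 0 r"
    unfolding bounded_pos by (metis mem_cball_0 subset_iff)
  show ?thesis
  proof (rule that[OF r(1)])
    show "cont_supp r f"
      using r(2) smooth_continuous[OF test_function_smooth[OF assms]]
      by (auto simp: cont_supp_def supp_subset_iff)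
  qed
qed

lemma test_function_zero: "test_function U f \<Longrightarrow> x \<notin> U \<Longrightarrow> f x = 0"
  using closure_subset[of "{x. f x \<noteq> 0}"] by (auto simp: test_function_def supp_def)

section \<open>The Hardy--Littlewood maximal function\<close>

lemma epowr_ennreal: "x \<ge> 0 \<Longrightarrow> epowr (ennreal x) a = ennreal (x powr a)"
  by (simp add: epowr_def)

lemma epowr_zero: "epowr 0 a = 0"
  by (simp add: epowr_def)

lemma epowr_measurable [measurable]: "(\<lambda>x. epowr x a) \<in> borel_measurable borel"
  unfolding epowr_def by measurable

lemma epowr_mono:
  assumes "x \<le> y" "a \<ge> 0" shows "epowr x a \<le> epowr y a"
proof (cases y)
  case (real r)
  then obtain s where "x = ennreal s" "0 \<le> s" "s \<le> r"
    using assms(1) by (cases x) (auto simp: top_unique)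
  then show ?thesis using real assms by (auto simp: epowr_ennreal intro!: powr_mono2)
qed (simp add: epowr_def)

lemma epowr_epowr:
  assumes "a > 0" shows "epowr (epowr x a) b = epowr x (a * b)"
  by (cases x) (auto simp: epowr_def powr_powr)

lemma epowr_cmult:
  assumes "c > 0" shows "epowr (ennreal c * x) a = ennreal (c powr a) * epowr x a"
proof (cases x)
  case (real r)
  then show ?thesis using assms by (simp add: epowr_ennreal powr_mult flip: ennreal_mult)
next
  case top
  then show ?thesis using assms by (simp add: epowr_def ennreal_mult_top)
qed

lemma epowr_mult_self:
  assumes "b > 0" shows "x * epowr x b = epowr x (b + 1)"
proof (cases x)
  case (real r)
  then show ?thesis
    by (cases "r = 0") (simp_all add: epowr_ennreal epowr_zero powr_add mult.commute flip: ennreal_mult)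
next
  case top
  then show ?thesis by (simp add: epowr_def)
qed

lemma epowr_one: "epowr x 1 = x"
  by (cases x) (auto simp: epowr_def)

text \<open>After division by \<open>r + s\<close> both summands lie in [0,1], where t \<le> t^a,
  and they add up to 1.\<close>

lemma epowr_add_subadditive:
  assumes "0 < a" "a \<le> 1" shows "epowr (x + y) a \<le> epowr x a + epowr y a"
proof (cases "x = \<infinity> \<or> y = \<infinity>")
  case False
  then obtain r s where rs: "x = ennreal r" "y = ennreal s" "r \<ge> 0" "s \<ge> 0"
    by (cases x; cases y) auto
  have "(r + s) powr a \<le> r powr a + s powr a"
  proof (cases "r + s = 0")
    case True
    then show ?thesis using rs by (simp add: add_nonneg_eq_0_iff)
  next
    case False
    then have pos: "r + s > 0" using rs by simp
    have "t / (r + s) \<le> (t / (r + s)) powr a" if "0 \<le> t" "t \<le> r + s" for t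
      using powr_mono'[of a 1 "t / (r + s)"] that pos assms by simp
    moreover have "r / (r + s) + s / (r + s) = 1"
      using pos by (simp flip: add_divide_distrib)
    ultimately have "1 \<le> (r / (r + s)) powr a + (s / (r + s)) powr a"
      using rs by (smt (verit))
    then show ?thesis
      using rs pos by (simp add: powr_divide field_simps)
  qed
  then show ?thesis
    using rs by (simp add: epowr_ennreal flip: ennreal_plus)
qed (auto simp: epowr_def)

lemma epowr_sum_subadditive:
  assumes "0 < a" "a \<le> 1"
  shows "epowr (sum f A) a \<le> (\<Sum>i\<in>A. epowr (f i) a)"
proof (induction A rule: infinite_finite_induct)
  case (insert i A)
  then show ?case
    using epowr_add_subadditive[OF assms, of "f i" "sum f A"] by (simp add: order_trans add_left_mono)
qed (auto simp: epowr_zero)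

text \<open>A union bound over an arbitrary countable index set. The covering lemma delivers a
  countable set of centres, and integrating over \<open>count_space C\<close> avoids enumerating it,
  be it finite or infinite.\<close>

lemma emeasure_UN_le_count_space:
  assumes "countable C" "\<And>i. i \<in> C \<Longrightarrow> X i \<in> sets M"
  shows "emeasure M (\<Union>i\<in>C. X i) \<le> (\<integral>\<^sup>+i. emeasure M (X i) \<partial>count_space C)"
proof -
  have "emeasure M (\<Union>i\<in>C. X i) = (\<integral>\<^sup>+x. indicator (\<Union>i\<in>C. X i) x \<partial>M)"
    by (rule nn_integral_indicator[symmetric]) (use assms in auto)
  also have "\<dots> \<le> (\<integral>\<^sup>+x. \<integral>\<^sup>+i. indicator (X i) x \<partial>count_space C \<partial>M)"
  proof (intro nn_integral_mono)
    fix x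
    show "indicator (\<Union>i\<in>C. X i) x \<le> (\<integral>\<^sup>+i. indicator (X i) x \<partial>count_space C)"
    proof (cases "x \<in> (\<Union>i\<in>C. X i)")
      case True
      then obtain i where i: "i \<in> C" "x \<in> X i" by blast
      have "(\<integral>\<^sup>+j. indicator {i} j \<partial>count_space C) \<le> (\<integral>\<^sup>+j. indicator (X j) x \<partial>count_space C)"
        by (intro nn_integral_mono) (use i in \<open>auto simp: indicator_def\<close>)
      then show ?thesis using True i by simp
    qed simp
  qed
  also have "\<dots> = (\<integral>\<^sup>+i. \<integral>\<^sup>+x. indicator (X i) x \<partial>M \<partial>count_space C)"
    by (rule nn_integral_count_space_nn_integral) (use assms in auto)
  also have "\<dots> = (\<integral>\<^sup>+i. emeasure M (X i) \<partial>count_space C)"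
    by (intro nn_integral_cong nn_integral_indicator) (use assms in auto)
  finally show ?thesis .
qed

text \<open>Countable additivity of the measure \<open>density M f\<close>, followed by
  monotonicity.\<close>

lemma nn_integral_disjoint_le:
  assumes "countable C" "disjoint_family_on X C"
    and X: "\<And>i. i \<in> C \<Longrightarrow> X i \<in> sets M" "\<And>i. i \<in> C \<Longrightarrow> X i \<subseteq> Y" and Y: "Y \<in> sets M"
    and f [measurable]: "f \<in> borel_measurable M"
  shows "(\<integral>\<^sup>+i. (\<integral>\<^sup>+x\<in>X i. f x \<partial>M) \<partial>count_space C) \<le> (\<integral>\<^sup>+x\<in>Y. f x \<partial>M)"
proof -
  have "(\<integral>\<^sup>+i. (\<integral>\<^sup>+x\<in>X i. f x \<partial>M) \<partial>count_space C) = (\<integral>\<^sup>+i. emeasure (density M f) (X i) \<partial>count_space C)"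
    by (intro nn_integral_cong) (use X in \<open>auto simp: emeasure_density\<close>)
  also have "\<dots> = emeasure (density M f) (\<Union>i\<in>C. X i)"
    by (rule emeasure_UN_countable[symmetric]) (use assms in auto)
  also have "\<dots> \<le> emeasure (density M f) Y"
    by (rule emeasure_mono) (use X Y in auto)
  also have "\<dots> = (\<integral>\<^sup>+x\<in>Y. f x \<partial>M)"
    using Y by (simp add: emeasure_density)
  finally show ?thesis .
qed

text \<open>Normalised by \<open>r\<^sup>n\<close> instead of the volume of the ball.\<close>

definition hl :: "(real^'n \<Rightarrow> ennreal) \<Rightarrow> real^'n \<Rightarrow> ennreal" where
  "hl h x = (SUP r\<in>{0<..}. (\<integral>\<^sup>+y\<in>ball x r. h y \<partial>lborel) / ennreal (r ^ CARD('n)))"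

lemma ennreal_divide_le_iff':
  assumes "c > 0" shows "x / ennreal c \<le> y \<longleftrightarrow> x \<le> ennreal c * y"
proof -
  have "x / ennreal c \<le> y \<longleftrightarrow> ennreal c * (x / ennreal c) \<le> ennreal c * y"
    using assms by (simp add: ennreal_mult_le_mult_iff)
  also have "ennreal c * (x / ennreal c) = x"
    using assms by (simp add: ennreal_times_divide ennreal_mult_divide_eq mult.commute[of _ x])
  finally show ?thesis .
qed

lemma hl_le_iff:
  fixes h :: "real^'n \<Rightarrow> ennreal"
  shows "hl h x \<le> y \<longleftrightarrow> (\<forall>r>0. (\<integral>\<^sup>+z\<in>ball x r. h z \<partial>lborel) \<le> ennreal (r ^ CARD('n)) * y)"
  by (auto simp: hl_def SUP_le_iff ennreal_divide_le_iff')

lemma integral_ball_le_hl: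
  fixes h :: "real^'n \<Rightarrow> ennreal"
  assumes "r > 0" shows "(\<integral>\<^sup>+z\<in>ball x r. h z \<partial>lborel) \<le> ennreal (r ^ CARD('n)) * hl h x"
  using hl_le_iff[of h x "hl h x"] assms by blast

lemma less_hl_iff:
  fixes h :: "real^'n \<Rightarrow> ennreal"
  shows "y < hl h x \<longleftrightarrow> (\<exists>r>0. ennreal (r ^ CARD('n)) * y < (\<integral>\<^sup>+z\<in>ball x r. h z \<partial>lborel))"
  using hl_le_iff[of h x y] by (auto simp: not_le[symmetric])

text \<open>Lower semicontinuity, and hence measurability, of the maximal function. A strict
  inequality at radius \<open>r\<close> survives a slightly larger normalisation \<open>s\<close>,
  and \<open>ball x' s\<close> contains \<open>ball x r\<close> as soon as \<open>x'\<close> is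
  within \<open>s - r\<close> of \<open>x\<close>.\<close>

lemma open_less_hl:
  fixes h :: "real^'n \<Rightarrow> ennreal"
  shows "open {x. y < hl h x}"
  unfolding open_dist
proof
  fix x assume "x \<in> {x. y < hl h x}"
  then have "y < hl h x" by simp
  then obtain r where r: "r > 0" "ennreal (r ^ CARD('n)) * y < (\<integral>\<^sup>+z\<in>ball x r. h z \<partial>lborel)" (is "_ < ?I")
    using less_hl_iff by metis
  have y: "y < top" using \<open>y < hl h x\<close> by (meson less_le_trans top_greatest)
  have "((\<lambda>s. y * ennreal (s ^ CARD('n))) \<longlongrightarrow> y * ennreal (r ^ CARD('n))) (at_right r)"
    by (intro ennreal_tendsto_cmult y tendsto_ennrealI tendsto_intros)
  then have "\<forall>\<^sub>F s in at_right r. y * ennreal (s ^ CARD('n)) < ?I"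
    using r by (intro order_tendstoD) (auto simp: mult.commute)
  then have "\<forall>\<^sub>F s in at_right r. y * ennreal (s ^ CARD('n)) < ?I \<and> r < s"
    using eventually_at_right_less[of r] by eventually_elim auto
  then obtain s where s: "y * ennreal (s ^ CARD('n)) < ?I" "r < s"
    using eventually_happens'[OF trivial_limit_at_right_real] by blast
  show "\<exists>e>0. \<forall>x'. dist x' x < e \<longrightarrow> x' \<in> {x. y < hl h x}"
  proof (intro exI[of _ "s - r"] conjI allI impI)
    fix x' assume x': "dist x' x < s - r"
    have "ball x r \<subseteq> ball x' s"
    proof
      fix z assume "z \<in> ball x r"
      then show "z \<in> ball x' s" using x' dist_triangle[of x' z x] by auto
    qed
    then have "?I \<le> (\<integral>\<^sup>+z\<in>ball x' s. h z \<partial>lborel)"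
      by (intro nn_set_integral_set_mono) auto
    then have "y < hl h x'"
      unfolding less_hl_iff using s r by (intro exI[of _ s]) (auto simp: mult.commute)
    then show "x' \<in> {x. y < hl h x}" by simp
  qed (use s in auto)
qed

lemma hl_measurable [measurable]: "hl h \<in> borel_measurable borel"
proof (rule borel_measurableI_greater)
  show "{x \<in> space borel. y < hl h x} \<in> sets borel" for y
    using open_less_hl[of y h] by simp
qed

definition vol :: "'n itself \<Rightarrow> real" where
  "vol _ = unit_ball_vol (real CARD('n))"

lemma emeasure_ball_vol:
  "r \<ge> 0 \<Longrightarrow> emeasure lborel (ball (x :: real^'n) r) = ennreal (vol TYPE('n) * r ^ CARD('n))"
  by (simp add: emeasure_ball vol_def)

lemma vol_pos: "vol TYPE('n) > 0"
  by (simp add: vol_def)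

text \<open>Each point of the superlevel set is the centre of a ball of large mean. A disjoint
  subfamily whose fivefold enlargements still cover the set has total volume controlled by the
  integral of \<open>h\<close>.\<close>

lemma hl_weak:
  fixes h :: "real^'n \<Rightarrow> ennreal"
  assumes h [measurable]: "h \<in> borel_measurable borel" and l: "l > 0"
  shows "emeasure lborel {x. ennreal l < hl h x} \<le>
    ennreal (vol TYPE('n) * 5 ^ CARD('n) / l) * (\<integral>\<^sup>+x. h x \<partial>lborel)"
proof (cases "(\<integral>\<^sup>+x. h x \<partial>lborel) = \<infinity>")
  case True
  then show ?thesis using l vol_pos[where 'n='n] by (simp add: ennreal_mult_top)
next
  case False
  then obtain T where T: "T \<ge> 0" "(\<integral>\<^sup>+x. h x \<partial>lborel) = ennreal T"
    by (cases "(\<integral>\<^sup>+x. h x \<partial>lborel)") auto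
  let ?A = "{x. ennreal l < hl h x}"
  let ?I = "\<lambda>x r. \<integral>\<^sup>+z\<in>ball x r. h z \<partial>lborel"
  have "\<exists>r. r > 0 \<and> ennreal (r ^ CARD('n) * l) < ?I x r" if "x \<in> ?A" for x
    using that less_hl_iff[of "ennreal l" h x] l by (auto simp: ennreal_mult)
  then obtain r where r: "\<And>x. x \<in> ?A \<Longrightarrow> r x > 0" "\<And>x. x \<in> ?A \<Longrightarrow> ennreal (r x ^ CARD('n) * l) < ?I x (r x)"
    by metis
  have IT: "?I x s \<le> ennreal T" for x s
    unfolding T(2)[symmetric] by (intro nn_integral_mono) (auto simp: indicator_def)
  \<comment> \<open>The covering lemma requires bounded radii. For a radius above 1 one has r \<le>
    r^n, and r^n * l stays below the total integral \<open>T\<close>.\<close>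
  have bd: "r x \<le> 1 + T / l" if "x \<in> ?A" for x
  proof (cases "r x \<le> 1")
    case True
    then show ?thesis using T l by (simp add: add_increasing2)
  next
    case False
    then have "r x \<le> r x ^ CARD('n)" by (intro self_le_power) (auto simp: Suc_leI)
    moreover have "ennreal (r x ^ CARD('n) * l) \<le> ennreal T"
      using r(2)[OF that] IT[of x "r x"] by (meson less_imp_le order_trans)
    then have "r x ^ CARD('n) \<le> T / l" using T l by (simp add: field_simps)
    ultimately show ?thesis by simp
  qed
  have cov: "?A \<subseteq> (\<Union>x\<in>?A. ball (id x) (r x))"
    using r(1) by force
  obtain C where C: "countable C" "C \<subseteq> ?A"
    "pairwise (\<lambda>i j. disjnt (ball (id i) (r i)) (ball (id j) (r j))) C"
    "?A \<subseteq> (\<Union>i\<in>C. ball (id i) (5 * r i))"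
    by (rule Vitali_covering_lemma_balls[OF cov, of "1 + T / l"]) (use r(1) bd in auto)
  have CA: "i \<in> ?A" if "i \<in> C" for i using C(2) that by blast
  have "emeasure lborel ?A \<le> emeasure lborel (\<Union>i\<in>C. ball i (5 * r i))"
    using C by (intro emeasure_mono) auto
  also have "\<dots> \<le> (\<integral>\<^sup>+i. emeasure lborel (ball i (5 * r i)) \<partial>count_space C)"
    by (rule emeasure_UN_le_count_space[OF C(1)]) auto
  also have "\<dots> \<le> (\<integral>\<^sup>+i. ennreal (vol TYPE('n) * 5 ^ CARD('n) / l) * ?I i (r i) \<partial>count_space C)"
  proof (intro nn_integral_mono)
    fix i assume "i \<in> space (count_space C)"
    then have i: "i \<in> ?A" using CA by simp
    have "emeasure lborel (ball i (5 * r i)) = ennreal (vol TYPE('n) * 5 ^ CARD('n) / l) * ennreal (r i ^ CARD('n) * l)"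
      using r(1)[OF i] l vol_pos[where 'n='n]
      by (simp add: emeasure_ball_vol power_mult_distrib flip: ennreal_mult)
    also have "\<dots> \<le> ennreal (vol TYPE('n) * 5 ^ CARD('n) / l) * ?I i (r i)"
      using r(2)[OF i] by (intro mult_left_mono) auto
    finally show "emeasure lborel (ball i (5 * r i)) \<le> \<dots>" .
  qed
  also have "\<dots> = ennreal (vol TYPE('n) * 5 ^ CARD('n) / l) * (\<integral>\<^sup>+i. ?I i (r i) \<partial>count_space C)"
    by (rule nn_integral_cmult) auto
  also have "(\<integral>\<^sup>+i. ?I i (r i) \<partial>count_space C) \<le> (\<integral>\<^sup>+x\<in>UNIV. h x \<partial>lborel)"
    by (rule nn_integral_disjoint_le[OF C(1)])
       (use C(3) in \<open>auto simp: disjoint_family_on_def pairwise_def disjnt_def\<close>)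
  finally show ?thesis by (simp add: mult_left_mono)
qed

lemma layer_cake_real:
  assumes "a > 0" "y \<ge> 0"
  shows "(\<integral>\<^sup>+l. ennreal (l powr (a - 1)) * indicator {0..y} l \<partial>lborel) = ennreal (y powr a / a)"
proof -
  have "((\<lambda>l. l powr (a - 1)) has_integral (y powr (a - 1 + 1) / (a - 1 + 1))) {0..y}"
    by (rule has_integral_powr_from_0) (use assms in auto)
  then have "(\<integral>\<^sup>+l. ennreal (indicator {0..y} l * l powr (a - 1)) \<partial>lborel) = ennreal (y powr a / a)"
    by (subst nn_integral_has_integral_lebesgue) auto
  then show ?thesis by (simp add: ennreal_mult ennreal_indicator mult.commute)
qed

lemma layer_cake:
  assumes "a > 0"
  shows "(\<integral>\<^sup>+l. ennreal (l powr (a - 1)) * indicator {l. 0 \<le> l \<and> ennreal l < y} l \<partial>lborel) = ennreal (1 / a) * epowr y a"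
proof (cases y)
  case (real s)
  have "AE l in lborel. ennreal (l powr (a - 1)) * indicator {l. 0 \<le> l \<and> ennreal l < y} l =
      ennreal (l powr (a - 1)) * indicator {0..s} l"
    using AE_lborel_singleton[of s] by eventually_elim (use real in \<open>auto simp: indicator_def ennreal_less_iff\<close>)
  then have "(\<integral>\<^sup>+l. ennreal (l powr (a - 1)) * indicator {l. 0 \<le> l \<and> ennreal l < y} l \<partial>lborel) =
     (\<integral>\<^sup>+l. ennreal (l powr (a - 1)) * indicator {0..s} l \<partial>lborel)"
    by (rule nn_integral_cong_AE)
  then show ?thesis
    using layer_cake_real[OF assms, of s] real assms by (simp add: epowr_ennreal flip: ennreal_mult)
next
  case top
  let ?J = "\<integral>\<^sup>+l. ennreal (l powr (a - 1)) * indicator {l. 0 \<le> l \<and> ennreal l < y} l \<partial>lborel"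
  \<comment> \<open>Cutting the integral off at s^(1/a) already gives \<open>s / a\<close>, with
    \<open>s\<close> arbitrary, so the integral is infinite.\<close>
  have "ennreal (s / a) \<le> ?J" if "s \<ge> 0" for s
  proof -
    have "ennreal ((s powr (1 / a)) powr a / a) =
        (\<integral>\<^sup>+l. ennreal (l powr (a - 1)) * indicator {0..s powr (1 / a)} l \<partial>lborel)"
      by (rule layer_cake_real[symmetric]) (use assms in auto)
    also have "\<dots> \<le> ?J"
      by (intro nn_integral_mono mult_left_mono) (auto simp: top indicator_def)
    finally show ?thesis using assms that by (simp add: powr_powr)
  qed
  from this[of "s * a" for s] have "ennreal s \<le> ?J" if "s \<ge> 0" for s
    using assms that by simp
  then have "?J = top"
  proof (cases ?J)
    case (real r)
    then have "ennreal (r + 1) \<le> ennreal r"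
      using \<open>\<And>s. s \<ge> 0 \<Longrightarrow> ennreal s \<le> ?J\<close>[of "r + 1"] by simp
    then show ?thesis using real by simp
  qed
  then show ?thesis using top assms by (simp add: epowr_def ennreal_mult_top)
qed

text \<open>A ball of radius \<open>r\<close> has volume \<open>vol TYPE('n) * r ^ n\<close>, so the
  part of \<open>h\<close> below \<open>l / (2 * vol)\<close> contributes at most
  \<open>l / 2\<close> to any normalised mean; the large values must provide the rest.\<close>

lemma hl_split:
  fixes h :: "real^'n \<Rightarrow> ennreal"
  assumes [measurable]: "h \<in> borel_measurable borel" and l: "l > 0" and x: "ennreal l < hl h x"
  shows "ennreal (l / 2) < hl (\<lambda>x. h x * indicator {x. ennreal (l / (2 * vol TYPE('n))) < h x} x) x"
proof -
  let ?v = "vol TYPE('n)"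
  let ?c = "l / (2 * ?v)"
  let ?g = "\<lambda>x. h x * indicator {x. ennreal ?c < h x} x"
  obtain r where r: "r > 0" "ennreal (r ^ CARD('n)) * ennreal l < (\<integral>\<^sup>+z\<in>ball x r. h z \<partial>lborel)"
    using x less_hl_iff by metis
  have v: "?v > 0" by (rule vol_pos)
  have m: "(\<lambda>z. ?g z * indicator (ball x r) z) \<in> borel_measurable lborel"
    "(\<lambda>z. ennreal ?c * indicator (ball x r) z) \<in> borel_measurable lborel"
    by (auto intro!: borel_measurable_times_ennreal borel_measurable_indicator)
  have "(\<integral>\<^sup>+z\<in>ball x r. h z \<partial>lborel) \<le> (\<integral>\<^sup>+z. ?g z * indicator (ball x r) z + ennreal ?c * indicator (ball x r) z \<partial>lborel)"
    by (intro nn_integral_mono) (auto simp: indicator_def)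
  also have "\<dots> = (\<integral>\<^sup>+z\<in>ball x r. ?g z \<partial>lborel) + ennreal ?c * emeasure lborel (ball x r)"
    unfolding nn_integral_add[OF m] by (simp add: nn_integral_cmult_indicator)
  also have "ennreal ?c * emeasure lborel (ball x r) = ennreal (r ^ CARD('n) * (l / 2))"
    using r l v by (simp add: emeasure_ball_vol flip: ennreal_mult)
  finally have "ennreal (r ^ CARD('n) * l) < (\<integral>\<^sup>+z\<in>ball x r. ?g z \<partial>lborel) + ennreal (r ^ CARD('n) * (l / 2))"
    using r l by (simp add: ennreal_mult)
  moreover have "ennreal (r ^ CARD('n) * l) = ennreal (r ^ CARD('n) * (l / 2)) + ennreal (r ^ CARD('n) * (l / 2))"
    using r l by (simp flip: ennreal_plus)
  ultimately have *: "H + H < G + H" if "H = ennreal (r ^ CARD('n) * (l / 2))" "G = (\<integral>\<^sup>+z\<in>ball x r. ?g z \<partial>lborel)" for G H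
    unfolding that by argo
  have "ennreal (r ^ CARD('n) * (l / 2)) < (\<integral>\<^sup>+z\<in>ball x r. ?g z \<partial>lborel)"
  proof (rule ccontr)
    assume "\<not> ?thesis"
    then show False
      using *[OF refl refl] by (meson add_right_mono linorder_not_le)
  qed
  then show ?thesis
    unfolding less_hl_iff using r l by (intro exI[of _ r]) (simp flip: ennreal_mult)
qed

text \<open>The Marcinkiewicz argument: the weak bound is applied at each level \<open>l\<close> to
  the part of \<open>h\<close> above a fixed multiple of \<open>l\<close>, and the levels are then
  integrated with the order of integration exchanged.\<close>

lemma hl_strong:
  assumes a: "a > 1"
  obtains C where "C > 0" "\<And>h :: real^'n \<Rightarrow> ennreal. h \<in> borel_measurable borel \<Longrightarrow>
    (\<integral>\<^sup>+x. epowr (hl h x) a \<partial>lborel) \<le> ennreal C * (\<integral>\<^sup>+x. epowr (h x) a \<partial>lborel)"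
proof -
  let ?v = "vol TYPE('n)"
  have v: "?v > 0" by (rule vol_pos)
  \<comment> \<open>\<open>K / l\<close> is the weak-type constant at level \<open>l / 2\<close>. In
    \<open>C\<close>, the factor \<open>a\<close> comes from the layer-cake formula and the last
    factor from integrating l^(a-2) up to \<open>2 * ?v * h x\<close>, which is finite because a >
    1.\<close>
  define K where "K = 2 * ?v * 5 ^ CARD('n)"
  define C where "C = a * K * ((2 * ?v) powr (a - 1) / (a - 1))"
  have K: "K > 0" using v by (simp add: K_def)
  show ?thesis
  proof (rule that)
    show "C > 0" using a v K by (simp add: C_def)
    fix h :: "real^'n \<Rightarrow> ennreal" assume h [measurable]: "h \<in> borel_measurable borel"
    let ?p = "\<lambda>l::real. ennreal (l powr (a - 1))"
    let ?J = "\<lambda>l. \<integral>\<^sup>+x. h x * indicator {x. ennreal (l / (2 * ?v)) < h x} x \<partial>lborel"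
    have "ennreal (1 / a) * (\<integral>\<^sup>+x. epowr (hl h x) a \<partial>lborel) =
        (\<integral>\<^sup>+x. \<integral>\<^sup>+l. ?p l * indicator {l. 0 \<le> l \<and> ennreal l < hl h x} l \<partial>lborel \<partial>lborel)"
      using a by (subst layer_cake) (auto simp: nn_integral_cmult)
    also have "\<dots> = (\<integral>\<^sup>+l. \<integral>\<^sup>+x. ?p l * indicator {l. 0 \<le> l \<and> ennreal l < hl h x} l \<partial>lborel \<partial>lborel)"
      by (rule lborel_pair.Fubini') measurable
    also have "\<dots> = (\<integral>\<^sup>+l. ?p l * indicator {0..} l * emeasure lborel {x. ennreal l < hl h x} \<partial>lborel)"
    proof (intro nn_integral_cong)
      fix l :: real
      have "(\<lambda>x. ?p l * indicator {l. 0 \<le> l \<and> ennreal l < hl h x} l) =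
          (\<lambda>x. (?p l * indicator {0..} l) * indicator {x. ennreal l < hl h x} x)"
        by (auto simp: indicator_def)
      then show "(\<integral>\<^sup>+x. ?p l * indicator {l. 0 \<le> l \<and> ennreal l < hl h x} l \<partial>lborel) =
          ?p l * indicator {0..} l * emeasure lborel {x. ennreal l < hl h x}"
        by (simp add: nn_integral_cmult)
    qed
    also have "\<dots> \<le> (\<integral>\<^sup>+l. ennreal K * (ennreal (l powr (a - 1 - 1)) * indicator {0..} l * ?J l) \<partial>lborel)"
    proof (intro nn_integral_mono)
      fix l :: real
      show "?p l * indicator {0..} l * emeasure lborel {x. ennreal l < hl h x} \<le>
          ennreal K * (ennreal (l powr (a - 1 - 1)) * indicator {0..} l * ?J l)"
      proof (cases "l > 0")
        case True
        have "emeasure lborel {x. ennreal l < hl h x} \<le>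
            emeasure lborel {x. ennreal (l / 2) < hl (\<lambda>x. h x * indicator {x. ennreal (l / (2 * ?v)) < h x} x) x}"
          using hl_split[OF h True] by (intro emeasure_mono) auto
        also have "\<dots> \<le> ennreal (?v * 5 ^ CARD('n) / (l / 2)) * ?J l"
          by (rule hl_weak) (use True in auto)
        also have "?v * 5 ^ CARD('n) / (l / 2) = K / l" by (simp add: K_def)
        finally have "?p l * emeasure lborel {x. ennreal l < hl h x} \<le> ?p l * (ennreal (K / l) * ?J l)"
          by (rule mult_left_mono) simp
        also have "?p l * (ennreal (K / l) * ?J l) = ennreal (l powr (a - 1) * (K / l)) * ?J l"
          using True K by (subst ennreal_mult) (auto simp: mult.assoc)
        also have "l powr (a - 1) * (K / l) = K * l powr (a - 1 - 1)"
          using True by (simp add: powr_diff power2_eq_square)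
        finally show ?thesis using True K by (simp add: ennreal_mult mult.assoc)
      next
        case False
        then show ?thesis by (cases "l = 0") auto
      qed
    qed
    also have "\<dots> = ennreal K * (\<integral>\<^sup>+l. \<integral>\<^sup>+x. ennreal (l powr (a - 1 - 1)) * indicator {0..} l *
        (h x * indicator {x. ennreal (l / (2 * ?v)) < h x} x) \<partial>lborel \<partial>lborel)"
      by (subst nn_integral_cmult[symmetric]) (auto simp: nn_integral_cmult)
    also have "(\<integral>\<^sup>+l. \<integral>\<^sup>+x. ennreal (l powr (a - 1 - 1)) * indicator {0..} l *
        (h x * indicator {x. ennreal (l / (2 * ?v)) < h x} x) \<partial>lborel \<partial>lborel) =
        (\<integral>\<^sup>+x. \<integral>\<^sup>+l. ennreal (l powr (a - 1 - 1)) * indicator {0..} l *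
        (h x * indicator {x. ennreal (l / (2 * ?v)) < h x} x) \<partial>lborel \<partial>lborel)"
      by (rule lborel_pair.Fubini') measurable
    also have "\<dots> = (\<integral>\<^sup>+x. h x * (ennreal (1 / (a - 1)) * epowr (ennreal (2 * ?v) * h x) (a - 1)) \<partial>lborel)"
    proof (intro nn_integral_cong)
      fix x
      have iff: "ennreal (l / (2 * ?v)) < h x \<longleftrightarrow> ennreal l < ennreal (2 * ?v) * h x" if "l \<ge> 0" for l
      proof (cases "h x")
        case (real y)
        have "ennreal (l / (2 * ?v)) < h x \<longleftrightarrow> l / (2 * ?v) < y"
          using real v that by (simp add: ennreal_less_iff)
        also have "\<dots> \<longleftrightarrow> l < 2 * ?v * y" using v by (simp add: field_simps)
        also have "\<dots> \<longleftrightarrow> ennreal l < ennreal (2 * ?v) * h x"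
          using real v that by (simp add: ennreal_less_iff flip: ennreal_mult)
        finally show ?thesis .
      qed (use v that in \<open>auto simp: ennreal_mult_top\<close>)
      have "(\<integral>\<^sup>+l. ennreal (l powr (a - 1 - 1)) * indicator {0..} l * (h x * indicator {x. ennreal (l / (2 * ?v)) < h x} x) \<partial>lborel)
         = (\<integral>\<^sup>+l. h x * (ennreal (l powr (a - 1 - 1)) * indicator {l. 0 \<le> l \<and> ennreal l < ennreal (2 * ?v) * h x} l) \<partial>lborel)"
        using iff by (intro nn_integral_cong) (auto simp: indicator_def mult.commute)
      also have "\<dots> = h x * (ennreal (1 / (a - 1)) * epowr (ennreal (2 * ?v) * h x) (a - 1))"
        using a layer_cake[of "a - 1" "ennreal (2 * ?v) * h x"] by (subst nn_integral_cmult) auto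
      finally show "(\<integral>\<^sup>+l. ennreal (l powr (a - 1 - 1)) * indicator {0..} l * (h x * indicator {x. ennreal (l / (2 * ?v)) < h x} x) \<partial>lborel) = \<dots>" .
    qed
    also have "\<dots> = (\<integral>\<^sup>+x. ennreal ((2 * ?v) powr (a - 1) / (a - 1)) * epowr (h x) a \<partial>lborel)"
    proof (intro nn_integral_cong)
      fix x
      have "h x * (ennreal (1 / (a - 1)) * epowr (ennreal (2 * ?v) * h x) (a - 1)) =
          (ennreal (1 / (a - 1)) * ennreal ((2 * ?v) powr (a - 1))) * (h x * epowr (h x) (a - 1))"
        using v by (subst epowr_cmult) (auto simp: mult_ac)
      then show "h x * (ennreal (1 / (a - 1)) * epowr (ennreal (2 * ?v) * h x) (a - 1)) =
          ennreal ((2 * ?v) powr (a - 1) / (a - 1)) * epowr (h x) a"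
        using a v by (simp add: epowr_mult_self flip: ennreal_mult)
    qed
    also have "\<dots> = ennreal ((2 * ?v) powr (a - 1) / (a - 1)) * (\<integral>\<^sup>+x. epowr (h x) a \<partial>lborel)"
      by (rule nn_integral_cmult) measurable
    finally have "ennreal a * (ennreal (1 / a) * (\<integral>\<^sup>+x. epowr (hl h x) a \<partial>lborel)) \<le>
        ennreal a * (ennreal K * (ennreal ((2 * ?v) powr (a - 1) / (a - 1)) * (\<integral>\<^sup>+x. epowr (h x) a \<partial>lborel)))"
      by (intro mult_left_mono) auto
    then show "(\<integral>\<^sup>+x. epowr (hl h x) a \<partial>lborel) \<le> ennreal C * (\<integral>\<^sup>+x. epowr (h x) a \<partial>lborel)"
      using a K v by (simp add: C_def mult.assoc[symmetric] flip: ennreal_mult)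
  qed
qed

section \<open>Iterated differences and mollifiers\<close>

primrec idiff :: "(real^'n) list \<Rightarrow> (real^'n \<Rightarrow> real) \<Rightarrow> real^'n \<Rightarrow> real" where
  "idiff [] f = f"
| "idiff (h # hs) f = idiff hs (\<lambda>x. f (x + h) - f x)"

text \<open>Translations commute, so the increment that \<open>idiff\<close> applies first may
  equally be applied last. In this form a Lipschitz bound can act on
  \<open>idiff hs f\<close>.\<close>

lemma diffs_translate: "idiff hs (\<lambda>x. f (x + h) - f x) x = idiff hs f (x + h) - idiff hs f x"
proof (induction hs arbitrary: f)
  case (Cons k hs)
  have A: "idiff (k # hs) (\<lambda>x. f (x + h) - f x) x = idiff hs (\<lambda>x. (f (x + h + k) - f (x + h)) - (f (x + k) - f x)) x"
    by (simp add: algebra_simps)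
  show ?case unfolding A using Cons.IH[of "\<lambda>x. f (x + k) - f x"] by simp
qed simp

lemma continuous_translate_diff: "continuous_on UNIV f \<Longrightarrow> continuous_on UNIV (\<lambda>x::real^'n. f (x + h) - f x :: real)"
  by (auto intro!: continuous_intros continuous_on_compose2[of UNIV f])

lemma continuous_diffs: "continuous_on UNIV f \<Longrightarrow> continuous_on UNIV (idiff hs f)"
  by (induction hs arbitrary: f) (auto simp: continuous_translate_diff)

lemma smooth_translate_diff: "smooth f \<Longrightarrow> smooth (\<lambda>x. f (x + h) - f x)"
  using smooth_diff[OF smooth_affine[of f h 1]] by (simp add: add.commute)

lemma smooth_diffs: "smooth f \<Longrightarrow> smooth (idiff hs f)"
  by (induction hs arbitrary: f) (auto simp: smooth_translate_diff)

lemma partial_diff: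
  assumes "smooth f" "smooth g"
  shows "partial j (\<lambda>x. f x - g x) x = partial j f x - partial j g x"
  using smooth_differentiable[OF assms(1), of x] smooth_differentiable[OF assms(2), of x]
  unfolding partial_def frechet_derivative_works
  by (subst frechet_derivative_at[symmetric], rule has_derivative_diff) auto

lemma partial_translate_diff:
  fixes f :: "real^'n \<Rightarrow> real"
  assumes "smooth f"
  shows "partial j (\<lambda>x. f (x + h) - f x) = (\<lambda>x. partial j f (x + h) - partial j f x)"
proof
  fix x
  have "partial j (\<lambda>x. f (h + 1 *\<^sub>R x)) x = partial j f (x + h)"
    using partial_affine[of f h 1 x j] smooth_differentiable[OF assms] by (simp add: add.commute)
  then show "partial j (\<lambda>x. f (x + h) - f x) x = partial j f (x + h) - partial j f x"
    using partial_diff[OF smooth_affine[OF assms, of h 1] assms, of j x] by (simp add: add.commute)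
qed

lemma partial_diffs: "smooth f \<Longrightarrow> partial j (idiff hs f) = idiff hs (partial j f)"
  by (induction hs arbitrary: f) (auto simp: smooth_translate_diff partial_translate_diff)

lemma convolve_translate_diff:
  fixes f g :: "real^'n \<Rightarrow> real"
  assumes "cont_supp r g" "continuous_on UNIV f"
  shows "(\<lambda>x. convolve g f (x + h) - convolve g f x) = convolve g (\<lambda>x. f (x + h) - f x)"
proof
  fix x
  have "convolve g f (x + h) - convolve g f x = (LINT y|lborel. g y * f (x + h - y) - g y * f (x - y))"
    unfolding convolve_def
    by (rule Bochner_Integration.integral_diff[symmetric]) (use conv_integrable[OF assms] in auto)
  then show "convolve g f (x + h) - convolve g f x = convolve g (\<lambda>x. f (x + h) - f x) x"
    by (simp add: convolve_def right_diff_distrib add.commute add_diff_eq diff_add_eq)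
qed

lemma diffs_convolve:
  assumes "cont_supp r g" "continuous_on UNIV f"
  shows "idiff hs (convolve g f) = convolve g (idiff hs f)"
  using assms(2)
proof (induction hs arbitrary: f)
  case (Cons h hs)
  then show ?case
    by (simp add: convolve_translate_diff[OF assms(1)] continuous_translate_diff)
qed simp

lemma diffs_minus: "idiff hs (\<lambda>x. f x - g x) x = idiff hs f x - idiff hs g x"
proof (induction hs arbitrary: f g)
  case (Cons h hs)
  have "idiff (h # hs) (\<lambda>x. f x - g x) x = idiff hs (\<lambda>x. (f (x + h) - f x) - (g (x + h) - g x)) x"
    by (simp add: algebra_simps)
  then show ?case by (simp only: Cons idiff.simps)
qed simp

text \<open>Regularity of order \<open>m\<close>, measured by iterated differences instead of derivatives
  because differences trivially commute with convolution.\<close>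

definition diff_bounded :: "nat \<Rightarrow> real \<Rightarrow> (real^'n \<Rightarrow> real) \<Rightarrow> bool" where
  "diff_bounded m b f \<longleftrightarrow>
     (\<forall>hs. length hs = m \<longrightarrow> (\<forall>x. \<bar>idiff hs f x\<bar> \<le> b * prod_list (map norm hs)))"

lemma diff_boundedD: "diff_bounded m b f \<Longrightarrow> length hs = m \<Longrightarrow> \<bar>idiff hs f x\<bar> \<le> b * prod_list (map norm hs)"
  by (simp add: diff_bounded_def)

lemma prod_list_norm_nonneg: "prod_list (map norm (hs :: 'a::real_normed_vector list)) \<ge> 0"
  by (induction hs) auto

lemma diff_bounded_mono:
  assumes "diff_bounded m b f" "b \<le> c" shows "diff_bounded m c f"
  unfolding diff_bounded_def
  using diff_boundedD[OF assms(1)] mult_right_mono[OF assms(2) prod_list_norm_nonneg] order_trans by blast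

text \<open>Each order of difference is traded for one partial derivative by the Lipschitz estimate;
  the induction closes because partial derivatives commute with \<open>idiff\<close> and preserve
  the support.\<close>

lemma smooth_diff_bounded:
  fixes f :: "real^'n \<Rightarrow> real"
  assumes "smooth f" "cont_supp r f"
  shows "\<exists>b\<ge>0. diff_bounded m b f"
  using assms
proof (induction m arbitrary: f)
  case 0
  then show ?case using cont_supp_bounded[of r f] by (metis diff_bounded_def idiff.simps(1) length_0_conv list.simps(8) mult_1_right prod_list.Nil)
next
  case (Suc m)
  have "\<exists>b. \<forall>j. b j \<ge> 0 \<and> diff_bounded m (b j) (partial j f)"
    by (rule choice) (use Suc smooth_partial cont_supp_partial in blast)
  then obtain b where b: "\<And>j. b j \<ge> 0" "\<And>j. diff_bounded m (b j) (partial j f)" by blast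
  define B where "B = sum b UNIV"
  have B: "B \<ge> 0" "b j \<le> B" for j
    unfolding B_def using b(1) by (auto simp: sum_nonneg intro: member_le_sum)
  have "\<bar>idiff (h # hs) f x\<bar> \<le> real CARD('n) * B * prod_list (map norm (h # hs))" if "length hs = m" for h hs x
  proof -
    have "\<bar>idiff hs f (x + h) - idiff hs f x\<bar> \<le> real CARD('n) * (B * prod_list (map norm hs)) * norm h"
    proof (rule smooth_lipschitz[OF smooth_diffs[OF Suc.prems(1)]])
      show "\<bar>partial j (idiff hs f) x\<bar> \<le> B * prod_list (map norm hs)" for j x
        using diff_boundedD[OF diff_bounded_mono[OF b(2)[of j] B(2)] that] by (simp add: partial_diffs[OF Suc.prems(1)])
    qed
    then show ?thesis by (simp add: diffs_translate mult_ac)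
  qed
  then have "diff_bounded (Suc m) (real CARD('n) * B) f"
    unfolding diff_bounded_def by (auto simp: length_Suc_conv simp del: idiff.simps)
  then show ?case using B(1) by (intro exI[of _ "real CARD('n) * B"]) simp
qed

lemma diff_bounded_convolve:
  assumes g: "cont_supp r g" and f: "continuous_on UNIV f" "diff_bounded m b f"
  shows "diff_bounded m (b * (LINT y|lborel. \<bar>g y\<bar>)) (convolve g f)"
  unfolding diff_bounded_def diffs_convolve[OF g f(1)]
proof (intro allI impI)
  fix hs :: "(real^'a) list" and x assume "length hs = m"
  then have "\<bar>convolve g (idiff hs f) x\<bar> \<le> b * prod_list (map norm hs) * (LINT y|lborel. \<bar>g y\<bar>)"
    by (intro convolve_bound[OF g continuous_diffs[OF f(1)]] diff_boundedD[OF f(2)])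
  then show "\<bar>convolve g (idiff hs f) x\<bar> \<le> b * (LINT y|lborel. \<bar>g y\<bar>) * prod_list (map norm hs)"
    by (simp add: mult_ac)
qed

lemma diff_bounded_minus:
  assumes "diff_bounded m b f" "diff_bounded m c g"
  shows "diff_bounded m (b + c) (\<lambda>x. f x - g x)"
  unfolding diff_bounded_def diffs_minus
proof (intro allI impI)
  fix hs :: "(real^'a) list" and x assume "length hs = m"
  from diff_boundedD[OF assms(1) this, of x] diff_boundedD[OF assms(2) this, of x]
  show "\<bar>idiff hs f x - idiff hs g x\<bar> \<le> (b + c) * prod_list (map norm hs)"
    by (simp add: distrib_right)
qed

text \<open>As \<open>g\<close> has integral 1, the constant \<open>f x\<close> may be moved under
  the convolution, leaving a weighted mean of the increments \<open>f x - f (x - y)\<close> with |y|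
  \<le> r.\<close>

lemma minus_convolve_bound:
  fixes f g :: "real^'n \<Rightarrow> real"
  assumes g: "cont_supp r g" "(LINT y|lborel. g y) = 1" and f: "continuous_on UNIV f"
    and B: "\<And>y. norm y \<le> r \<Longrightarrow> \<bar>f x - f (x - y)\<bar> \<le> B"
  shows "\<bar>f x - convolve g f x\<bar> \<le> B * (LINT y|lborel. \<bar>g y\<bar>)"
proof -
  have "convolve g (\<lambda>z. f x - f z) x = (LINT y|lborel. f x * g y - g y * f (x - y))"
    unfolding convolve_def by (simp add: algebra_simps)
  also have "\<dots> = f x - convolve g f x"
    using g cont_supp_integrable[OF g(1)] conv_integrable[OF g(1) f] by (simp add: convolve_def)
  finally show ?thesis
    using convolve_bound[OF g(1) continuous_on_diff[OF continuous_on_const[of _ "f x"] f], where x = x and B = B] B by simp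
qed

text \<open>One order of difference is spent to gain one factor \<open>r\<close>: subtracting the
  mollification averages increments of length at most \<open>r\<close>. This exchange is the source
  of the decay of \<open>Psi\<close>.\<close>

lemma diff_bounded_step:
  assumes g: "cont_supp r g" "(LINT y|lborel. g y) = 1" and f: "continuous_on UNIV f" "diff_bounded (Suc m) b f" and b: "b \<ge> 0"
  shows "diff_bounded m (r * b * (LINT y|lborel. \<bar>g y\<bar>)) (\<lambda>x. f x - convolve g f x)"
  unfolding diff_bounded_def diffs_minus diffs_convolve[OF g(1) f(1)]
proof (intro allI impI)
  fix hs :: "(real^'a) list" and x assume hs: "length hs = m"
  let ?P = "prod_list (map norm hs)"
  have "\<bar>idiff hs f x - convolve g (idiff hs f) x\<bar> \<le> (b * ?P * r) * (LINT y|lborel. \<bar>g y\<bar>)"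
  proof (rule minus_convolve_bound[OF g continuous_diffs[OF f(1)]])
    fix y :: "real^'a" assume y: "norm y \<le> r"
    have "\<bar>idiff ((- y) # hs) f x\<bar> \<le> b * prod_list (map norm ((- y) # hs))"
      using hs by (intro diff_boundedD[OF f(2)]) simp
    then have "\<bar>idiff hs f x - idiff hs f (x - y)\<bar> \<le> b * ?P * norm y"
      using diffs_translate[of hs f "- y" x] by (simp add: mult_ac abs_minus_commute)
    also have "\<dots> \<le> b * ?P * r"
      using y b by (intro mult_left_mono mult_nonneg_nonneg prod_list_norm_nonneg)
    finally show "\<bar>idiff hs f x - idiff hs f (x - y)\<bar> \<le> b * ?P * r" .
  qed
  then show "\<bar>idiff hs f x - convolve g (idiff hs f) x\<bar> \<le> r * b * (LINT y|lborel. \<bar>g y\<bar>) * ?P"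
    by (simp add: mult_ac)
qed

lemma smooth_convolve:
  fixes f g :: "real^'n \<Rightarrow> real"
  assumes "smooth f" "cont_supp r f" "cont_supp s g"
  shows "smooth (convolve f g)"
proof -
  have "C_k k (convolve f g)" if "smooth f" "cont_supp r f" for k f
    using that
  proof (induction k arbitrary: f)
    case 0
    then show ?case using cont_supp_convolve[OF _ assms(3)] cont_supp_continuous by (metis C_k.simps(1))
  next
    case (Suc k)
    then have "partial j (convolve f g) = convolve (partial j f) g" for j
      using partial_convolve[OF _ _ assms(3)] by blast
    moreover have "C_k k (convolve (partial j f) g)" for j
      using Suc.IH smooth_partial[OF Suc.prems(1)] cont_supp_partial[OF Suc.prems] by blast
    moreover have "convolve f g differentiable (at x)" for x
      unfolding differentiable_def using convolve_has_derivative[OF Suc.prems assms(3)] by blast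
    ultimately show ?case by simp
  qed
  then show ?thesis using assms by (simp add: smooth_def)
qed

section \<open>The remainder kernels \<open>Psi\<close> and their decay\<close>

locale mollifier =
  fixes \<psi> :: "real^'n \<Rightarrow> real"
  assumes smooth_psi: "smooth \<psi>" and cont_supp_psi: "cont_supp 1 \<psi>" and int_psi: "(LINT x|lborel. \<psi> x) = 1"
begin

definition psi_mass :: real where "psi_mass = (LINT y|lborel. \<bar>\<psi> y\<bar>)"

lemma psi_mass_nonneg: "psi_mass \<ge> 0"
  by (simp add: psi_mass_def)

lemma cont_supp_psi_t: "t > 0 \<Longrightarrow> cont_supp t (dilate \<psi> t)"
  using cont_supp_dilate[OF cont_supp_psi] by simp

lemma measurable_psi: "\<psi> \<in> borel_measurable borel"
  using cont_supp_psi by (rule cont_supp_measurable)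

lemma int_psi_t: "t > 0 \<Longrightarrow> (LINT x|lborel. dilate \<psi> t x) = 1"
  using integral_dilate[OF measurable_psi] int_psi by simp

lemma abs_int_psi_t: "t > 0 \<Longrightarrow> (LINT x|lborel. \<bar>dilate \<psi> t x\<bar>) = psi_mass"
  using integral_dilate[of "\<lambda>x. \<bar>\<psi> x\<bar>" t] measurable_psi by (simp add: abs_dilate psi_mass_def)

text \<open>Formally the convolution of \<open>\<psi>\<close> with the factors \<delta>_0 - \<psi>_s
  for s = 1/2, ..., 1/2^k: what remains of \<open>\<psi>\<close> after splitting off one mollifier
  at each of these scales.\<close>

primrec Psi :: "nat \<Rightarrow> real^'n \<Rightarrow> real" where
  "Psi 0 = \<psi>"
| "Psi (Suc k) = (\<lambda>x. Psi k x - convolve (dilate \<psi> (1 / 2 ^ Suc k)) (Psi k) x)"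

text \<open>The radii add up to 1 + 1/2 + ... + 1/2^k.\<close>

lemma cont_supp_Psi': "cont_supp (2 - 1 / 2 ^ k) (Psi k)"
proof (induction k)
  case 0
  then show ?case using cont_supp_psi by simp
next
  case (Suc k)
  have "cont_supp (1 / 2 ^ Suc k + (2 - 1 / 2 ^ k)) (convolve (dilate \<psi> (1 / 2 ^ Suc k)) (Psi k))"
    by (rule cont_supp_convolve[OF cont_supp_psi_t Suc]) simp
  moreover have "1 / 2 ^ Suc k + (2 - 1 / 2 ^ k) = (2 - 1 / 2 ^ Suc k :: real)" by (simp add: field_simps)
  ultimately have "cont_supp (2 - 1 / 2 ^ Suc k) (convolve (dilate \<psi> (1 / 2 ^ Suc k)) (Psi k))" by simp
  then show ?case
    by (simp only: Psi.simps) (intro cont_supp_diff cont_supp_mono[OF Suc], auto simp: field_simps)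
qed

lemma cont_supp_Psi: "cont_supp 2 (Psi k)"
  by (rule cont_supp_mono[OF cont_supp_Psi']) simp

lemma continuous_Psi: "continuous_on UNIV (Psi k)"
  by (rule cont_supp_continuous[OF cont_supp_Psi])

text \<open>Induction on the decay rate \<open>i\<close>, for all difference orders \<open>l\<close>
  at once, since raising \<open>i\<close> by one uses the bound of order \<open>Suc l\<close>. The
  factor (1 + \<open>psi_mass\<close>)^K is the growth that \<open>K\<close> steps cause without any
  cancellation.\<close>

lemma diff_bounded_Psi:
  "\<exists>B\<ge>0. \<forall>K. diff_bounded l (B * (1 + psi_mass) ^ K / 2 ^ (i * K)) (Psi K)"
proof (induction i arbitrary: l)
  case 0
  obtain B where B: "B \<ge> 0" "diff_bounded l B \<psi>"
    using smooth_diff_bounded[OF smooth_psi cont_supp_psi] by blast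
  have "diff_bounded l (B * (1 + psi_mass) ^ K) (Psi K)" for K
  proof (induction K)
    case 0
    then show ?case using B by simp
  next
    case (Suc K)
    have "diff_bounded l (B * (1 + psi_mass) ^ K * (LINT y|lborel. \<bar>dilate \<psi> (1 / 2 ^ Suc K) y\<bar>)) (convolve (dilate \<psi> (1 / 2 ^ Suc K)) (Psi K))"
      by (rule diff_bounded_convolve[OF cont_supp_psi_t continuous_Psi Suc]) simp
    then have "diff_bounded l (B * (1 + psi_mass) ^ K * psi_mass) (convolve (dilate \<psi> (1 / 2 ^ Suc K)) (Psi K))"
      by (subst (asm) abs_int_psi_t) auto
    from diff_bounded_minus[OF Suc this] show ?case by (simp add: algebra_simps)
  qed
  then show ?case using B by auto
next
  case (Suc i)
  obtain B where B: "B \<ge> 0" "\<And>K. diff_bounded (Suc l) (B * (1 + psi_mass) ^ K / 2 ^ (i * K)) (Psi K)"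
    using Suc by blast
  obtain b where b: "b \<ge> 0" "diff_bounded l b \<psi>"
    using smooth_diff_bounded[OF smooth_psi cont_supp_psi] by blast
  \<comment> \<open>\<open>b\<close> serves K = 0, where no step has been made. For K = k + 1 the
    hypothesis is used at \<open>k\<close>, which loses a factor 2^i against the exponent
    \<open>i * K\<close>.\<close>
  define D where "D = max b (B * 2 ^ i)"
  have D: "b \<le> D" "B * 2 ^ i \<le> D" "D \<ge> 0" using b by (auto simp: D_def)
  have "diff_bounded l (D * (1 + psi_mass) ^ K / 2 ^ (Suc i * K)) (Psi K)" for K
  proof (cases K)
    case 0
    then show ?thesis using diff_bounded_mono[OF b(2) D(1)] by simp
  next
    case (Suc k)
    let ?b = "B * (1 + psi_mass) ^ k / 2 ^ (i * k)"
    have "diff_bounded l (1 / 2 ^ Suc k * ?b * (LINT y|lborel. \<bar>dilate \<psi> (1 / 2 ^ Suc k) y\<bar>)) (Psi (Suc k))"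
      unfolding Psi.simps
      by (rule diff_bounded_step[OF cont_supp_psi_t int_psi_t continuous_Psi B(2)]) (use B psi_mass_nonneg in auto)
    then have "diff_bounded l (1 / 2 ^ Suc k * ?b * psi_mass) (Psi (Suc k))"
      by (subst (asm) abs_int_psi_t) auto
    moreover have "1 / 2 ^ Suc k * ?b * psi_mass \<le> D * (1 + psi_mass) ^ Suc k / 2 ^ (Suc i * Suc k)"
    proof -
      have "1 / 2 ^ Suc k * ?b * psi_mass = (B * 2 ^ i) * ((1 + psi_mass) ^ k * psi_mass) / 2 ^ (Suc i * Suc k)"
        by (simp add: field_simps power_add)
      also have "\<dots> \<le> D * ((1 + psi_mass) ^ k * (1 + psi_mass)) / 2 ^ (Suc i * Suc k)"
        using D B psi_mass_nonneg by (intro divide_right_mono mult_mono) auto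
      finally show ?thesis by (simp add: mult.commute)
    qed
    ultimately show ?thesis using Suc diff_bounded_mono by blast
  qed
  then show ?case using D(3) by blast
qed

lemma Psi_decay:
  obtains B where "B \<ge> 0" "\<And>K x. \<bar>Psi K x\<bar> \<le> B / 2 ^ (N * K)"
proof -
  \<comment> \<open>The growth (1 + \<open>psi_mass\<close>)^K is paid for by \<open>i\<close> extra
    orders of decay.\<close>
  obtain i where i: "1 + psi_mass < 2 ^ i" using real_arch_pow[of 2 "1 + psi_mass"] by auto
  obtain B where B: "B \<ge> 0" "\<And>K. diff_bounded 0 (B * (1 + psi_mass) ^ K / 2 ^ ((N + i) * K)) (Psi K)"
    using diff_bounded_Psi by blast
  show ?thesis
  proof (rule that[OF B(1)])
    fix K x
    have "\<bar>Psi K x\<bar> \<le> B * (1 + psi_mass) ^ K / 2 ^ ((N + i) * K)"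
      using diff_boundedD[OF B(2), of "[]" K x] by simp
    also have "\<dots> \<le> B * (2 ^ i) ^ K / 2 ^ ((N + i) * K)"
      using i B psi_mass_nonneg by (intro divide_right_mono mult_left_mono power_mono) auto
    also have "\<dots> = B / 2 ^ (N * K)"
      by (simp add: power_add power_mult add_mult_distrib)
    finally show "\<bar>Psi K x\<bar> \<le> B / 2 ^ (N * K)" .
  qed
qed

text \<open>Dilation by \<open>t\<close> turns the scale 1/2^(k+1) in the recursion into t/2^(k+1),
  and associativity moves that mollifier onto \<open>f\<close>.\<close>

lemma convolve_Psi_step:
  assumes f: "cont_supp r f" and t: "t > 0"
  shows "convolve f (dilate (Psi k) t) x =
    convolve (convolve f (dilate \<psi> (t / 2 ^ Suc k))) (dilate (Psi k) t) x + convolve f (dilate (Psi (Suc k)) t) x"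
proof -
  let ?s = "1 / 2 ^ Suc k :: real"
  have s: "?s > 0" by simp
  have m: "dilate \<psi> ?s \<in> borel_measurable borel" "Psi k \<in> borel_measurable borel"
    using cont_supp_measurable[OF cont_supp_psi_t[OF s]] cont_supp_measurable[OF cont_supp_Psi] by auto
  have cs: "cont_supp (t / 2 ^ Suc k) (dilate \<psi> (t / 2 ^ Suc k))"
    by (rule cont_supp_psi_t) (use t in auto)
  have c: "cont_supp (t * 2) (dilate (Psi k) t)"
    by (rule cont_supp_dilate[OF cont_supp_Psi t])
  have "dilate (Psi (Suc k)) t = (\<lambda>x. dilate (Psi k) t x - convolve (dilate \<psi> (t / 2 ^ Suc k)) (dilate (Psi k) t) x)"
    using dilate_convolve[OF m t] dilate_dilate[OF s t, of \<psi>] by (simp add: dilate_diff)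
  then have "convolve f (dilate (Psi (Suc k)) t) x = convolve f (dilate (Psi k) t) x -
      convolve f (convolve (dilate \<psi> (t / 2 ^ Suc k)) (dilate (Psi k) t)) x"
    using convolve_diff_right[OF f cont_supp_continuous[OF c] cont_supp_continuous[OF cont_supp_convolve[OF cs c]]] by simp
  then show ?thesis unfolding convolve_assoc[OF f cs c] by linarith
qed

lemma convolve_Psi_sum:
  assumes f: "cont_supp r f" and t: "t > 0"
  shows "convolve f (dilate \<psi> t) x =
    (\<Sum>k<K. convolve (convolve f (dilate \<psi> (t / 2 ^ Suc k))) (dilate (Psi k) t) x) + convolve f (dilate (Psi K) t) x"
proof (induction K)
  case (Suc K)
  then show ?case using convolve_Psi_step[OF f t, of K x] by simp
qed simp

lemma convolve_le_maximal: "t > 0 \<Longrightarrow> ennreal \<bar>convolve f (dilate \<psi> t) x\<bar> \<le> maximal \<psi> f x"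
  unfolding maximal_def by (rule SUP_upper) simp

end

section \<open>Control of all scales by the vertical maximal function\<close>

lemma nonneg_split_powr:
  fixes v :: real
  assumes "0 \<le> v" "v \<le> a" "0 < q" "q < 1"
  shows "v \<le> v powr q * a powr (1 - q)"
proof (cases "v = 0")
  case False
  have "v = v powr (q + (1 - q))" using assms by simp
  also have "\<dots> = v powr q * v powr (1 - q)" by (rule powr_add)
  also have "\<dots> \<le> v powr q * a powr (1 - q)"
    using assms by (intro mult_left_mono powr_mono2) auto
  finally show ?thesis .
qed simp

context mollifier
begin

text \<open>The \<open>L\<^sup>1\<close> average produced by convolution is turned into an average of \<open>\<bar>F\<bar>\<^sup>q\<close>
  at the price of a factor \<open>a\<^sup>1\<^sup>-\<^sup>q\<close>, where \<open>a\<close> is an a priori bound for \<open>\<bar>F\<bar>\<close>.\<close>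

lemma convolve_maximal_bound:
  fixes f :: "real^'n \<Rightarrow> real" and h :: "real^'n \<Rightarrow> ennreal"
  assumes q: "0 < q" "q < 1" and f: "cont_supp r f" and t: "t > 0" and s: "s > 0"
    and g: "cont_supp 2 g" "\<And>z. \<bar>g z\<bar> \<le> b" and b: "b \<ge> 0"
    and h [measurable]: "h \<in> borel_measurable borel" "\<And>w. epowr (maximal \<psi> f w) q \<le> h w"
    and k: "\<kappa> \<ge> 0" "hl h x \<le> ennreal \<kappa>"
    and a: "\<And>w. dist y w \<le> 2 * t \<Longrightarrow> \<bar>convolve f (dilate \<psi> s) w\<bar> \<le> a"
  shows "\<bar>convolve (convolve f (dilate \<psi> s)) (dilate g t) y\<bar> \<le>
    a powr (1 - q) * b * (3 * (1 + dist x y / t)) ^ CARD('n) * \<kappa>"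
proof -
  let ?F = "convolve f (dilate \<psi> s)"
  let ?R = "dist x y + 3 * t"
  let ?Q = "a powr (1 - q) * (b / t ^ CARD('n))"
  have cF: "cont_supp (r + s) ?F" by (rule cont_supp_convolve[OF f cont_supp_psi_t[OF s]])
  have cg: "cont_supp (t * 2) (dilate g t)" by (rule cont_supp_dilate[OF g(1) t])
  have pw: "ennreal (norm (?F w * dilate g t (y - w))) \<le> ennreal ?Q * (h w * indicator (ball x ?R) w)" for w
  proof (cases "norm (y - w) \<le> t * 2")
    case False
    then show ?thesis using cont_supp_zero[OF cg] by simp
  next
    case True
    then have yw: "dist y w \<le> 2 * t" by (simp add: dist_norm mult.commute)
    have w: "w \<in> ball x ?R"
      using yw t dist_triangle[of x w y] by simp
    have gb: "\<bar>dilate g t (y - w)\<bar> \<le> b / t ^ CARD('n)"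
      using g(2) t by (simp add: dilate_def divide_right_mono)
    have "norm (?F w * dilate g t (y - w)) \<le> (\<bar>?F w\<bar> powr q * a powr (1 - q)) * (b / t ^ CARD('n))"
      unfolding real_norm_def abs_mult
      by (intro mult_mono nonneg_split_powr a[OF yw] gb q) auto
    also have "\<dots> = ?Q * \<bar>?F w\<bar> powr q" by simp
    finally have "ennreal (norm (?F w * dilate g t (y - w))) \<le> ennreal ?Q * ennreal (\<bar>?F w\<bar> powr q)"
      using b t by (simp add: ennreal_leI flip: ennreal_mult)
    also have "ennreal (\<bar>?F w\<bar> powr q) = epowr (ennreal \<bar>?F w\<bar>) q"
      by (simp add: epowr_ennreal)
    also have "\<dots> \<le> epowr (maximal \<psi> f w) q"
      using q by (intro epowr_mono convolve_le_maximal s) auto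
    also have "\<dots> \<le> h w * indicator (ball x ?R) w"
      using h(2)[of w] w by simp
    finally show ?thesis by (simp add: mult_left_mono)
  qed
  have "ennreal \<bar>convolve ?F (dilate g t) y\<bar> \<le> (\<integral>\<^sup>+w. ennreal (norm (?F w * dilate g t (y - w))) \<partial>lborel)"
    using integral_norm_bound_ennreal[OF conv_integrable[OF cF cont_supp_continuous[OF cg], of y]]
    by (simp add: convolve_def)
  also have "\<dots> \<le> (\<integral>\<^sup>+w. ennreal ?Q * (h w * indicator (ball x ?R) w) \<partial>lborel)"
    by (intro nn_integral_mono pw)
  also have "\<dots> = ennreal ?Q * (\<integral>\<^sup>+w\<in>ball x ?R. h w \<partial>lborel)"
    by (rule nn_integral_cmult) (auto intro!: borel_measurable_times_ennreal borel_measurable_indicator)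
  also have "\<dots> \<le> ennreal ?Q * (ennreal (?R ^ CARD('n)) * hl h x)"
    by (intro mult_left_mono integral_ball_le_hl) (use t in \<open>auto intro: add_nonneg_pos\<close>)
  also have "\<dots> \<le> ennreal ?Q * (ennreal (?R ^ CARD('n)) * ennreal \<kappa>)"
    by (intro mult_left_mono k) auto
  also have "\<dots> = ennreal (?Q * (?R ^ CARD('n) * \<kappa>))"
    using k b t by (simp flip: ennreal_mult)
  finally have "\<bar>convolve ?F (dilate g t) y\<bar> \<le> ?Q * (?R ^ CARD('n) * \<kappa>)"
    using k b t by simp
  also have "\<dots> = a powr (1 - q) * b * (?R / t) ^ CARD('n) * \<kappa>"
    by (simp add: power_divide)
  also have "\<dots> \<le> a powr (1 - q) * b * (3 * (1 + dist x y / t)) ^ CARD('n) * \<kappa>"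
    using b k t by (intro mult_right_mono mult_left_mono power_mono) (auto simp: field_simps)
  finally show ?thesis .
qed

text \<open>The supremum \<open>G\<close> of \<open>F t y / X t y ^ N\<close> over all scales and
  points reproduces itself with power 1 - q on the right: G \<le> C0 * G^(1-q) * \<kappa>. The
  weight \<open>X\<close> is there because the expansion at (t, y) uses smaller scales at displaced
  points, which only a supremum with polynomial weight can absorb.\<close>

lemma fefferman_stein:
  assumes q: "0 < q" "q < 1"
  obtains C N where "C > 0" "\<And>f r h x y t \<kappa>. \<lbrakk>cont_supp r f; h \<in> borel_measurable borel;
      \<And>w. epowr (maximal \<psi> f w) q \<le> h w; \<kappa> \<ge> 0; hl h x \<le> ennreal \<kappa>; t > 0\<rbrakk>
      \<Longrightarrow> \<bar>convolve f (dilate \<psi> t) y\<bar> \<le> C * \<kappa> powr (1 / q) * (1 + dist x y / t) ^ N"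
proof -
  let ?n = "CARD('n)"
  \<comment> \<open>n \<le> N * q is exactly what makes the exponent N * (1 - q) + n of the weight
    at most N again.\<close>
  obtain N :: nat where N: "real ?n / q \<le> real N" using real_arch_simple by blast
  obtain B where B: "B \<ge> 0" "\<And>K x. \<bar>Psi K x\<bar> \<le> B / 2 ^ ((N + 1) * K)"
    using Psi_decay[of "N + 1"] by blast
  \<comment> \<open>The 2 sums the geometric series over the scales, 6^N is the fixed part of the
    loss of weight, 3^n comes from the radius of the averaging ball, and the final 1 gives
    positivity.\<close>
  define C0 where "C0 = 2 * (B * 3 ^ ?n * 6 ^ N) + 1"
  have C0: "C0 > 0" using B by (simp add: C0_def add_nonneg_pos)
  show ?thesis
  proof (rule that)
    show "C0 powr (1 / q) > 0" using C0 by simp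
    fix f :: "real^'n \<Rightarrow> real" and r h x y t \<kappa>
    assume f: "cont_supp r f" and h: "h \<in> borel_measurable borel" "\<And>w. epowr (maximal \<psi> f w) q \<le> h w"
      and k: "\<kappa> \<ge> 0" "hl h x \<le> ennreal \<kappa>" and t: "t > (0::real)"
    define F where "F t y = \<bar>convolve f (dilate \<psi> t) y\<bar>" for t y
    define X where "X t y = 1 + dist x y / t" for t y
    have X: "X t y \<ge> 1" if "t > 0" for t y using that by (simp add: X_def)
    define S where "S = (\<lambda>(t, y). F t y / X t y ^ N) ` ({0<..} \<times> UNIV)"
    obtain M where M: "M \<ge> 0" "\<And>x. \<bar>f x\<bar> \<le> M" using cont_supp_bounded[OF f] by blast
    have FM: "F t y \<le> M * psi_mass" if "t > 0" for t y
    proof -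
      have "convolve f (dilate \<psi> t) = convolve (dilate \<psi> t) f"
        by (rule convolve_commute) (use cont_supp_measurable[OF f] cont_supp_measurable[OF cont_supp_psi_t[OF that]] in auto)
      then show ?thesis
        using convolve_bound[OF cont_supp_psi_t[OF that] cont_supp_continuous[OF f], of y M] M abs_int_psi_t[OF that]
        by (simp add: F_def)
    qed
    have bdd: "bdd_above S"
      unfolding S_def
    proof (rule bdd_aboveI2, clarify)
      fix t y assume "(0::real) < t"
      then have "F t y / X t y ^ N \<le> F t y / 1"
        using X[of t y] by (intro divide_left_mono) (auto simp: F_def)
      then show "F t y / X t y ^ N \<le> M * psi_mass" using FM[OF \<open>0 < t\<close>, of y] by simp
    qed
    define G where "G = Sup S"
    have GF: "F t y \<le> G * X t y ^ N" if "t > 0" for t y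
    proof -
      have "F t y / X t y ^ N \<le> G"
        unfolding G_def by (rule cSup_upper[OF _ bdd]) (use that in \<open>auto simp: S_def\<close>)
      moreover have "X t y ^ N > 0" using X[OF that, of y] by simp
      ultimately show ?thesis by (simp add: divide_le_eq)
    qed
    have "0 \<le> F 1 x" by (simp add: F_def)
    also have "\<dots> \<le> G" using GF[of 1 x] by (simp add: X_def)
    finally have G0: "G \<ge> 0" .
    have key: "F t y / X t y ^ N \<le> C0 * G powr (1 - q) * \<kappa>" if t: "t > 0" for t y
    proof -
      define D where "D = B * 3 ^ ?n * 6 ^ N * G powr (1 - q) * \<kappa> * X t y ^ N"
      have X1: "X t y \<ge> 1" using X[OF t] .
      have D: "D \<ge> 0" using B k X1 by (simp add: D_def)
      have tm: "\<bar>convolve (convolve f (dilate \<psi> (t / 2 ^ Suc k))) (dilate (Psi k) t) y\<bar> \<le> D * (1 / 2) ^ k" for k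
      proof -
        let ?s = "t / 2 ^ Suc k"
        let ?W = "6 * 2 ^ k * X t y"
        have s: "?s > 0" using t by simp
        have W: "?W \<ge> 0" using X1 by simp
        \<comment> \<open>Passing from scale \<open>t\<close> to t/2^(k+1) and moving by at most 2 t
          multiplies the weight by at most 6 * 2^k. The resulting 2^(N k) is beaten by the decay
          2^(-(N+1) k) of \<open>Psi k\<close>, which leaves (1/2)^k.\<close>
        have "\<bar>convolve f (dilate \<psi> ?s) w\<bar> \<le> G * ?W ^ N" if "dist y w \<le> 2 * t" for w
        proof -
          have "dist x w / ?s \<le> (dist x y + 2 * t) / ?s"
            using that s dist_triangle[of x w y] by (intro divide_right_mono) auto
          also have "\<dots> = 2 ^ Suc k * (dist x y / t + 2)" using t by (simp add: field_simps)
          finally have "X ?s w \<le> 1 + 2 ^ Suc k * (dist x y / t + 2)" by (simp add: X_def)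
          also have "\<dots> \<le> 2 ^ Suc k * 1 + 2 ^ Suc k * (dist x y / t + 2)" by (simp del: power_Suc)
          also have "\<dots> = 2 ^ Suc k * (X t y + 2)" by (simp add: X_def algebra_simps)
          also have "\<dots> \<le> 2 ^ Suc k * (3 * X t y)" using X1 by (intro mult_left_mono) auto
          finally have "X ?s w \<le> ?W" by simp
          then have "G * X ?s w ^ N \<le> G * ?W ^ N"
            using G0 X[OF s, of w] by (intro mult_left_mono power_mono) auto
          then show ?thesis using GF[OF s, of w] by (simp add: F_def)
        qed
        then have "\<bar>convolve (convolve f (dilate \<psi> ?s)) (dilate (Psi k) t) y\<bar> \<le>
            (G * ?W ^ N) powr (1 - q) * (B / 2 ^ ((N + 1) * k)) * (3 * (1 + dist x y / t)) ^ ?n * \<kappa>"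
          by (intro convolve_maximal_bound[OF q f t s cont_supp_Psi B(2) _ h k]) (use B in auto)
        also have "(G * ?W ^ N) powr (1 - q) = G powr (1 - q) * (?W ^ N) powr (1 - q)"
          using G0 W by (simp add: powr_mult)
        also have "(?W ^ N) powr (1 - q) \<le> (6 * 2 ^ k) ^ N * X t y powr (real N * (1 - q))"
        proof -
          have "(?W ^ N) powr (1 - q) = ((6 * 2 ^ k) ^ N) powr (1 - q) * (X t y ^ N) powr (1 - q)"
            using X1 by (simp add: power_mult_distrib powr_mult)
          also have "((6 * 2 ^ k) ^ N) powr (1 - q) \<le> ((6 * 2 ^ k) ^ N :: real) powr 1"
            using q by (intro powr_mono) (auto intro!: one_le_power mult_ge1_I)
          also have "((6 * 2 ^ k) ^ N :: real) powr 1 = (6 * 2 ^ k) ^ N" by simp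
          also have "(X t y ^ N) powr (1 - q) = X t y powr (real N * (1 - q))"
            using X1 by (simp add: powr_realpow[symmetric] powr_powr)
          finally show ?thesis by (simp add: mult_right_mono)
        qed
        also have "G powr (1 - q) * ((6 * 2 ^ k) ^ N * X t y powr (real N * (1 - q))) * (B / 2 ^ ((N + 1) * k)) * (3 * (1 + dist x y / t)) ^ ?n * \<kappa>
          = B * 3 ^ ?n * 6 ^ N * G powr (1 - q) * \<kappa> * (X t y powr (real N * (1 - q)) * X t y ^ ?n) * (1 / 2) ^ k"
          by (simp add: X_def[symmetric] power_mult_distrib power_add power_mult power_divide field_simps flip: power_mult)
        also have "\<dots> \<le> D * (1 / 2) ^ k"
          unfolding D_def
        proof (intro mult_right_mono mult_left_mono)
          have "X t y powr (real N * (1 - q)) * X t y ^ ?n = X t y powr (real N * (1 - q) + real ?n)"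
            using X1 by (simp add: powr_add powr_realpow)
          also have "\<dots> \<le> X t y powr (real N)"
            using X1 N q by (intro powr_mono) (auto simp: field_simps)
          finally show "X t y powr (real N * (1 - q)) * X t y ^ ?n \<le> X t y ^ N"
            using X1 by (simp add: powr_realpow)
        qed (use B k in auto)
        finally show ?thesis
          by this (intro mult_right_mono mult_left_mono, use B k t in auto)
      qed
      define I where "I = (LINT y|lborel. \<bar>f y\<bar>)"
      have rest: "\<bar>convolve f (dilate (Psi K) t) y\<bar> \<le> B / t ^ ?n * I * (1 / 2) ^ K" for K
      proof -
        have "\<bar>convolve f (dilate (Psi K) t) y\<bar> \<le> B / 2 ^ ((N + 1) * K) / t ^ ?n * I"
          unfolding I_def
        proof (rule convolve_bound[OF f cont_supp_continuous[OF cont_supp_dilate[OF cont_supp_Psi t]]])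
          show "\<bar>dilate (Psi K) t (y - z)\<bar> \<le> B / 2 ^ ((N + 1) * K) / t ^ ?n" for z
            using divide_right_mono[OF B(2)[of K "(y - z) /\<^sub>R t"], of "t ^ ?n"] t
            by (simp add: dilate_def)
        qed
        also have "\<dots> \<le> B / 2 ^ K / t ^ ?n * I"
          using B t by (intro mult_right_mono divide_right_mono divide_left_mono power_increasing) (auto simp: I_def)
        finally show ?thesis by (simp add: power_divide mult.commute)
      qed
      have "F t y \<le> 2 * D + B / t ^ ?n * I * (1 / 2) ^ K" for K
      proof -
        have "F t y \<le> (\<Sum>k<K. \<bar>convolve (convolve f (dilate \<psi> (t / 2 ^ Suc k))) (dilate (Psi k) t) y\<bar>) + \<bar>convolve f (dilate (Psi K) t) y\<bar>"
          unfolding F_def convolve_Psi_sum[OF f t, of y K]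
          by (rule order_trans[OF abs_triangle_ineq add_right_mono[OF sum_abs]])
        also have "\<dots> \<le> (\<Sum>k<K. D * (1 / 2) ^ k) + B / t ^ ?n * I * (1 / 2) ^ K"
          by (intro add_mono sum_mono tm rest)
        also have "(\<Sum>k<K. D * (1 / 2) ^ k) \<le> 2 * D"
        proof -
          have "(\<Sum>k<K. (1 / 2 :: real) ^ k) \<le> 2"
            by (simp add: sum_gp_strict)
          from mult_left_mono[OF this D] show ?thesis by (simp add: sum_distrib_left mult.commute)
        qed
        finally show ?thesis by simp
      qed
      \<comment> \<open>The remainder term depends on \<open>t\<close> and on the integral of |f|,
        but it tends to 0 as \<open>K\<close> grows, so neither enters the final constant.\<close>
      moreover have "(\<lambda>K. 2 * D + B / t ^ ?n * I * (1 / 2) ^ K) \<longlonglongrightarrow> 2 * D + B / t ^ ?n * I * 0"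
        by (intro tendsto_intros LIMSEQ_power_zero) auto
      ultimately have "F t y \<le> 2 * D"
        by (intro LIMSEQ_le_const[where x = "2 * D"]) auto
      also have "2 * D \<le> C0 * G powr (1 - q) * \<kappa> * X t y ^ N"
        unfolding D_def C0_def using k X1 by (simp add: algebra_simps)
      finally show ?thesis using X1 by (simp add: divide_le_eq)
    qed
    have "G \<le> C0 * G powr (1 - q) * \<kappa>"
      unfolding G_def by (rule cSup_least) (use key in \<open>auto simp: S_def G_def\<close>)
    \<comment> \<open>Here the finiteness of \<open>G\<close> is used: for G > 0 the factor G^(1-q)
      may be cancelled.\<close>
    then have GC: "G \<le> (C0 * \<kappa>) powr (1 / q)"
    proof (cases "G = 0")
      case False
      then have "G > 0" using G0 by simp
      have "G powr q * G powr (1 - q) \<le> C0 * \<kappa> * G powr (1 - q)"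
        using \<open>G \<le> C0 * G powr (1 - q) * \<kappa>\<close> \<open>G > 0\<close> by (simp add: mult_ac flip: powr_add)
      then have "G powr q \<le> C0 * \<kappa>" using \<open>G > 0\<close> by simp
      then have "(G powr q) powr (1 / q) \<le> (C0 * \<kappa>) powr (1 / q)"
        using q by (intro powr_mono2) auto
      then show ?thesis using q \<open>G > 0\<close> by (simp add: powr_powr)
    qed simp
    have "\<bar>convolve f (dilate \<psi> t) y\<bar> \<le> G * X t y ^ N"
      using GF[OF t, of y] by (simp add: F_def)
    also have "\<dots> \<le> (C0 * \<kappa>) powr (1 / q) * X t y ^ N"
      using GC X[OF t, of y] by (intro mult_right_mono) auto
    finally show "\<bar>convolve f (dilate \<psi> t) y\<bar> \<le> C0 powr (1 / q) * \<kappa> powr (1 / q) * (1 + dist x y / t) ^ N"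
      using C0 k by (simp add: powr_mult X_def)
  qed
qed

text \<open>Keeps only what is needed of the q-th power of the summed maximal functions: one
  measurable majorant that serves all partial derivatives at once.\<close>

definition grad_ctrl :: "real \<Rightarrow> (real^'n \<Rightarrow> real) \<Rightarrow> (real^'n \<Rightarrow> ennreal) \<Rightarrow> bool" where
  "grad_ctrl q u h \<longleftrightarrow> h \<in> borel_measurable borel \<and> (\<forall>j w. epowr (maximal \<psi> (partial j u) w) q \<le> h w)"

lemma smooth_psi_t: "smooth (dilate \<psi> t)"
  by (rule smooth_dilate[OF smooth_psi])

text \<open>The first estimate integrates the bound for mollified gradients along a segment. For
  consecutive scales, both mollifications are compared with the double mollification by \<psi>_t and
  \<psi>_(t/2). The allowance 2 t in the first estimate permits its use at scale t/2 with
  displacements up to \<open>t\<close>.\<close>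

lemma mollified_estimates:
  assumes q: "0 < q" "q < 1"
  obtains C where "C > 0"
    "\<And>u r h z y y' t \<kappa>. \<lbrakk>smooth u; cont_supp r u; grad_ctrl q u h; \<kappa> \<ge> 0; hl h z \<le> ennreal \<kappa>; t > 0;
      dist z y \<le> 2 * t; dist y y' \<le> 2 * t\<rbrakk>
      \<Longrightarrow> \<bar>convolve u (dilate \<psi> t) y - convolve u (dilate \<psi> t) y'\<bar> \<le> C * \<kappa> powr (1 / q) * dist y y'"
    "\<And>u r h z y t \<kappa>. \<lbrakk>smooth u; cont_supp r u; grad_ctrl q u h; \<kappa> \<ge> 0; hl h z \<le> ennreal \<kappa>; t > 0; dist z y \<le> t\<rbrakk>
      \<Longrightarrow> \<bar>convolve u (dilate \<psi> t) y - convolve u (dilate \<psi> (t / 2)) y\<bar> \<le> C * \<kappa> powr (1 / q) * t"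
proof -
  obtain A N where A: "A > 0" "\<And>f r h x y t \<kappa>. \<lbrakk>cont_supp r f; h \<in> borel_measurable borel;
      \<And>w. epowr (maximal \<psi> f w) q \<le> h w; \<kappa> \<ge> 0; hl h x \<le> ennreal \<kappa>; t > 0\<rbrakk>
      \<Longrightarrow> \<bar>convolve f (dilate \<psi> t) y\<bar> \<le> A * \<kappa> powr (1 / q) * (1 + dist x y / t) ^ N"
    using fefferman_stein[OF q] by metis
  \<comment> \<open>The segment stays within 4 t of \<open>z\<close>, so the weight 1 + dist / t is
    at most 5.\<close>
  define D where "D = real CARD('n) * A * 5 ^ N"
  have D: "D > 0" using A by (simp add: D_def)
  have lip: "\<bar>convolve u (dilate \<psi> t) y - convolve u (dilate \<psi> t) y'\<bar> \<le> D * \<kappa> powr (1 / q) * dist y y'"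
    if u: "smooth u" "cont_supp r u" "grad_ctrl q u h" and k: "\<kappa> \<ge> 0" "hl h z \<le> ennreal \<kappa>" and t: "t > 0"
      and d: "dist z y \<le> 2 * t" "dist y y' \<le> 2 * t" for u r h z y y' t \<kappa>
  proof -
    let ?v = "convolve u (dilate \<psi> t)"
    have sv: "smooth ?v" by (rule smooth_convolve[OF u(1,2) cont_supp_psi_t[OF t]])
    obtain \<theta> where th: "0 < \<theta>" "\<theta> < 1"
      "?v (y + (y' - y)) - ?v y = (\<Sum>j\<in>UNIV. (y' - y) $ j * partial j ?v (y + \<theta> *\<^sub>R (y' - y)))"
      using smooth_mvt[OF sv] by blast
    let ?w = "y + \<theta> *\<^sub>R (y' - y)"
    have "dist y ?w \<le> dist y y'" using th by (simp add: dist_norm norm_minus_commute mult_left_le_one_le)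
    then have w: "dist z ?w \<le> 4 * t" using d dist_triangle[of z ?w y] by simp
    have "\<bar>partial j ?v ?w\<bar> \<le> A * \<kappa> powr (1 / q) * 5 ^ N" for j
    proof -
      have "\<bar>partial j ?v ?w\<bar> \<le> A * \<kappa> powr (1 / q) * (1 + dist z ?w / t) ^ N"
        unfolding partial_convolve[OF u(1,2) cont_supp_psi_t[OF t]]
        by (rule A(2)[OF cont_supp_partial[OF u(1,2)]]) (use u(3) k t in \<open>auto simp: grad_ctrl_def\<close>)
      also have "\<dots> \<le> A * \<kappa> powr (1 / q) * 5 ^ N"
        using w t A(1) by (intro mult_left_mono power_mono) (auto simp: field_simps)
      finally show ?thesis .
    qed
    from sum_component_le[of "\<lambda>j. partial j ?v ?w", OF this, of "y' - y"]
    have "\<bar>?v (y + (y' - y)) - ?v y\<bar> \<le> real CARD('n) * (A * \<kappa> powr (1 / q) * 5 ^ N) * norm (y' - y)"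
      unfolding th(3) .
    then show ?thesis
      by (simp add: D_def dist_norm norm_minus_commute abs_minus_commute mult_ac)
  qed
  define E where "E = D * (2 * psi_mass) + D"
  have E: "D \<le> E" "E > 0" "2 * D * psi_mass \<le> E" using D psi_mass_nonneg by (auto simp: E_def add_nonneg_pos)
  show ?thesis
  proof (rule that[OF E(2)])
    fix u r h z y y' t \<kappa>
    assume *: "smooth u" "cont_supp r u" "grad_ctrl q u h" "\<kappa> \<ge> 0" "hl h z \<le> ennreal \<kappa>" "t > 0"
      "dist z y \<le> 2 * t" "dist y y' \<le> 2 * t"
    have "\<bar>convolve u (dilate \<psi> t) y - convolve u (dilate \<psi> t) y'\<bar> \<le> D * \<kappa> powr (1 / q) * dist y y'"
      by (rule lip[OF *])
    also have "\<dots> \<le> E * \<kappa> powr (1 / q) * dist y y'"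
      using E by (intro mult_right_mono) auto
    finally show "\<bar>convolve u (dilate \<psi> t) y - convolve u (dilate \<psi> t) y'\<bar> \<le> E * \<kappa> powr (1 / q) * dist y y'" .
  next
    fix u r h z y t \<kappa>
    assume *: "smooth u" "cont_supp r u" "grad_ctrl q u h" "\<kappa> \<ge> 0" "hl h z \<le> ennreal \<kappa>" and t: "t > 0" and d: "dist z y \<le> t"
    let ?p = "dilate \<psi> t" and ?p' = "dilate \<psi> (t / 2)"
    let ?v = "convolve u ?p" and ?v' = "convolve u ?p'"
    let ?H = "\<kappa> powr (1 / q)"
    have t2: "t / 2 > 0" using t by simp
    note p = cont_supp_psi_t[OF t] cont_supp_psi_t[OF t2]
    note m = cont_supp_measurable[OF p(1)] cont_supp_measurable[OF p(2)]
    note cv = cont_supp_convolve[OF *(2) p(1)] cont_supp_convolve[OF *(2) p(2)]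
    have "convolve ?p' ?v = convolve ?v ?p'" "convolve ?p ?v' = convolve ?v' ?p" "convolve ?p ?p' = convolve ?p' ?p"
      by (rule convolve_commute m cont_supp_measurable[OF cv(1)] cont_supp_measurable[OF cv(2)])+
    \<comment> \<open>The common middle term: mollifying \<open>?v\<close> at scale t/2 and
      \<open>?v'\<close> at scale \<open>t\<close> gives the same function.\<close>
    then have comm: "convolve ?p' ?v = convolve ?p ?v'"
      using convolve_assoc[OF *(2) p(1) p(2)] convolve_assoc[OF *(2) p(2) p(1)] by simp
    have 1: "\<bar>?v y - convolve ?p' ?v y\<bar> \<le> (D * ?H * t) * psi_mass"
      unfolding abs_int_psi_t[OF t2, symmetric]
    proof (rule minus_convolve_bound[OF p(2) int_psi_t[OF t2] cont_supp_continuous[OF cv(1)]])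
      fix w :: "real^'n" assume w: "norm w \<le> t / 2"
      have "\<bar>?v y - ?v (y - w)\<bar> \<le> D * ?H * dist y (y - w)"
        by (rule lip[OF *]) (use t d w in \<open>auto simp: dist_norm\<close>)
      also have "\<dots> \<le> D * ?H * t"
        using D w t by (intro mult_left_mono) (auto simp: dist_norm)
      finally show "\<bar>?v y - ?v (y - w)\<bar> \<le> D * ?H * t" .
    qed
    have 2: "\<bar>?v' y - convolve ?p ?v' y\<bar> \<le> (D * ?H * t) * psi_mass"
      unfolding abs_int_psi_t[OF t, symmetric]
    proof (rule minus_convolve_bound[OF p(1) int_psi_t[OF t] cont_supp_continuous[OF cv(2)]])
      fix w :: "real^'n" assume w: "norm w \<le> t"
      have "\<bar>?v' y - ?v' (y - w)\<bar> \<le> D * ?H * dist y (y - w)"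
        by (rule lip[OF *]) (use t d w in \<open>auto simp: dist_norm\<close>)
      also have "\<dots> \<le> D * ?H * t"
        using D w t by (intro mult_left_mono) (auto simp: dist_norm)
      finally show "\<bar>?v' y - ?v' (y - w)\<bar> \<le> D * ?H * t" .
    qed
    have "\<bar>?v y - ?v' y\<bar> \<le> 2 * D * psi_mass * (?H * t)"
      using 1 2 comm by (simp add: mult_ac)
    also have "\<dots> \<le> E * (?H * t)"
      using E t by (intro mult_right_mono) auto
    finally show "\<bar>?v y - ?v' y\<bar> \<le> E * ?H * t" by (simp add: mult.assoc)
  qed
qed

lemma mollify_tendsto:
  assumes u: "smooth u" "cont_supp r u" and d: "d > 0"
  shows "(\<lambda>k. convolve u (dilate \<psi> (d / 2 ^ k)) y) \<longlonglongrightarrow> u y"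
proof -
  obtain B where B: "B \<ge> 0" "\<And>j x. \<bar>partial j u x\<bar> \<le> B" using partials_bounded[OF u] by metis
  have "\<bar>convolve u (dilate \<psi> (d / 2 ^ k)) y - u y\<bar> \<le> real CARD('n) * B * psi_mass * d * (1 / 2) ^ k" for k
  proof -
    have t: "d / 2 ^ k > 0" using d by simp
    have "convolve u (dilate \<psi> (d / 2 ^ k)) = convolve (dilate \<psi> (d / 2 ^ k)) u"
      by (rule convolve_commute[OF cont_supp_measurable[OF u(2)] cont_supp_measurable[OF cont_supp_psi_t[OF t]]])
    moreover have "\<bar>u y - convolve (dilate \<psi> (d / 2 ^ k)) u y\<bar> \<le> (real CARD('n) * B * (d / 2 ^ k)) * psi_mass"
      unfolding abs_int_psi_t[OF t, symmetric]
    proof (rule minus_convolve_bound[OF cont_supp_psi_t[OF t] int_psi_t[OF t] cont_supp_continuous[OF u(2)]])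
      fix w :: "real^'n" assume w: "norm w \<le> d / 2 ^ k"
      have "\<bar>u (y + - w) - u y\<bar> \<le> real CARD('n) * B * norm (- w)"
        by (rule smooth_lipschitz[OF u(1) B(2)])
      also have "\<dots> \<le> real CARD('n) * B * (d / 2 ^ k)"
        using w B by (intro mult_left_mono) auto
      finally show "\<bar>u y - u (y - w)\<bar> \<le> real CARD('n) * B * (d / 2 ^ k)"
        by (simp add: abs_minus_commute)
    qed
    ultimately show ?thesis by (simp add: abs_minus_commute power_divide mult_ac)
  qed
  then have "\<forall>\<^sub>F k in sequentially. norm (convolve u (dilate \<psi> (d / 2 ^ k)) y - u y) \<le> real CARD('n) * B * psi_mass * d * (1 / 2) ^ k"
    by (intro always_eventually) simp
  moreover have "(\<lambda>k. real CARD('n) * B * psi_mass * d * (1 / 2) ^ k) \<longlonglongrightarrow> 0"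
    by (intro tendsto_mult_right_zero LIMSEQ_power_zero) simp
  ultimately have "(\<lambda>k. convolve u (dilate \<psi> (d / 2 ^ k)) y - u y) \<longlonglongrightarrow> 0"
    by (rule Lim_null_comparison)
  then show ?thesis by (simp add: LIM_zero_iff)
qed

end

section \<open>The pointwise Hardy inequality\<close>

lemma ennreal_le_suminf: "f k \<le> (\<Sum>k. f k)" for f :: "nat \<Rightarrow> ennreal"
proof -
  have "sum f {k} \<le> suminf f" by (rule sum_le_suminf) simp_all
  then show ?thesis by simp
qed

section \<open>Covers, Hausdorff content and the iterated maximal function\<close>

lemma hausdorff_content_le:
  assumes "\<And>k. r k > 0" "E \<subseteq> (\<Union>k. ball (a k) (r k))"
  shows "hausdorff_content c s E \<le> ennreal c * (\<Sum>k. ennreal (r k powr s))"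
  unfolding hausdorff_content_def
  by (intro mult_left_mono INF_lower2[of "(a, r)"]) (use assms in auto)

lemma hausdorff_content_geI:
  assumes "c > 0"
    and "\<And>a r. (\<And>k. r k > 0) \<Longrightarrow> E \<subseteq> (\<Union>k. ball (a k) (r k)) \<Longrightarrow> X \<le> ennreal c * (\<Sum>k. ennreal (r k powr s))"
  shows "X \<le> hausdorff_content c s E"
  unfolding hausdorff_content_def ennreal_divide_le_iff'[OF assms(1), symmetric]
  by (rule INF_greatest) (use assms in \<open>auto simp: ennreal_divide_le_iff'[OF assms(1)]\<close>)

lemma hausdorff_content_le_countable:
  fixes a :: "'i \<Rightarrow> real^'n"
  assumes C: "countable C" and r: "\<And>i. i \<in> C \<Longrightarrow> r i > 0" and E: "E \<subseteq> (\<Union>i\<in>C. ball (a i) (r i))" and s: "s > 0"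
    and T: "(\<integral>\<^sup>+i. ennreal (r i powr s) \<partial>count_space C) \<le> ennreal T" "T \<ge> 0" and c: "c > 0"
  shows "hausdorff_content c s E \<le> ennreal (c * T)"
proof (rule ennreal_le_epsilon)
  fix e :: real assume e: "e > 0"
  let ?e = "e / c"
  have e': "?e > 0" using e c by simp
  define J where "J = to_nat_on C ` C"
  define d where "d k = (?e * (1 / 2) ^ Suc k) powr (1 / s)" for k
  define r' where "r' k = (if k \<in> J then r (from_nat_into C k) else d k)" for k
  define a' where "a' k = a (from_nat_into C k)" for k
  have d: "d k > 0" "d k powr s = ?e * (1 / 2) ^ Suc k" for k
    unfolding d_def using e e' s c by (auto simp: powr_powr)
  have inj: "inj_on (to_nat_on C) C" using C by (rule inj_on_to_nat_on)
  have "hausdorff_content c s E \<le> ennreal c * (\<Sum>k. ennreal (r' k powr s))"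
  proof (rule hausdorff_content_le)
    show "r' k > 0" for k
      using d(1) r C by (auto simp: r'_def J_def)
    show "E \<subseteq> (\<Union>k. ball (a' k) (r' k))"
    proof
      fix x assume "x \<in> E"
      then obtain i where "i \<in> C" "x \<in> ball (a i) (r i)" using E by blast
      then show "x \<in> (\<Union>k. ball (a' k) (r' k))"
        using C by (intro UN_I[of "to_nat_on C i"]) (auto simp: a'_def r'_def J_def)
    qed
  qed
  also have "(\<Sum>k. ennreal (r' k powr s)) \<le>
      (\<Sum>k. ennreal (r (from_nat_into C k) powr s) * indicator J k + ennreal (?e * (1 / 2) ^ Suc k))"
    by (intro suminf_le) (auto simp: r'_def d(2) simp del: power_Suc)
  also have "\<dots> = (\<Sum>k. ennreal (r (from_nat_into C k) powr s) * indicator J k) + (\<Sum>k. ennreal (?e * (1 / 2) ^ Suc k))"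
    by (rule suminf_add[symmetric]) auto
  also have "(\<Sum>k. ennreal (?e * (1 / 2) ^ Suc k)) = ennreal ?e"
  proof -
    have "(\<lambda>k. ?e * (1 / 2) ^ Suc k) sums (?e * 1)"
      by (intro sums_mult power_half_series)
    then show ?thesis using e c by (intro suminf_ennreal_eq) auto
  qed
  also have "(\<Sum>k. ennreal (r (from_nat_into C k) powr s) * indicator J k) = (\<integral>\<^sup>+i. ennreal (r i powr s) \<partial>count_space C)"
  proof -
    have "(\<Sum>k. ennreal (r (from_nat_into C k) powr s) * indicator J k) =
        (\<integral>\<^sup>+k. ennreal (r (from_nat_into C k) powr s) * indicator J k \<partial>count_space UNIV)"
      by (rule nn_integral_count_space_nat[symmetric])
    also have "\<dots> = (\<integral>\<^sup>+k. ennreal (r (from_nat_into C k) powr s) \<partial>count_space J)"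
      by (rule nn_integral_count_space_indicator[symmetric]) simp
    also have "\<dots> = (\<integral>\<^sup>+i. ennreal (r (from_nat_into C (to_nat_on C i)) powr s) \<partial>count_space C)"
      by (rule nn_integral_bij_count_space[symmetric]) (use inj in \<open>simp add: J_def bij_betw_def\<close>)
    also have "\<dots> = (\<integral>\<^sup>+i. ennreal (r i powr s) \<partial>count_space C)"
      using C by (intro nn_integral_cong) simp
    finally show ?thesis .
  qed
  finally have "hausdorff_content c s E \<le> ennreal c * ((\<integral>\<^sup>+i. ennreal (r i powr s) \<partial>count_space C) + ennreal ?e)"
    by (simp add: mult_left_mono)
  also have "\<dots> \<le> ennreal c * (ennreal T + ennreal ?e)"
    by (intro mult_left_mono add_right_mono T) simp
  also have "\<dots> = ennreal (c * T) + ennreal e"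
    using T c e by (simp add: distrib_left flip: ennreal_mult)
  finally show "hausdorff_content c s E \<le> ennreal (c * T) + ennreal e" .
qed

text \<open>If the sum for the smaller exponent already reaches R^s', nothing is left to show.
  Otherwise every radius is below \<open>R\<close>, so r^s \<le> R^(s-s') * r^s' and the bound for
  the larger exponent transfers.\<close>

lemma content_thick_mono:
  fixes \<Omega> :: "(real^'n) set"
  assumes thick: "content_thick_complement c\<^sub>0 s \<Omega>" and c0: "c\<^sub>0 > 0" and s: "0 < s'" "s' \<le> s"
  shows "content_thick_complement c\<^sub>0 s' \<Omega>"
proof -
  obtain c where c: "c > 0" "\<And>x r. x \<in> -\<Omega> \<Longrightarrow> r > 0 \<Longrightarrow> ennreal (c * r powr s) \<le> hausdorff_content c\<^sub>0 s (-\<Omega> \<inter> ball x r)"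
    using thick unfolding content_thick_complement_def by blast
  have "ennreal (min c c\<^sub>0 * R powr s') \<le> hausdorff_content c\<^sub>0 s' (-\<Omega> \<inter> ball x R)" if x: "x \<in> -\<Omega>" and R: "R > 0" for x R
  proof (rule hausdorff_content_geI[OF c0])
    fix a :: "nat \<Rightarrow> real^'n" and r :: "nat \<Rightarrow> real"
    assume r: "\<And>k. r k > 0" and cov: "-\<Omega> \<inter> ball x R \<subseteq> (\<Union>k. ball (a k) (r k))"
    let ?S = "\<Sum>k. ennreal (r k powr s')"
    show "ennreal (min c c\<^sub>0 * R powr s') \<le> ennreal c\<^sub>0 * ?S"
    proof (cases "ennreal (R powr s') \<le> ?S")
      case True
      have "ennreal (min c c\<^sub>0 * R powr s') \<le> ennreal (c\<^sub>0 * R powr s')"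
        by (intro ennreal_leI mult_right_mono) auto
      also have "\<dots> = ennreal c\<^sub>0 * ennreal (R powr s')" using c0 by (simp add: ennreal_mult)
      also have "\<dots> \<le> ennreal c\<^sub>0 * ?S" by (intro mult_left_mono True) simp
      finally show ?thesis .
    next
      case False
      have rR: "r k < R" for k
      proof -
        have "ennreal (r k powr s') \<le> ?S" by (rule ennreal_le_suminf)
        also have "?S < ennreal (R powr s')" using False by (simp only: not_le)
        finally have "ennreal (r k powr s') < ennreal (R powr s')" .
        then have "r k powr s' < R powr s'" by (simp add: ennreal_less_iff)
        moreover have "R powr s' \<le> r k powr s'" if "R \<le> r k"
          using that s R by (intro powr_mono2) auto
        ultimately show ?thesis by linarith
      qed
      have "ennreal (c * R powr s) \<le> hausdorff_content c\<^sub>0 s (-\<Omega> \<inter> ball x R)" by (rule c(2)[OF x R])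
      also have "\<dots> \<le> ennreal c\<^sub>0 * (\<Sum>k. ennreal (r k powr s))"
        by (rule hausdorff_content_le[OF r cov])
      also have "(\<Sum>k. ennreal (r k powr s)) \<le> (\<Sum>k. ennreal (R powr (s - s')) * ennreal (r k powr s'))"
      proof (rule suminf_le)
        fix k
        have "r k powr s = r k powr (s - s') * r k powr s'" by (simp flip: powr_add)
        also have "\<dots> \<le> R powr (s - s') * r k powr s'"
          using rR[of k] r[of k] s by (intro mult_right_mono powr_mono2) auto
        finally show "ennreal (r k powr s) \<le> ennreal (R powr (s - s')) * ennreal (r k powr s')"
          by (simp add: ennreal_leI flip: ennreal_mult)
      qed auto
      also have "\<dots> = ennreal (R powr (s - s')) * ?S" by simp
      finally have "ennreal (c * R powr s) \<le> ennreal c\<^sub>0 * (ennreal (R powr (s - s')) * ?S)"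
        by this (intro mult_left_mono, auto)
      then have "ennreal (c * R powr s) \<le> ennreal (R powr (s - s')) * (ennreal c\<^sub>0 * ?S)"
        by (simp only: mult.left_commute)
      moreover have "ennreal (c * R powr s) = ennreal (R powr (s - s')) * ennreal (c * R powr s')"
        using c R by (simp add: mult_ac flip: ennreal_mult powr_add)
      ultimately have "ennreal (c * R powr s') \<le> ennreal c\<^sub>0 * ?S"
        using R by (simp add: ennreal_mult_le_mult_iff)
      moreover have "ennreal (min c c\<^sub>0 * R powr s') \<le> ennreal (c * R powr s')"
        by (intro ennreal_leI mult_right_mono) auto
      ultimately show ?thesis by (rule order_trans[rotated])
    qed
  qed
  then show ?thesis
    unfolding content_thick_complement_def using c c0 by (intro exI[of _ "min c c\<^sub>0"]) auto
qed

lemma ennreal_mult3: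
  "a \<ge> 0 \<Longrightarrow> b \<ge> 0 \<Longrightarrow> c \<ge> 0 \<Longrightarrow> ennreal (a * (b * c)) * z = ennreal a * (ennreal b * (ennreal c * z))"
  by (simp add: ennreal_mult mult.assoc)

text \<open>The integral over \<open>ball x r\<close> is at most that over
  \<open>ball z (2 * r)\<close> for every \<open>z\<close> in \<open>ball x r\<close>; averaging
  over \<open>z\<close> gives the claim. The bound holds at every point, not merely almost
  everywhere, as the pointwise inequality requires.\<close>

lemma hl_le_hl_hl:
  fixes h :: "real^'n \<Rightarrow> ennreal"
  shows "hl h x \<le> ennreal (2 ^ CARD('n) / vol TYPE('n)) * hl (hl h) x"
  unfolding hl_le_iff
proof (intro allI impI)
  fix r :: real assume r: "r > 0"
  let ?n = "CARD('n)" and ?v = "vol TYPE('n)"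
  let ?I = "\<integral>\<^sup>+z\<in>ball x r. h z \<partial>lborel"
  have v: "?v > 0" by (rule vol_pos)
  have hz: "?I \<le> ennreal ((2 * r) ^ ?n) * hl h z" if "z \<in> ball x r" for z
  proof -
    have "ball x r \<subseteq> ball z (2 * r)"
    proof
      fix y assume "y \<in> ball x r"
      then show "y \<in> ball z (2 * r)" using that dist_triangle[of z y x] by (simp add: dist_commute)
    qed
    then have "?I \<le> (\<integral>\<^sup>+y\<in>ball z (2 * r). h y \<partial>lborel)"
      by (intro nn_set_integral_set_mono) auto
    also have "\<dots> \<le> ennreal ((2 * r) ^ ?n) * hl h z" by (rule integral_ball_le_hl) (use r in auto)
    finally show ?thesis .
  qed
  have "?I * ennreal (?v * r ^ ?n) = (\<integral>\<^sup>+z. ?I * indicator (ball x r) z \<partial>lborel)"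
    using r by (simp add: nn_integral_cmult_indicator emeasure_ball_vol)
  also have "\<dots> \<le> (\<integral>\<^sup>+z. ennreal ((2 * r) ^ ?n) * (hl h z * indicator (ball x r) z) \<partial>lborel)"
  proof (rule nn_integral_mono)
    show "?I * indicator (ball x r) z \<le> ennreal ((2 * r) ^ ?n) * (hl h z * indicator (ball x r) z)" for z
      using hz[of z] by (cases "z \<in> ball x r") (simp_all del: mem_ball)
  qed
  also have "\<dots> = ennreal ((2 * r) ^ ?n) * (\<integral>\<^sup>+z\<in>ball x r. hl h z \<partial>lborel)"
    by (rule nn_integral_cmult) (auto intro!: borel_measurable_times_ennreal borel_measurable_indicator)
  also have "\<dots> \<le> ennreal ((2 * r) ^ ?n) * (ennreal (r ^ ?n) * hl (hl h) x)"
    by (intro mult_left_mono integral_ball_le_hl r) simp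
  also have "\<dots> = ennreal ((2 * r) ^ ?n * r ^ ?n) * hl (hl h) x"
    using r by (subst ennreal_mult) (auto simp: mult.assoc)
  also have "(2 * r) ^ ?n * r ^ ?n = (?v * r ^ ?n) * (r ^ ?n * (2 ^ ?n / ?v))"
    using v by (simp add: power_mult_distrib)
  also have "ennreal \<dots> * hl (hl h) x = ennreal (?v * r ^ ?n) * (ennreal (r ^ ?n) * (ennreal (2 ^ ?n / ?v) * hl (hl h) x))"
    by (rule ennreal_mult3) (use r v in auto)
  finally show "?I \<le> ennreal (r ^ ?n) * (ennreal (2 ^ ?n / ?v) * hl (hl h) x)"
    using r v by (simp add: mult.commute[of ?I] ennreal_mult_le_mult_iff)
qed

lemma integral_ball_ge:
  fixes f :: "real^'n \<Rightarrow> ennreal"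
  assumes "r > 0" "\<And>z. z \<in> ball y r \<Longrightarrow> ennreal b \<le> f z" "b \<ge> 0"
  shows "ennreal (b * (vol TYPE('n) * r ^ CARD('n))) \<le> (\<integral>\<^sup>+z\<in>ball y r. f z \<partial>lborel)"
proof -
  have "ennreal (b * (vol TYPE('n) * r ^ CARD('n))) = (\<integral>\<^sup>+z. ennreal b * indicator (ball y r) z \<partial>lborel)"
    using assms vol_pos[where 'n='n] by (simp add: nn_integral_cmult_indicator emeasure_ball_vol ennreal_mult)
  also have "\<dots> \<le> (\<integral>\<^sup>+z\<in>ball y r. f z \<partial>lborel)"
    by (intro nn_integral_mono) (use assms in \<open>auto simp: indicator_def\<close>)
  finally show ?thesis .
qed

context mollifier
begin

lemma mollify_telescope:
  assumes u: "smooth u" "cont_supp r u" and d: "d > 0" and rho: "0 \<le> \<rho>" "\<rho> < 1" and M: "M \<ge> 0"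
    and step: "\<And>k. \<bar>convolve u (dilate \<psi> (d / 2 ^ k)) y - convolve u (dilate \<psi> (d / 2 ^ Suc k)) y\<bar> \<le> M * \<rho> ^ k"
  shows "\<bar>convolve u (dilate \<psi> d) y - u y\<bar> \<le> M / (1 - \<rho>)"
proof -
  let ?v = "\<lambda>k. convolve u (dilate \<psi> (d / 2 ^ k)) y"
  have "\<bar>?v 0 - ?v K\<bar> \<le> M / (1 - \<rho>)" for K
  proof -
    have "?v 0 - ?v K = (\<Sum>k<K. ?v k - ?v (Suc k))" using sum_lessThan_telescope'[of ?v K] by simp
    also have "\<bar>\<dots>\<bar> \<le> (\<Sum>k<K. M * \<rho> ^ k)"
      by (rule order_trans[OF sum_abs sum_mono[OF step]])
    also have "\<dots> = M * ((1 - \<rho> ^ K) / (1 - \<rho>))"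
      using rho by (simp add: sum_distrib_left[symmetric] sum_gp_strict)
    also have "\<dots> \<le> M * (1 / (1 - \<rho>))"
      using rho M by (intro mult_left_mono divide_right_mono) auto
    finally show ?thesis by simp
  qed
  moreover have "(\<lambda>K. \<bar>?v 0 - ?v K\<bar>) \<longlonglongrightarrow> \<bar>?v 0 - u y\<bar>"
    by (intro tendsto_intros mollify_tendsto[OF u d])
  ultimately have "\<bar>?v 0 - u y\<bar> \<le> M / (1 - \<rho>)"
    by (intro LIMSEQ_le_const2[where x = "\<bar>?v 0 - u y\<bar>"]) auto
  then show ?thesis by simp
qed

text \<open>At a point of the complement where the increments are too large at some scale
  \<open>R\<close>, the maximal function \<open>hl h\<close> must be large on the whole ball of that
  radius. If all complement points near the nearest boundary point \<open>w\<close> were of this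
  kind, these balls would carry so much mass that their (n - q0)-content falls below the thickness
  bound.\<close>

lemma pointwise_hardy:
  fixes \<Omega> :: "(real^'n) set"
  assumes q: "0 < q0" "q0 < q" "q < 1" and c0: "c\<^sub>0 > 0"
    and thick: "content_thick_complement c\<^sub>0 (real CARD('n) - q0) \<Omega>"
    and Om: "open \<Omega>" "\<Omega> \<noteq> UNIV"
  obtains C where "C > 0" "\<And>u h x \<kappa>. \<lbrakk>test_function \<Omega> u; grad_ctrl q u h; x \<in> \<Omega>; \<kappa> > 0; hl (hl h) x \<le> ennreal \<kappa>\<rbrakk>
      \<Longrightarrow> \<bar>u x\<bar> \<le> C * \<kappa> powr (1 / q) * infdist x (frontier \<Omega>)"
proof -
  let ?n = "CARD('n)" and ?v = "vol TYPE('n)"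
  let ?s = "real ?n - q0"
  have q': "0 < q" using q by simp
  have "1 \<le> ?n" by (simp add: Suc_leI)
  then have s: "?s > 0" using q by linarith
  have v: "?v > 0" by (rule vol_pos)
  obtain c where c: "c > 0" "\<And>x r. x \<in> -\<Omega> \<Longrightarrow> r > 0 \<Longrightarrow> ennreal (c * r powr ?s) \<le> hausdorff_content c\<^sub>0 ?s (-\<Omega> \<inter> ball x r)"
    using thick unfolding content_thick_complement_def by blast
  obtain C1 where C1: "C1 > 0" and
    lip: "\<And>u r h z y y' t \<kappa>. \<lbrakk>smooth u; cont_supp r u; grad_ctrl q u h; \<kappa> \<ge> 0; hl h z \<le> ennreal \<kappa>; t > 0;
      dist z y \<le> 2 * t; dist y y' \<le> 2 * t\<rbrakk>
      \<Longrightarrow> \<bar>convolve u (dilate \<psi> t) y - convolve u (dilate \<psi> t) y'\<bar> \<le> C1 * \<kappa> powr (1 / q) * dist y y'" and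
    half: "\<And>u r h z y t \<kappa>. \<lbrakk>smooth u; cont_supp r u; grad_ctrl q u h; \<kappa> \<ge> 0; hl h z \<le> ennreal \<kappa>; t > 0; dist z y \<le> t\<rbrakk>
      \<Longrightarrow> \<bar>convolve u (dilate \<psi> t) y - convolve u (dilate \<psi> (t / 2)) y\<bar> \<le> C1 * \<kappa> powr (1 / q) * t"
    by (rule mollified_estimates[OF q' q(3)]) (rule that; blast)
  \<comment> \<open>A level growing like (d / R)^q0 enters the increments as (d / R)^(q0/q), against
    the factor \<open>R / d\<close>. With R = d / 2^k this leaves 2^(-k \<delta>), summable because
    q0 < q.\<close>
  define \<delta> where "\<delta> = 1 - q0 / q"
  have delta: "0 < \<delta>" using q by (simp add: \<delta>_def)
  define \<rho> where "\<rho> = 2 powr (- \<delta>)"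
  have rho: "0 < \<rho>" "\<rho> < 1" using delta by (auto simp: \<rho>_def powr_less_one)
  \<comment> \<open>Chosen so that the content estimate at the end of the covering argument comes
    out as half of the lower bound given by thickness.\<close>
  define L where "L = 2 * c\<^sub>0 * 5 powr ?s * 3 ^ ?n / (c * ?v)"
  have L: "L > 0" using c0 c v by (simp add: L_def)
  define A where "A = C1 * L powr (1 / q)"
  have A: "A > 0" using C1 L by (simp add: A_def)
  define K where "K = (2 ^ ?n / ?v) powr (1 / q)"
  define C where "C = 4 * C1 * K + A / (1 - \<rho>)"
  have "C > 0" using C1 A rho v by (auto simp: C_def K_def intro!: add_nonneg_pos)
  show ?thesis
  proof (rule that[OF \<open>C > 0\<close>])
    fix u h x \<kappa>
    assume tu: "test_function \<Omega> u" and gc: "grad_ctrl q u h" and x: "x \<in> \<Omega>" and k: "\<kappa> > 0" and hk: "hl (hl h) x \<le> ennreal \<kappa>"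
    obtain r where cu: "cont_supp r u" using test_function_cc[OF tu] by blast
    note su = test_function_smooth[OF tu]
    have fr: "frontier \<Omega> \<noteq> {}" "frontier \<Omega> \<inter> \<Omega> = {}" using Om x frontier_eq_empty[of \<Omega>] by (auto simp: frontier_def interior_open)
    obtain w where w: "w \<in> frontier \<Omega>" "infdist x (frontier \<Omega>) = dist x w"
      using infdist_attains_inf[OF frontier_closed fr(1), of x] by blast
    define d where "d = dist x w"
    have wO: "w \<in> -\<Omega>" using w fr by blast
    then have d: "d > 0" using x by (auto simp: d_def)
    let ?H = "\<kappa> powr (1 / q)"
    let ?\<tau> = "\<lambda>y k. \<bar>convolve u (dilate \<psi> (d / 2 ^ k)) y - convolve u (dilate \<psi> (d / 2 ^ Suc k)) y\<bar>"
    let ?E = "-\<Omega> \<inter> ball w d"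
    have E2: "dist x y \<le> 2 * d" if "y \<in> ?E" for y
      using that dist_triangle[of x y w] by (simp add: d_def)
    \<comment> \<open>By contradiction: each \<open>y\<close> gets a bad scale \<open>R y\<close>,
      and the scale estimate \<open>half\<close>, read backwards at every \<open>z\<close> within
      \<open>R y\<close> of \<open>y\<close>, forces \<open>hl h z\<close> above the level
      \<open>b y\<close>.\<close>
    have "\<exists>y\<in>?E. \<forall>k. ?\<tau> y k \<le> (A * d * ?H) * \<rho> ^ k"
    proof (rule ccontr)
      assume "\<not> ?thesis"
      then have "\<forall>y\<in>?E. \<exists>k. (A * d * ?H) * \<rho> ^ k < ?\<tau> y k" by (simp add: not_le)
      then obtain N where N: "\<And>y. y \<in> ?E \<Longrightarrow> (A * d * ?H) * \<rho> ^ N y < ?\<tau> y (N y)" by metis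
      define R where "R y = d / 2 ^ N y" for y
      have R: "R y > 0" "R y \<le> d" for y using d by (auto simp: R_def field_simps)
      \<comment> \<open>The power \<open>q0\<close> makes \<open>b y\<close> times the volume of
        \<open>ball y (R y)\<close> proportional to R^(n-q0), the summand of the content.\<close>
      define b where "b y = L * (d / R y) powr q0 * \<kappa>" for y
      have b: "b y \<ge> 0" for y using L k by (simp add: b_def)
      have low: "ennreal (b y) \<le> hl h z" if y: "y \<in> ?E" and z: "z \<in> ball y (R y)" for y z
      proof (rule ccontr)
        assume "\<not> ?thesis"
        then have "hl h z \<le> ennreal (b y)" by simp
        then have "?\<tau> y (N y) \<le> C1 * b y powr (1 / q) * R y"
          using half[OF su cu gc b, of z y "R y" y] R[of y] z by (simp add: R_def dist_commute mult.commute)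
        also have "b y powr (1 / q) = L powr (1 / q) * (d / R y) powr (q0 / q) * ?H"
          using L k by (simp add: b_def powr_mult powr_powr)
        also have "C1 * (L powr (1 / q) * (d / R y) powr (q0 / q) * ?H) * R y = A * d * ?H * ((d / R y) powr (q0 / q) * (R y / d))"
          using d by (simp add: A_def)
        also have "(d / R y) powr (q0 / q) * (R y / d) = \<rho> ^ N y"
        proof -
          have "(d / R y) powr (q0 / q) * (R y / d) = (2 powr real (N y)) powr (q0 / q) * (2 powr real (N y)) powr (- 1)"
            using d by (simp add: R_def powr_realpow powr_minus_divide)
          also have "\<dots> = (2 powr real (N y)) powr (- \<delta>)"
            by (subst powr_add[symmetric]) (simp add: \<delta>_def)
          also have "\<dots> = \<rho> ^ N y"
            by (simp add: \<rho>_def powr_powr powr_realpow[symmetric] mult.commute)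
          finally show ?thesis .
        qed
        finally show False using N[OF y] by simp
      qed
      have cov: "?E \<subseteq> (\<Union>y\<in>?E. ball (id y) (R y))" using R(1) by force
      obtain D where D: "countable D" "D \<subseteq> ?E"
        "pairwise (\<lambda>i j. disjnt (ball (id i) (R i)) (ball (id j) (R j))) D"
        "?E \<subseteq> (\<Union>i\<in>D. ball (id i) (5 * R i))"
        by (rule Vitali_covering_lemma_balls[OF cov, of d]) (use R in auto)
      have mass: "ennreal (L * \<kappa> * d powr q0 * ?v) * ennreal (R y powr ?s) \<le> (\<integral>\<^sup>+z\<in>ball y (R y). hl h z \<partial>lborel)" if "y \<in> D" for y
      proof -
        have "ennreal (b y * (?v * R y ^ ?n)) \<le> (\<integral>\<^sup>+z\<in>ball y (R y). hl h z \<partial>lborel)"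
          by (rule integral_ball_ge[OF R(1) low b]) (use that D in auto)
        moreover have "b y * (?v * R y ^ ?n) = L * \<kappa> * d powr q0 * ?v * R y powr ?s"
          using R(1)[of y] d by (simp add: b_def powr_diff powr_divide powr_realpow)
        ultimately show ?thesis
          using L k v by (simp flip: ennreal_mult)
      qed
      let ?T = "\<integral>\<^sup>+y. ennreal (R y powr ?s) \<partial>count_space D"
      have "ennreal (L * \<kappa> * d powr q0 * ?v) * ?T = (\<integral>\<^sup>+y. ennreal (L * \<kappa> * d powr q0 * ?v) * ennreal (R y powr ?s) \<partial>count_space D)"
        by (rule nn_integral_cmult[symmetric]) simp
      also have "\<dots> \<le> (\<integral>\<^sup>+y. (\<integral>\<^sup>+z\<in>ball y (R y). hl h z \<partial>lborel) \<partial>count_space D)"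
        by (intro nn_integral_mono mass) simp
      also have "\<dots> \<le> (\<integral>\<^sup>+z\<in>ball x (3 * d). hl h z \<partial>lborel)"
      proof (rule nn_integral_disjoint_le[OF D(1)])
        show "disjoint_family_on (\<lambda>y. ball y (R y)) D"
          using D(3) by (auto simp: disjoint_family_on_def pairwise_def disjnt_def)
        fix y assume "y \<in> D"
        then have "y \<in> ?E" using D by blast
        then have "dist x y < 2 * d" using dist_triangle[of x y w] by (simp add: d_def)
        then show "ball y (R y) \<subseteq> ball x (3 * d)"
          using R(2)[of y] unfolding ball_subset_ball_iff by (simp add: dist_commute)
      qed auto
      also have "\<dots> \<le> ennreal ((3 * d) ^ ?n) * hl (hl h) x"
        by (rule integral_ball_le_hl) (use d in auto)
      also have "\<dots> \<le> ennreal ((3 * d) ^ ?n) * ennreal \<kappa>"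
        by (intro mult_left_mono hk) simp
      also have "\<dots> = ennreal (L * \<kappa> * d powr q0 * ?v) * ennreal (3 ^ ?n * d powr ?s / (L * ?v))"
        using L k d v by (simp add: powr_diff powr_realpow power_mult_distrib flip: ennreal_mult)
      finally have "?T \<le> ennreal (3 ^ ?n * d powr ?s / (L * ?v))"
        using L k d v by (simp add: ennreal_mult_le_mult_iff)
      then have T5: "(\<integral>\<^sup>+y. ennreal ((5 * R y) powr ?s) \<partial>count_space D) \<le> ennreal (5 powr ?s * (3 ^ ?n * d powr ?s / (L * ?v)))"
      proof -
        have "(\<integral>\<^sup>+y. ennreal ((5 * R y) powr ?s) \<partial>count_space D) = (\<integral>\<^sup>+y. ennreal (5 powr ?s) * ennreal (R y powr ?s) \<partial>count_space D)"
          using R(1) by (intro nn_integral_cong) (simp add: powr_mult less_imp_le flip: ennreal_mult)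
        also have "\<dots> = ennreal (5 powr ?s) * ?T"
          by (rule nn_integral_cmult) simp
        also have "\<dots> \<le> ennreal (5 powr ?s) * ennreal (3 ^ ?n * d powr ?s / (L * ?v))"
          by (intro mult_left_mono \<open>?T \<le> _\<close>) simp
        finally show ?thesis using L v by (simp flip: ennreal_mult)
      qed
      have "ennreal (c * d powr ?s) \<le> hausdorff_content c\<^sub>0 ?s ?E" by (rule c(2)[OF wO d])
      also have "\<dots> \<le> ennreal (c\<^sub>0 * (5 powr ?s * (3 ^ ?n * d powr ?s / (L * ?v))))"
        by (rule hausdorff_content_le_countable[OF D(1) _ _ s T5 _ c0, where a = id]) (use R(1) D(4) L v in auto)
      also have "c\<^sub>0 * (5 powr ?s * (3 ^ ?n * d powr ?s / (L * ?v))) = c / 2 * d powr ?s"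
        using c c0 v by (simp add: L_def)
      finally show False using c d by simp
    qed
    then obtain y where y: "y \<in> ?E" "\<And>k. ?\<tau> y k \<le> (A * d * ?H) * \<rho> ^ k" by blast
    have 1: "\<bar>convolve u (dilate \<psi> d) y - u y\<bar> \<le> (A * d * ?H) / (1 - \<rho>)"
      by (rule mollify_telescope[OF su cu d _ _ _ y(2)]) (use rho A d in auto)
    \<comment> \<open>At \<open>y\<close> the telescoped increments therefore bound the
      mollification of \<open>u\<close> itself; \<open>x\<close> is reached by comparing
      \<open>x\<close> with \<open>y\<close> at the single scale \<open>d\<close>.\<close>
    have uy: "u y = 0" using test_function_zero[OF tu] y(1) by blast
    \<comment> \<open>The hypothesis bounds \<open>hl (hl h)\<close> at \<open>x\<close>, while the
      estimates centred at \<open>x\<close> ask for \<open>hl h x\<close>.\<close>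
    define \<kappa>1 where "\<kappa>1 = 2 ^ ?n / ?v * \<kappa>"
    have k1: "\<kappa>1 \<ge> 0" "\<kappa>1 powr (1 / q) = K * ?H"
      unfolding \<kappa>1_def K_def using k v powr_mult[of "2 ^ ?n / ?v" \<kappa> "1 / q"] by auto
    have h1: "hl h x \<le> ennreal \<kappa>1"
    proof -
      have "hl h x \<le> ennreal (2 ^ ?n / ?v) * ennreal \<kappa>"
        by (rule order_trans[OF hl_le_hl_hl mult_left_mono[OF hk]]) simp
      then show ?thesis using k v by (simp add: \<kappa>1_def flip: ennreal_mult)
    qed
    have 2: "\<bar>convolve u (dilate \<psi> d) x - u x\<bar> \<le> (C1 * (K * ?H) * d) / (1 - 1 / 2)"
    proof (rule mollify_telescope[OF su cu d])
      show "?\<tau> x k \<le> (C1 * (K * ?H) * d) * (1 / 2) ^ k" for k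
        using half[OF su cu gc k1(1) h1, of "d / 2 ^ k" x] d by (simp add: k1 power_divide mult.commute)
    qed (use C1 d in \<open>auto simp: K_def\<close>)
    have 3: "\<bar>convolve u (dilate \<psi> d) x - convolve u (dilate \<psi> d) y\<bar> \<le> C1 * (K * ?H) * (2 * d)"
    proof -
      have "\<bar>convolve u (dilate \<psi> d) x - convolve u (dilate \<psi> d) y\<bar> \<le> C1 * \<kappa>1 powr (1 / q) * dist x y"
        by (rule lip[OF su cu gc k1(1) h1 d]) (use d E2[OF y(1)] in auto)
      also have "\<dots> \<le> C1 * (K * ?H) * (2 * d)"
        unfolding k1(2) using C1 E2[OF y(1)] by (intro mult_left_mono) (auto simp: K_def)
      finally show ?thesis .
    qed
    have "\<bar>u x\<bar> \<le> (A * d * ?H) / (1 - \<rho>) + (C1 * (K * ?H) * d) / (1 - 1 / 2) + C1 * (K * ?H) * (2 * d)"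
      using 1 2 3 uy by linarith
    also have "\<dots> = C * ?H * d" by (simp add: C_def algebra_simps)
    finally show "\<bar>u x\<bar> \<le> C * ?H * infdist x (frontier \<Omega>)" by (simp add: w(2) d_def)
  qed
qed

section \<open>From the pointwise bound to the integral inequality\<close>

lemma maximal_measurable:
  assumes "cont_supp r f"
  shows "maximal \<psi> f \<in> borel_measurable borel"
proof (rule borel_measurableI_greater)
  fix y
  \<comment> \<open>The supremum runs over uncountably many scales; measurability is saved because
    each superlevel set is a union of open sets.\<close>
  have "{x \<in> space borel. y < maximal \<psi> f x} = (\<Union>t\<in>{0<..}. {x. y < ennreal \<bar>convolve f (dilate \<psi> t) x\<bar>})"
    by (auto simp: maximal_def less_SUP_iff)
  moreover have "open {x. y < ennreal \<bar>convolve f (dilate \<psi> t) x\<bar>}" if "t > 0" for t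
    by (intro open_Collect_less continuous_intros continuous_on_ennreal cont_supp_continuous[OF cont_supp_convolve[OF assms cont_supp_psi_t[OF that]]])
  ultimately show "{x \<in> space borel. y < maximal \<psi> f x} \<in> sets borel"
    by (simp only:) (intro borel_open open_UN ballI, auto)
qed

lemma hardy_norm_powr:
  assumes "p > 0"
  shows "epowr (hardy_norm \<psi> p f) p = (\<integral>\<^sup>+x. epowr (maximal \<psi> f x) p \<partial>lborel)"
  using assms by (simp add: hardy_norm_def epowr_epowr epowr_one)

theorem hardy_of_content_thick:
  fixes \<Omega> :: "(real^'n) set"
  assumes c0: "c\<^sub>0 > 0" and q0: "0 < q0" "q0 < p" and p: "p \<le> 1"
    and thick: "content_thick_complement c\<^sub>0 (real CARD('n) - q0) \<Omega>"
    and Om: "open \<Omega>" "\<Omega> \<noteq> UNIV"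
  shows "carries_hardy_inequality \<psi> p \<Omega>"
proof -
  \<comment> \<open>Any value strictly between \<open>q0\<close> and \<open>p\<close> works:
    \<open>q0 < q\<close> feeds the pointwise inequality, and \<open>p / q > 1\<close> the maximal
    theorem, which is applied twice and so contributes \<open>K * K\<close>.\<close>
  define q where "q = (q0 + p) / 2"
  have q: "q0 < q" "q < 1" "q < p" "0 < q" and p0: "p > 0" using q0 p by (auto simp: q_def)
  obtain C where C: "C > 0" "\<And>u h x \<kappa>. \<lbrakk>test_function \<Omega> u; grad_ctrl q u h; x \<in> \<Omega>; \<kappa> > 0; hl (hl h) x \<le> ennreal \<kappa>\<rbrakk>
      \<Longrightarrow> \<bar>u x\<bar> \<le> C * \<kappa> powr (1 / q) * infdist x (frontier \<Omega>)"
    using pointwise_hardy[OF q0(1) q(1,2) c0 thick Om] by metis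
  have "p / q > 1" using q by simp
  from hl_strong[OF this] obtain K where K: "K > 0" "\<And>h :: real^'n \<Rightarrow> ennreal. h \<in> borel_measurable borel \<Longrightarrow>
    (\<integral>\<^sup>+x. epowr (hl h x) (p / q) \<partial>lborel) \<le> ennreal K * (\<integral>\<^sup>+x. epowr (h x) (p / q) \<partial>lborel)"
    by metis
  show ?thesis
    unfolding carries_hardy_inequality_def
  proof (intro exI[of _ "C powr p * (K * K)"] allI impI)
    fix u assume tu: "test_function \<Omega> u"
    obtain r where cu: "cont_supp r u" using test_function_cc[OF tu] by blast
    note su = test_function_smooth[OF tu]
    let ?m = "\<lambda>j. maximal \<psi> (partial j u)"
    have m [measurable]: "?m j \<in> borel_measurable borel" for j
      by (rule maximal_measurable[OF cont_supp_partial[OF su cu]])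
    define h where "h = (\<lambda>w. epowr (\<Sum>j\<in>UNIV. ?m j w) q)"
    have h [measurable]: "h \<in> borel_measurable borel" unfolding h_def by measurable
    have gc: "grad_ctrl q u h"
      unfolding grad_ctrl_def h_def using q h unfolding h_def
      by (auto intro!: epowr_mono member_le_sum)
    have pw: "ennreal ((\<bar>u x\<bar> / infdist x (frontier \<Omega>)) powr p) \<le> ennreal (C powr p) * epowr (hl (hl h) x) (p / q)" if x: "x \<in> \<Omega>" for x
    proof (cases "hl (hl h) x")
      case top
      then show ?thesis using C by (simp add: epowr_def ennreal_mult_top)
    next
      case (real k)
      let ?d = "infdist x (frontier \<Omega>)"
      let ?a = "\<bar>u x\<bar> / ?d / C"
      have a0: "?a \<ge> 0" using C by (simp add: infdist_nonneg)
      \<comment> \<open>The pointwise inequality needs a positive bound while \<open>k\<close> may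
        be 0, hence the detour through \<open>k + e\<close>.\<close>
      have "?a powr q \<le> k + e" if e: "e > 0" for e
      proof -
        have "\<bar>u x\<bar> \<le> C * (k + e) powr (1 / q) * ?d"
          by (rule C(2)[OF tu gc x]) (use real e in auto)
        then have "?a \<le> (k + e) powr (1 / q)"
          using C infdist_nonneg[of x "frontier \<Omega>"] by (cases "?d = 0") (auto simp: field_simps)
        then have "?a powr q \<le> ((k + e) powr (1 / q)) powr q"
          using q a0 by (intro powr_mono2) auto
        then show ?thesis using q real e by (simp add: powr_powr)
      qed
      then have "?a powr q \<le> k" by (rule field_le_epsilon)
      then have "(?a powr q) powr (p / q) \<le> k powr (p / q)"
        using q by (intro powr_mono2) auto
      then have "?a powr p \<le> k powr (p / q)" using q by (simp add: powr_powr)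
      then have "(C * ?a) powr p \<le> C powr p * k powr (p / q)"
        using C a0 by (subst powr_mult) (auto intro: mult_left_mono)
      then show ?thesis using real C by (simp add: epowr_ennreal ennreal_leI flip: ennreal_mult)
    qed
    have "(\<integral>\<^sup>+x\<in>\<Omega>. ennreal ((\<bar>u x\<bar> / infdist x (frontier \<Omega>)) powr p) \<partial>lborel) \<le>
        (\<integral>\<^sup>+x. ennreal (C powr p) * epowr (hl (hl h) x) (p / q) \<partial>lborel)"
      by (intro nn_integral_mono) (auto simp: indicator_def pw)
    also have "\<dots> = ennreal (C powr p) * (\<integral>\<^sup>+x. epowr (hl (hl h) x) (p / q) \<partial>lborel)"
      by (rule nn_integral_cmult) measurable
    also have "\<dots> \<le> ennreal (C powr p) * (ennreal K * (ennreal K * (\<integral>\<^sup>+x. epowr (h x) (p / q) \<partial>lborel)))"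
      by (intro mult_left_mono order_trans[OF K(2)[OF hl_measurable]] K(2) h) auto
    also have "(\<integral>\<^sup>+x. epowr (h x) (p / q) \<partial>lborel) \<le> (\<integral>\<^sup>+x. (\<Sum>j\<in>UNIV. epowr (?m j x) p) \<partial>lborel)"
      using q p0 p by (intro nn_integral_mono) (simp add: h_def epowr_epowr epowr_sum_subadditive)
    also have "\<dots> = (\<Sum>j\<in>UNIV. \<integral>\<^sup>+x. epowr (?m j x) p \<partial>lborel)"
      by (rule nn_integral_sum) measurable
    also have "\<dots> = (\<Sum>j\<in>UNIV. epowr (hardy_norm \<psi> p (partial j u)) p)"
      by (simp add: hardy_norm_powr[OF p0])
    finally show "(\<integral>\<^sup>+x\<in>\<Omega>. ennreal ((\<bar>u x\<bar> / infdist x (frontier \<Omega>)) powr p) \<partial>lborel) \<le>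
        ennreal (C powr p * (K * K)) * (\<Sum>j\<in>UNIV. epowr (hardy_norm \<psi> p (partial j u)) p)"
      using K C by (simp add: ennreal_mult mult.assoc mult_left_mono)
  qed
qed

end

section \<open>Extrapolation and bump functions\<close>

text \<open>Summation over dyadic balls: on the k-th one the integrand is replaced by 2^(-k e) while
  the volume grows like 2^(k n), a convergent geometric series because e > n.\<close>

lemma decay_integral_finite:
  assumes e: "e > real CARD('n)"
  shows "(\<integral>\<^sup>+w. ennreal ((1 + norm (w :: real^'n)) powr (- e)) \<partial>lborel) < \<infinity>"
proof -
  let ?n = "CARD('n)" and ?v = "vol TYPE('n)"
  let ?B = "\<lambda>k. ball (0 :: real^'n) (2 ^ Suc k)"
  define \<rho> where "\<rho> = 2 powr (real ?n - e)"
  have rho: "0 < \<rho>" "\<rho> < 1" using e by (auto simp: \<rho>_def powr_less_one)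
  have v: "?v > 0" by (rule vol_pos)
  have "ennreal ((1 + norm w) powr (- e)) \<le> (\<Sum>k. ennreal ((2 ^ k) powr (- e)) * indicator (?B k) w)" for w :: "real^'n"
  proof -
    \<comment> \<open>Minimality gives the lower bound 2^k \<le> 1 + |w|; for k = 0 it is
      trivial.\<close>
    define k where "k = (LEAST k. 1 + norm w < 2 ^ Suc k)"
    obtain m where "1 + norm w < 2 ^ m" using real_arch_pow[of 2 "1 + norm w"] by auto
    also have "(2 :: real) ^ m \<le> 2 ^ Suc m" by simp
    finally have "1 + norm w < 2 ^ Suc m" .
    then have k: "1 + norm w < 2 ^ Suc k" unfolding k_def by (rule LeastI)
    have k': "2 ^ k \<le> 1 + norm w"
    proof (cases k)
      case (Suc j)
      then have "\<not> 1 + norm w < 2 ^ Suc j" unfolding k_def by (intro not_less_Least) simp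
      then show ?thesis using Suc by simp
    qed simp
    have "ennreal ((1 + norm w) powr (- e)) \<le> ennreal ((2 ^ k) powr (- e)) * indicator (?B k) w"
      using k k' e by (auto intro!: ennreal_leI powr_mono2')
    also have "\<dots> \<le> (\<Sum>k. ennreal ((2 ^ k) powr (- e)) * indicator (?B k) w)"
      by (rule ennreal_le_suminf)
    finally show ?thesis .
  qed
  then have "(\<integral>\<^sup>+w. ennreal ((1 + norm (w :: real^'n)) powr (- e)) \<partial>lborel) \<le>
      (\<integral>\<^sup>+w. (\<Sum>k. ennreal ((2 ^ k) powr (- e)) * indicator (?B k) w) \<partial>lborel)"
    by (intro nn_integral_mono) auto
  also have "\<dots> = (\<Sum>k. \<integral>\<^sup>+w. ennreal ((2 ^ k) powr (- e)) * indicator (?B k) w \<partial>lborel)"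
    by (rule nn_integral_suminf) (intro borel_measurable_times_ennreal borel_measurable_indicator borel_measurable_const, simp)
  also have "\<dots> = (\<Sum>k. ennreal (?v * 2 ^ ?n * \<rho> ^ k))"
  proof (rule suminf_cong)
    fix k
    have "(2 ^ k) powr (- e) * (?v * (2 ^ Suc k) ^ ?n) = ?v * 2 ^ ?n * ((2 powr real k) powr (- e) * (2 powr real k) powr real ?n)"
      by (simp add: powr_realpow power_mult_distrib)
    also have "(2 powr real k) powr (- e) * (2 powr real k) powr real ?n = \<rho> ^ k"
      by (simp add: \<rho>_def powr_powr powr_add[symmetric] powr_realpow[symmetric] algebra_simps)
    finally have "(2 ^ k) powr (- e) * (?v * (2 ^ Suc k) ^ ?n) = ?v * 2 ^ ?n * \<rho> ^ k" .
    moreover have "(\<integral>\<^sup>+w. ennreal ((2 ^ k) powr (- e)) * indicator (?B k) w \<partial>lborel) = ennreal ((2 ^ k) powr (- e) * (?v * (2 ^ Suc k) ^ ?n))"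
      by (subst nn_integral_cmult_indicator) (use v in \<open>auto simp: emeasure_ball_vol ennreal_mult simp del: power_Suc\<close>)
    ultimately show "(\<integral>\<^sup>+w. ennreal ((2 ^ k) powr (- e)) * indicator (?B k) w \<partial>lborel) = ennreal (?v * 2 ^ ?n * \<rho> ^ k)" by (simp only:)
  qed
  also have "\<dots> = ennreal (?v * 2 ^ ?n * (1 / (1 - \<rho>)))"
  proof (rule suminf_ennreal_eq)
    show "(\<lambda>k. ?v * 2 ^ ?n * \<rho> ^ k) sums (?v * 2 ^ ?n * (1 / (1 - \<rho>)))"
      using rho by (intro sums_mult geometric_sums) simp
  qed (use v rho in simp)
  also have "\<dots> < \<infinity>" by simp
  finally show ?thesis .
qed

lemma decay_integral:
  assumes e: "e > real CARD('n)"
  obtains J where "J > 0" "\<And>(a :: real^'n) r. r > 0 \<Longrightarrow>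
    (\<integral>\<^sup>+z. ennreal ((1 + dist z a / r) powr (- e)) \<partial>lborel) \<le> ennreal (J * r ^ CARD('n))"
proof -
  let ?I = "\<integral>\<^sup>+w. ennreal ((1 + norm (w :: real^'n)) powr (- e)) \<partial>lborel"
  obtain J where J: "J \<ge> 0" "?I = ennreal J"
    using decay_integral_finite[OF e] by (cases ?I) auto
  show ?thesis
  proof (rule that)
    show "J + 1 > 0" using J by simp
    fix a :: "real^'n" and r :: real assume r: "r > 0"
    have "(\<integral>\<^sup>+z. ennreal ((1 + dist z a / r) powr (- e)) \<partial>lborel) =
        ennreal (r ^ CARD('n)) * (\<integral>\<^sup>+w. ennreal ((1 + dist (a + r *\<^sub>R w) a / r) powr (- e)) \<partial>lborel)"
      using nn_integral_lborel_affine[of "\<lambda>z. ennreal ((1 + dist z a / r) powr (- e))" r a] r by simp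
    also have "\<dots> = ennreal (r ^ CARD('n)) * ?I"
      using r by (simp add: dist_norm)
    also have "\<dots> \<le> ennreal ((J + 1) * r ^ CARD('n))"
      using J r by (auto simp: mult.commute intro!: ennreal_leI mult_right_mono simp flip: ennreal_mult)
    finally show "(\<integral>\<^sup>+z. ennreal ((1 + dist z a / r) powr (- e)) \<partial>lborel) \<le> ennreal ((J + 1) * r ^ CARD('n))" .
  qed
qed

section \<open>Lagrange extrapolation along a line\<close>

definition lagrange :: "(nat \<Rightarrow> real) \<Rightarrow> nat \<Rightarrow> nat \<Rightarrow> real poly" where
  "lagrange \<tau> M j = (\<Prod>i\<in>{..M} - {j}. smult (1 / (\<tau> j - \<tau> i)) [:- \<tau> i, 1:])"

lemma poly_lagrange_node:
  assumes "inj_on \<tau> {..M}" "i \<le> M" "j \<le> M"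
  shows "poly (lagrange \<tau> M j) (\<tau> i) = (if i = j then 1 else 0)"
proof (cases "i = j")
  case True
  have "poly (lagrange \<tau> M j) (\<tau> j) = (\<Prod>k\<in>{..M} - {j}. 1)"
    unfolding lagrange_def poly_prod
  proof (rule prod.cong[OF refl])
    fix k assume "k \<in> {..M} - {j}"
    then have "\<tau> j - \<tau> k \<noteq> 0" using assms by (auto simp: inj_on_def)
    then show "poly (smult (1 / (\<tau> j - \<tau> k)) [:- \<tau> k, 1:]) (\<tau> j) = 1"
      by (simp flip: diff_divide_distrib)
  qed
  then show ?thesis using True by simp
next
  case False
  then show ?thesis using assms by (auto simp: lagrange_def poly_prod intro!: bexI[of _ i])
qed

lemma degree_lagrange: "j \<le> M \<Longrightarrow> degree (lagrange \<tau> M j) \<le> M"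
proof -
  assume "j \<le> M"
  have "degree (lagrange \<tau> M j) \<le> (\<Sum>i\<in>{..M} - {j}. degree (smult (1 / (\<tau> j - \<tau> i)) [:- \<tau> i, 1:]))"
    unfolding lagrange_def by (rule order_trans[OF degree_prod_sum_le]) (auto simp: o_def)
  also have "\<dots> \<le> (\<Sum>i\<in>{..M} - {j}. 1)" by (intro sum_mono) auto
  also have "\<dots> = M" using \<open>j \<le> M\<close> by simp
  finally show ?thesis .
qed

text \<open>Both sides, as polynomials in \<open>y\<close>, have degree at most \<open>M\<close> and
  agree at the M + 1 nodes.\<close>

lemma lagrange_interpolation:
  assumes "inj_on \<tau> {..M}" "degree p \<le> M"
  shows "(\<Sum>j\<le>M. poly (lagrange \<tau> M j) y * poly p (\<tau> j)) = poly p y"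
proof -
  let ?q = "\<Sum>j\<le>M. smult (poly p (\<tau> j)) (lagrange \<tau> M j)"
  have "?q = p"
  proof (rule poly_eqI_degree[where A = "\<tau> ` {..M}"])
    fix x assume "x \<in> \<tau> ` {..M}"
    then obtain i where i: "i \<le> M" "x = \<tau> i" by auto
    then show "poly ?q x = poly p x"
      using assms(1) by (simp add: poly_sum poly_lagrange_node if_distrib cong: if_cong)
  next
    have c: "card (\<tau> ` {..M}) = Suc M" using assms(1) by (simp add: card_image)
    show "degree p < card (\<tau> ` {..M})" using assms c by simp
    have "degree ?q \<le> M"
      by (intro degree_sum_le) (auto intro!: order_trans[OF degree_smult_le] degree_lagrange)
    then show "degree ?q < card (\<tau> ` {..M})" using c by simp
  qed
  have "(\<Sum>j\<le>M. poly (lagrange \<tau> M j) y * poly p (\<tau> j)) = poly ?q y"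
    by (simp add: poly_sum mult.commute)
  also have "\<dots> = poly p y" by (simp only: \<open>?q = p\<close>)
  finally show ?thesis .
qed

text \<open>Here \<open>D m\<close> is the m-th derivative of \<open>D 0\<close>. The Taylor
  polynomial at \<open>y\<close> is reproduced exactly and has value \<open>D 0 y\<close> there, so
  only the Taylor remainders at the nodes survive. Nothing forces \<open>y\<close> to lie between
  the nodes; the cost of extrapolating is carried by \<Lambda>.\<close>

lemma lagrange_error:
  assumes inj: "inj_on \<tau> {..M}" and D: "\<And>m s. (D m has_real_derivative D (Suc m) s) (at s)"
    and B: "\<And>s. \<bar>D (Suc M) s\<bar> \<le> B" and y: "\<And>j. j \<le> M \<Longrightarrow> \<bar>\<tau> j - y\<bar> \<le> d"
    and L: "\<And>j. j \<le> M \<Longrightarrow> \<bar>poly (lagrange \<tau> M j) y\<bar> \<le> \<Lambda>"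
  shows "\<bar>D 0 y - (\<Sum>j\<le>M. poly (lagrange \<tau> M j) y * D 0 (\<tau> j))\<bar> \<le> real (Suc M) * (\<Lambda> * (B * d ^ Suc M))"
proof -
  let ?p = "\<Sum>m\<le>M. smult (D m y / fact m) ([:- y, 1:] ^ m)"
  have B0: "B \<ge> 0" using B[of 0] by linarith
  have deg: "degree ?p \<le> M"
    by (intro degree_sum_le) (auto intro!: order_trans[OF degree_smult_le] order_trans[OF degree_power_le])
  have pt: "poly ?p s = (\<Sum>m<Suc M. D m y / fact m * (s - y) ^ m)" for s
    by (simp add: poly_sum poly_power lessThan_Suc_atMost)
  have py: "poly ?p y = D 0 y"
  proof -
    have "poly ?p y = (\<Sum>m\<in>{..M}. if m = 0 then D 0 y else 0)"
      unfolding poly_sum by (intro sum.cong) (auto simp: poly_power)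
    then show ?thesis by simp
  qed
  have rem: "\<bar>D 0 s - poly ?p s\<bar> \<le> B * \<bar>s - y\<bar> ^ Suc M" for s
  proof (cases "s = y")
    case True
    then show ?thesis using py B0 by simp
  next
    case False
    have "\<exists>t. (if s < y then s < t \<and> t < y else y < t \<and> t < s) \<and>
        D 0 s = (\<Sum>m<Suc M. D m y / fact m * (s - y) ^ m) + D (Suc M) t / fact (Suc M) * (s - y) ^ Suc M"
      by (rule Taylor[where a = "min s y" and b = "max s y"]) (use D False in auto)
    then obtain t where t: "D 0 s = poly ?p s + D (Suc M) t / fact (Suc M) * (s - y) ^ Suc M"
      unfolding pt by blast
    have "\<bar>D (Suc M) t / fact (Suc M)\<bar> \<le> \<bar>D (Suc M) t\<bar> / 1"
      unfolding abs_divide by (rule divide_left_mono) (auto simp: fact_ge_1 simp del: fact_Suc)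
    also have "\<dots> \<le> B" using B by simp
    finally have "\<bar>D (Suc M) t / fact (Suc M) * (s - y) ^ Suc M\<bar> \<le> B * \<bar>s - y\<bar> ^ Suc M"
      unfolding abs_mult power_abs by (intro mult_right_mono) auto
    then show ?thesis using t by simp
  qed
  have "D 0 y - (\<Sum>j\<le>M. poly (lagrange \<tau> M j) y * D 0 (\<tau> j)) =
      - (\<Sum>j\<le>M. poly (lagrange \<tau> M j) y * (D 0 (\<tau> j) - poly ?p (\<tau> j)))"
    using lagrange_interpolation[OF inj deg, of y] py
    by (simp only: right_diff_distrib sum_subtractf)
  also have "\<bar>\<dots>\<bar> \<le> (\<Sum>j\<le>M. \<Lambda> * (B * d ^ Suc M))"
    unfolding abs_minus_cancel
  proof (rule order_trans[OF sum_abs sum_mono])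
    fix j assume j: "j \<in> {..M}"
    have "\<bar>D 0 (\<tau> j) - poly ?p (\<tau> j)\<bar> \<le> B * d ^ Suc M"
      by (rule order_trans[OF rem mult_left_mono[OF power_mono]]) (use y j B0 in auto)
    then show "\<bar>poly (lagrange \<tau> M j) y * (D 0 (\<tau> j) - poly ?p (\<tau> j))\<bar> \<le> \<Lambda> * (B * d ^ Suc M)"
      unfolding abs_mult using L[of j] j by (intro mult_mono) auto
  qed
  also have "\<dots> = real (Suc M) * (\<Lambda> * (B * d ^ Suc M))" by simp
  finally show ?thesis .
qed

lemma smooth_partial_iterate: "smooth f \<Longrightarrow> smooth ((partial i ^^ m) f)"
  by (induction m) (auto intro: smooth_partial)

lemma cont_supp_partial_iterate: "smooth f \<Longrightarrow> cont_supp r f \<Longrightarrow> cont_supp r ((partial i ^^ m) f)"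
  by (induction m) (auto intro: cont_supp_partial smooth_partial_iterate)

lemma partial_iterate_dilate:
  fixes f :: "real^'n \<Rightarrow> real"
  assumes "smooth f" "t > 0"
  shows "(partial i ^^ m) (\<lambda>x. c * dilate f t x) = (\<lambda>x. c / t ^ m * dilate ((partial i ^^ m) f) t x)"
proof (induction m)
  case (Suc m)
  let ?g = "(partial i ^^ m) f"
  have g: "smooth ?g" by (rule smooth_partial_iterate[OF assms(1)])
  have "(partial i ^^ Suc m) (\<lambda>x. c * dilate f t x) = partial i (\<lambda>x. c / t ^ m * dilate ?g t x)"
    by (simp add: Suc)
  also have "\<dots> = (\<lambda>x. c / t ^ m * partial i (dilate ?g t) x)"
    using partial_cmult[OF smooth_differentiable[OF smooth_dilate[OF g]]] by blast
  also have "\<dots> = (\<lambda>x. c / t ^ Suc m * dilate ((partial i ^^ Suc m) f) t x)"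
    using assms(2) by (simp add: partial_dilate[OF g assms(2)] fun_eq_iff)
  finally show ?case .
qed simp

lemma line_derivative:
  fixes f :: "real^'n \<Rightarrow> real"
  assumes "smooth f"
  shows "((\<lambda>s. f (v - (\<rho> * (s - \<sigma>)) *\<^sub>R axis i 1)) has_real_derivative
    - \<rho> * partial i f (v - (\<rho> * (s - \<sigma>)) *\<^sub>R axis i 1)) (at s)"
proof -
  have "((\<lambda>s. v - (\<rho> * (s - \<sigma>)) *\<^sub>R axis i 1) has_derivative (\<lambda>h. - (\<rho> * h) *\<^sub>R axis i 1)) (at s)"
    by (auto intro!: derivative_eq_intros)
  from has_derivative_compose[OF this has_derivative_partial[OF smooth_differentiable[OF assms]]]
  show ?thesis
    unfolding has_field_derivative_def
    by (rule has_derivative_eq_rhs) (auto simp: fun_eq_iff axis_def if_distrib if_distribR cong: if_cong)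
qed

text \<open>The line through \<open>v\<close> is parametrised so that s = \<sigma> gives
  \<open>v\<close> and the nodes give its translates; each derivative in \<open>s\<close> then
  brings out a factor -\<rho>.\<close>

lemma translated_extrapolation_error:
  fixes \<kappa> :: "real^'n \<Rightarrow> real"
  assumes inj: "inj_on \<tau> {..M}" and k: "smooth \<kappa>" and B: "\<And>x. \<bar>(partial i ^^ Suc M) \<kappa> x\<bar> \<le> B"
    and y: "\<And>j. j \<le> M \<Longrightarrow> \<bar>\<tau> j - \<sigma>\<bar> \<le> d" and L: "\<And>j. j \<le> M \<Longrightarrow> \<bar>poly (lagrange \<tau> M j) \<sigma>\<bar> \<le> \<Lambda>"
    and rho: "\<rho> \<ge> 0"
  shows "\<bar>\<kappa> v - (\<Sum>j\<le>M. poly (lagrange \<tau> M j) \<sigma> * \<kappa> (v - (\<rho> * (\<tau> j - \<sigma>)) *\<^sub>R axis i 1))\<bar>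
    \<le> real (Suc M) * (\<Lambda> * (\<rho> ^ Suc M * B * d ^ Suc M))"
proof -
  define D where "D m s = (- \<rho>) ^ m * (partial i ^^ m) \<kappa> (v - (\<rho> * (s - \<sigma>)) *\<^sub>R axis i 1)" for m s
  have "(D m has_real_derivative D (Suc m) s) (at s)" for m s
  proof -
    have "(D m has_real_derivative (- \<rho>) ^ m * (- \<rho> * partial i ((partial i ^^ m) \<kappa>) (v - (\<rho> * (s - \<sigma>)) *\<^sub>R axis i 1))) (at s)"
      unfolding D_def[abs_def] by (intro DERIV_cmult line_derivative smooth_partial_iterate k)
    then show ?thesis by (simp add: D_def mult_ac)
  qed
  moreover have "\<bar>D (Suc M) s\<bar> \<le> \<rho> ^ Suc M * B" for s
    using mult_left_mono[OF B, of "\<rho> ^ Suc M"] rho by (simp add: D_def abs_mult power_abs)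
  ultimately have "\<bar>D 0 \<sigma> - (\<Sum>j\<le>M. poly (lagrange \<tau> M j) \<sigma> * D 0 (\<tau> j))\<bar> \<le> real (Suc M) * (\<Lambda> * (\<rho> ^ Suc M * B * d ^ Suc M))"
    by (rule lagrange_error[OF inj _ _ y L])
  then show ?thesis by (simp add: D_def)
qed

section \<open>Bumps and their maximal functions\<close>

definition bump :: "(real^'n \<Rightarrow> real) \<Rightarrow> real^'n \<Rightarrow> real \<Rightarrow> real^'n \<Rightarrow> real" where
  "bump \<beta> a r y = \<beta> ((y - a) /\<^sub>R r)"

lemma bump_alt: "bump \<beta> a r = (\<lambda>y. \<beta> (- (a /\<^sub>R r) + (1 / r) *\<^sub>R y))"
  by (simp add: bump_def fun_eq_iff algebra_simps divide_inverse)

lemma smooth_bump: "smooth \<beta> \<Longrightarrow> smooth (bump \<beta> a r)"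
  unfolding bump_alt by (rule smooth_affine)

lemma partial_bump: "smooth \<beta> \<Longrightarrow> partial i (bump \<beta> a r) y = partial i \<beta> ((y - a) /\<^sub>R r) / r"
  unfolding bump_alt
  by (subst partial_affine) (auto intro: smooth_differentiable simp: algebra_simps divide_inverse)

lemma less_norm_rescale: "r > 0 \<Longrightarrow> l * r < dist y a \<Longrightarrow> l < norm ((y - a) /\<^sub>R r)"
  for y a :: "'a::real_normed_vector"
  by (simp add: dist_norm divide_inverse[symmetric] mult.commute[of "inverse r"] pos_less_divide_eq del: scaleR_diff_right)

lemma bump_zero: "cont_supp l \<beta> \<Longrightarrow> r > 0 \<Longrightarrow> l * r < dist y a \<Longrightarrow> bump \<beta> a r y = 0"
  unfolding bump_def by (rule cont_supp_zero[OF _ less_norm_rescale])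

lemma cont_supp_bump:
  fixes \<beta> :: "real^'n \<Rightarrow> real"
  assumes "smooth \<beta>" "cont_supp l \<beta>" "r > 0"
  shows "cont_supp (norm a + l * r) (bump \<beta> a r)"
  unfolding cont_supp_alt
proof safe
  show "continuous_on UNIV (bump \<beta> a r)" by (rule smooth_continuous[OF smooth_bump[OF assms(1)]])
  fix y :: "real^'n" assume "norm a + l * r < norm y"
  then have "l * r < dist y a" using norm_triangle_ineq2[of y a] by (simp add: dist_norm)
  then show "bump \<beta> a r y = 0" by (rule bump_zero[OF assms(2,3)])
qed

lemma integral_bump:
  fixes \<beta> :: "real^'n \<Rightarrow> real"
  assumes "\<beta> \<in> borel_measurable borel" "r > 0"
  shows "(LINT y|lborel. \<bar>bump \<beta> a r y\<bar>) = r ^ CARD('n) * (LINT y|lborel. \<bar>\<beta> y\<bar>)"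
proof -
  have [measurable]: "\<beta> \<in> borel_measurable borel" by fact
  have "(\<lambda>y. \<bar>bump \<beta> a r y\<bar>) \<in> borel_measurable borel" unfolding bump_def by measurable
  from integral_lborel_affine[OF this, of r a] show ?thesis
    using assms(2) by (simp add: bump_def)
qed

lemma bump_translate: "bump \<beta> (a + h) r y = bump \<beta> a r (y - h)"
  by (simp add: bump_def algebra_simps)

lemma convolve_bump_translate:
  fixes \<beta> \<kappa> :: "real^'n \<Rightarrow> real"
  assumes "\<beta> \<in> borel_measurable borel" "\<kappa> \<in> borel_measurable borel"
  shows "convolve (bump \<beta> (a + h) r) \<kappa> z = convolve (bump \<beta> a r) (\<lambda>v. \<kappa> (v - h)) z"
proof -
  have [measurable]: "\<beta> \<in> borel_measurable borel" "\<kappa> \<in> borel_measurable borel" by fact+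
  have "(\<lambda>y. bump \<beta> (a + h) r y * \<kappa> (z - y)) \<in> borel_measurable borel"
    unfolding bump_def by measurable
  from integral_lborel_affine[OF this, of 1 h] show ?thesis
    by (simp add: convolve_def bump_translate algebra_simps)
qed

context mollifier
begin

text \<open>The bump is made from the mollifier itself: near a point \<open>z\<close> with \<psi>(z)
  nonzero, |\<psi>| stays above half of |\<psi>(z)|. Squaring removes the sign, since
  \<open>\<psi>\<close> may change sign, and magnification carries that neighbourhood onto the unit
  ball.\<close>

lemma bump_exists:
  obtains \<beta> :: "real^'n \<Rightarrow> real" and l where "smooth \<beta>" "cont_supp l \<beta>" "l \<ge> 1" "\<And>x. \<beta> x \<ge> 0" "\<And>x. norm x < 1 \<Longrightarrow> \<beta> x \<ge> 1"
proof -
  have "\<exists>z. \<psi> z \<noteq> 0"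
  proof (rule ccontr)
    assume "\<nexists>z. \<psi> z \<noteq> 0"
    then have "\<psi> = (\<lambda>z. 0)" by auto
    then show False using int_psi by simp
  qed
  then obtain z where z: "\<psi> z \<noteq> 0" by blast
  define c where "c = \<bar>\<psi> z\<bar> / 2"
  have c: "c > 0" using z by (simp add: c_def)
  obtain \<eta> where eta: "\<eta> > 0" "\<And>x y. norm (x - y) < \<eta> \<Longrightarrow> \<bar>\<psi> x - \<psi> y\<bar> < c"
    using cont_supp_uniformly_continuous[OF cont_supp_psi c] by metis
  define \<beta> where "\<beta> y = 1 / c\<^sup>2 * (\<psi> (z + \<eta> *\<^sub>R y) * \<psi> (z + \<eta> *\<^sub>R y))" for y
  define l where "l = max 1 ((1 + norm z) / \<eta>)"
  show ?thesis
  proof (rule that)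
    show sm: "smooth \<beta>"
      unfolding \<beta>_def[abs_def] by (intro smooth_cmult smooth_mult smooth_affine smooth_psi)
    show "l \<ge> 1" by (simp add: l_def)
    show "cont_supp l \<beta>"
      unfolding cont_supp_alt
    proof safe
      show "continuous_on UNIV \<beta>" by (rule smooth_continuous[OF sm])
      fix y :: "real^'n" assume "l < norm y"
      then have "1 + norm z < \<eta> * norm y" using eta by (simp add: l_def field_simps)
      then have "1 < norm (z + \<eta> *\<^sub>R y)"
        using norm_triangle_ineq2[of "\<eta> *\<^sub>R y" "- z"] eta by (simp add: add.commute)
      then show "\<beta> y = 0" using cont_supp_zero[OF cont_supp_psi] by (simp add: \<beta>_def)
    qed
    show "\<beta> x \<ge> 0" for x by (simp add: \<beta>_def)
    fix x :: "real^'n" assume "norm x < 1"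
    then show "\<beta> x \<ge> 1"
    proof -
      assume that: "norm x < 1"
      have "\<bar>\<psi> (z + \<eta> *\<^sub>R x) - \<psi> z\<bar> < c" using that eta by (intro eta(2)) simp
      then have "c \<le> \<bar>\<psi> (z + \<eta> *\<^sub>R x)\<bar>" unfolding c_def by linarith
      then have "c\<^sup>2 \<le> \<bar>\<psi> (z + \<eta> *\<^sub>R x)\<bar>\<^sup>2" using c by (intro power_mono) auto
      then show ?thesis using c by (simp add: \<beta>_def power2_eq_square field_simps)
    qed
  qed
qed

lemma convolve_bump_small_scale:
  fixes f :: "real^'n \<Rightarrow> real"
  assumes f: "\<And>y. dist y a > s \<Longrightarrow> f y = 0" and t: "0 < t" "t < dist z a - s"
  shows "convolve f (dilate \<psi> t) z = 0"
proof -
  have "f y * dilate \<psi> t (z - y) = 0" for y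
  proof (cases "dist y a > s")
    case False
    then have "norm (z - y) > t"
      using t dist_triangle[of z a y] by (simp add: dist_norm)
    then show ?thesis using cont_supp_zero[OF cont_supp_psi_t[OF t(1)]] by simp
  qed (simp add: f)
  then show ?thesis by (simp only: convolve_def) simp
qed

text \<open>Near \<open>a\<close> the sup norm of the derivative is enough. Far away the convolution
  vanishes unless \<open>t\<close> is comparable to the distance, and then moving the derivative
  onto \<psi>_t gives t^(-n-1) against the mass r^n. The exponent n + 1 thus reflects the one
  vanishing moment of a derivative.\<close>

lemma partial_bump_convolve_bound:
  fixes \<beta> :: "real^'n \<Rightarrow> real"
  assumes b: "smooth \<beta>" "cont_supp l \<beta>" "l \<ge> 1"
  obtains C where "C > 0" "\<And>i a r t z. r > 0 \<Longrightarrow> t > 0 \<Longrightarrow>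
    \<bar>convolve (partial i (bump \<beta> a r)) (dilate \<psi> t) z\<bar> \<le> C / r * (1 + dist z a / r) powr (- real (Suc CARD('n)))"
proof -
  let ?n = "CARD('n)"
  let ?e = "- real (Suc ?n)"
  obtain B where B: "B \<ge> 0" "\<And>j x. \<bar>partial j \<beta> x\<bar> \<le> B" using partials_bounded[OF b(1,2)] by metis
  obtain P where P: "P \<ge> 0" "\<And>j x. \<bar>partial j \<psi> x\<bar> \<le> P" using partials_bounded[OF smooth_psi cont_supp_psi] by metis
  define I where "I = (LINT y|lborel. \<bar>\<beta> y\<bar>)"
  have I: "I \<ge> 0" by (simp add: I_def)
  \<comment> \<open>The first term serves distances up to 2 l r, the second larger ones, where r +
    dist z a \<le> 4 t; the final 1 ensures positivity.\<close>
  define C where "C = B * psi_mass * (1 + 2 * l) ^ Suc ?n + P * I * 4 ^ Suc ?n + 1"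
  have C: "B * psi_mass * (1 + 2 * l) ^ Suc ?n \<le> C" "P * I * 4 ^ Suc ?n \<le> C" "C > 0"
    unfolding C_def using B P I psi_mass_nonneg b(3)
    by (auto intro!: add_nonneg_pos add_nonneg_nonneg mult_nonneg_nonneg simp: add_increasing add_increasing2)
  show ?thesis
  proof (rule that[OF C(3)])
    fix i a and r t :: real and z assume r: "r > 0" and t: "t > 0"
    let ?f = "partial i (bump \<beta> a r)"
    note sb = smooth_bump[OF b(1), of a r] and cb = cont_supp_bump[OF b(1,2) r, of a]
    have cf: "cont_supp (norm a + l * r) ?f" by (rule cont_supp_partial[OF sb cb])
    define X where "X = 1 + dist z a / r"
    have X: "X \<ge> 1" using r by (simp add: X_def)
    have Xe: "X powr ?e = 1 / X ^ Suc ?n"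
      using X by (simp add: powr_minus powr_realpow[symmetric] inverse_eq_divide del: power_Suc of_nat_Suc)
    show "\<bar>convolve ?f (dilate \<psi> t) z\<bar> \<le> C / r * (1 + dist z a / r) powr ?e"
    proof (cases "dist z a \<le> 2 * l * r")
      case True
      have "convolve ?f (dilate \<psi> t) = convolve (dilate \<psi> t) ?f"
        by (rule convolve_commute[OF cont_supp_measurable[OF cf] cont_supp_measurable[OF cont_supp_psi_t[OF t]]])
      moreover have "\<bar>convolve (dilate \<psi> t) ?f z\<bar> \<le> B / r * psi_mass"
        unfolding abs_int_psi_t[OF t, symmetric]
        by (rule convolve_bound[OF cont_supp_psi_t[OF t] cont_supp_continuous[OF cf]])
           (use B r in \<open>auto simp: partial_bump[OF b(1)] divide_right_mono\<close>)
      ultimately have "\<bar>convolve ?f (dilate \<psi> t) z\<bar> \<le> B * psi_mass / r" by simp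
      also have "\<dots> \<le> B * psi_mass / r * ((1 + 2 * l) ^ Suc ?n / X ^ Suc ?n)"
      proof -
        have "X \<le> 1 + 2 * l" using True r by (simp add: X_def field_simps)
        then have "X ^ Suc ?n \<le> (1 + 2 * l) ^ Suc ?n" using X by (intro power_mono) auto
        then have "1 \<le> (1 + 2 * l) ^ Suc ?n / X ^ Suc ?n" using X by (simp add: le_divide_eq del: power_Suc)
        then show ?thesis using B(1) psi_mass_nonneg r mult_left_mono[of 1 "(1 + 2 * l) ^ Suc ?n / X ^ Suc ?n" "B * psi_mass / r"] by simp
      qed
      also have "\<dots> = (B * psi_mass * (1 + 2 * l) ^ Suc ?n) / r * (1 / X ^ Suc ?n)" by simp
      also have "\<dots> \<le> C / r * (1 / X ^ Suc ?n)"
        using C(1) r X by (intro mult_right_mono divide_right_mono) auto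
      finally show ?thesis using Xe by (simp add: X_def)
    next
      case False
      then have far: "dist z a > 2 * l * r" by simp
      have lr: "l * r > 0" "r \<le> l * r" using b(3) r by auto
      then have da: "dist z a > 0" using far by linarith
      show ?thesis
      proof (cases "t < dist z a / 2")
        case True
        have "convolve ?f (dilate \<psi> t) z = 0"
        proof (rule convolve_bump_small_scale[OF _ t])
          show "?f y = 0" if "dist y a > l * r" for y
            unfolding partial_bump[OF b(1)] cont_supp_zero[OF cont_supp_partial[OF b(1,2)] less_norm_rescale[OF r that]] by simp
          show "t < dist z a - l * r" using True far by simp
        qed
        then show ?thesis using C(3) r by simp
      next
        case False
        then have tz: "t \<ge> dist z a / 2" by simp
        have "convolve ?f (dilate \<psi> t) z = convolve (bump \<beta> a r) (partial i (dilate \<psi> t)) z"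
          using convolve_partial_swap[OF sb cb smooth_psi_t cont_supp_psi_t[OF t]] by simp
        also have "\<bar>\<dots>\<bar> \<le> P / t ^ Suc ?n * (LINT y|lborel. \<bar>bump \<beta> a r y\<bar>)"
        proof (rule convolve_bound[OF cb])
          show "continuous_on UNIV (partial i (dilate \<psi> t))"
            by (rule smooth_continuous[OF smooth_partial[OF smooth_psi_t]])
          show "\<bar>partial i (dilate \<psi> t) (z - y)\<bar> \<le> P / t ^ Suc ?n" for y
            using t divide_right_mono[OF P(2)[of i "(z - y) /\<^sub>R t"], of "t ^ Suc ?n"]
            by (simp add: partial_dilate[OF smooth_psi t] dilate_def mult.commute)
        qed
        also have "\<dots> = P * I * r ^ ?n / t ^ Suc ?n"
          using integral_bump[OF cont_supp_measurable[OF b(2)] r] by (simp add: I_def)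
        also have "\<dots> \<le> P * I * r ^ ?n * (4 ^ Suc ?n / (r * X) ^ Suc ?n)"
        proof -
          have "r * X = r + dist z a" using r by (simp add: X_def field_simps)
          also have "\<dots> \<le> 4 * t" using tz far lr by linarith
          finally have "(r * X) ^ Suc ?n \<le> (4 * t) ^ Suc ?n" using r X by (intro power_mono) auto
          then have "1 / t ^ Suc ?n \<le> 4 ^ Suc ?n / (r * X) ^ Suc ?n"
            using t r X by (simp add: power_mult_distrib divide_simps del: power_Suc)
          then show ?thesis using P I r mult_left_mono[of "1 / t ^ Suc ?n" "4 ^ Suc ?n / (r * X) ^ Suc ?n" "P * I * r ^ ?n"]
            by simp
        qed
        also have "\<dots> = (P * I * 4 ^ Suc ?n) / r * (1 / X ^ Suc ?n)"
          using r X by (simp add: power_mult_distrib)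
        also have "\<dots> \<le> C / r * (1 / X ^ Suc ?n)"
          using C(2) r X by (intro mult_right_mono divide_right_mono) auto
        finally show ?thesis using Xe by (simp add: X_def)
      qed
    qed
  qed
qed

text \<open>The decay exponent n + 1 is integrable after taking p-th powers precisely because (n+1)
  p > n, and p \<le> 1 allows summation over the bumps. Scaling gives r^(-p) * r^n per bump. The
  index type is left free so that pairs of a ball and a node can serve as indices.\<close>

lemma maximal_bump_sum:
  fixes \<beta> :: "real^'n \<Rightarrow> real"
  assumes b: "smooth \<beta>" "cont_supp l \<beta>" "l \<ge> 1" and p: "real CARD('n) / (real CARD('n) + 1) < p" "p \<le> 1" and L: "\<Lambda> > 0"
  obtains K where "K > 0" "\<And>i (Q :: 'q set) w a r. finite Q \<Longrightarrow> (\<And>k. k \<in> Q \<Longrightarrow> r k > 0) \<Longrightarrow> (\<And>k. k \<in> Q \<Longrightarrow> \<bar>w k\<bar> \<le> \<Lambda>) \<Longrightarrow>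
     (\<integral>\<^sup>+z. epowr (maximal \<psi> (partial i (\<lambda>y. \<Sum>k\<in>Q. w k * bump \<beta> (a k) (r k) y)) z) p \<partial>lborel)
       \<le> ennreal (K * (\<Sum>k\<in>Q. r k powr (real CARD('n) - p)))"
proof -
  let ?n = "CARD('n)"
  let ?e = "real (Suc ?n)"
  have p0: "p > 0" using p(1) by (meson divide_nonneg_nonneg of_nat_0_le_iff order_le_less_trans add_nonneg_nonneg zero_le_one)
  have "?e * p > real ?n" using p(1) by (simp add: field_simps)
  then obtain J where J: "J > 0" "\<And>(a :: real^'n) r. r > 0 \<Longrightarrow>
    (\<integral>\<^sup>+z. ennreal ((1 + dist z a / r) powr (- (?e * p))) \<partial>lborel) \<le> ennreal (J * r ^ ?n)"
    using decay_integral by metis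
  obtain C where C: "C > 0" "\<And>i a r t z. r > 0 \<Longrightarrow> t > 0 \<Longrightarrow>
    \<bar>convolve (partial i (bump \<beta> a r)) (dilate \<psi> t) z\<bar> \<le> C / r * (1 + dist z a / r) powr (- ?e)"
    using partial_bump_convolve_bound[OF b] by metis
  define K where "K = (\<Lambda> * C) powr p * J"
  show ?thesis
  proof (rule that)
    show "K > 0" using L C J by (simp add: K_def)
    fix i and Q :: "'q set" and w a r
    assume Q: "finite Q" and r: "\<And>k. k \<in> Q \<Longrightarrow> r k > (0::real)" and w: "\<And>k. k \<in> Q \<Longrightarrow> \<bar>w k\<bar> \<le> \<Lambda>"
    let ?b = "\<lambda>k. bump \<beta> (a k) (r k)"
    let ?P = "\<lambda>k z. \<Lambda> * C / r k * (1 + dist z (a k) / r k) powr (- ?e)"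
    have sm: "smooth (?b k)" for k by (rule smooth_bump[OF b(1)])
    have P0: "?P k z \<ge> 0" if "k \<in> Q" for k z using r[OF that] L C by simp
    define R where "R = (\<Sum>k\<in>Q. norm (a k) + l * r k)"
    have cR: "cont_supp R (partial i (?b k))" if k: "k \<in> Q" for k
    proof (rule cont_supp_mono[OF cont_supp_partial[OF sm cont_supp_bump[OF b(1,2) r[OF k]]]])
      have "0 \<le> norm (a k) + l * r k" if "k \<in> Q" for k
        using r[OF that] b(3) by simp
      then show "norm (a k) + l * r k \<le> R"
        unfolding R_def using Q k by (intro member_le_sum) auto
    qed
    have der: "partial i (\<lambda>y. \<Sum>k\<in>Q. w k * ?b k y) = (\<lambda>y. \<Sum>k\<in>Q. w k * partial i (?b k) y)"
    proof
      fix y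
      have "partial i (\<lambda>y. \<Sum>k\<in>Q. w k * ?b k y) y = (\<Sum>k\<in>Q. partial i (\<lambda>y. w k * ?b k y) y)"
        by (rule partial_sum[OF Q smooth_cmult[OF sm]])
      also have "\<dots> = (\<Sum>k\<in>Q. w k * partial i (?b k) y)"
        by (intro sum.cong refl partial_cmult smooth_differentiable sm)
      finally show "partial i (\<lambda>y. \<Sum>k\<in>Q. w k * ?b k y) y = (\<Sum>k\<in>Q. w k * partial i (?b k) y)" .
    qed
    have "maximal \<psi> (partial i (\<lambda>y. \<Sum>k\<in>Q. w k * ?b k y)) z \<le> (\<Sum>k\<in>Q. ennreal (?P k z))" for z
      unfolding maximal_def
    proof (rule SUP_least)
      fix t :: real assume "t \<in> {0<..}"
      then have t: "t > 0" by simp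
      have "convolve (\<lambda>y. \<Sum>k\<in>Q. w k * partial i (?b k) y) (dilate \<psi> t) z =
          (\<Sum>k\<in>Q. convolve (\<lambda>y. w k * partial i (?b k) y) (dilate \<psi> t) z)"
        by (rule convolve_sum_left[OF cont_supp_cmult[OF cR] smooth_continuous[OF smooth_psi_t]])
      also have "\<dots> = (\<Sum>k\<in>Q. w k * convolve (partial i (?b k)) (dilate \<psi> t) z)"
        by (simp add: convolve_cmult_left)
      also have "\<bar>\<dots>\<bar> \<le> (\<Sum>k\<in>Q. ?P k z)"
      proof (rule order_trans[OF sum_abs sum_mono])
        fix k assume k: "k \<in> Q"
        have "\<bar>w k * convolve (partial i (?b k)) (dilate \<psi> t) z\<bar> \<le> \<Lambda> * (C / r k * (1 + dist z (a k) / r k) powr (- ?e))"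
          unfolding abs_mult by (intro mult_mono w[OF k] C(2) r[OF k] t) (use L in auto)
        then show "\<bar>w k * convolve (partial i (?b k)) (dilate \<psi> t) z\<bar> \<le> ?P k z" by simp
      qed
      finally have "ennreal \<bar>convolve (partial i (\<lambda>y. \<Sum>k\<in>Q. w k * ?b k y)) (dilate \<psi> t) z\<bar> \<le> ennreal (\<Sum>k\<in>Q. ?P k z)"
        unfolding der by (rule ennreal_leI)
      then show "ennreal \<bar>convolve (partial i (\<lambda>y. \<Sum>k\<in>Q. w k * ?b k y)) (dilate \<psi> t) z\<bar> \<le> (\<Sum>k\<in>Q. ennreal (?P k z))"
        using P0 by (simp add: sum_ennreal)
    qed
    then have "(\<integral>\<^sup>+z. epowr (maximal \<psi> (partial i (\<lambda>y. \<Sum>k\<in>Q. w k * ?b k y)) z) p \<partial>lborel) \<le>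
        (\<integral>\<^sup>+z. (\<Sum>k\<in>Q. epowr (ennreal (?P k z)) p) \<partial>lborel)"
      using p0 p(2) by (intro nn_integral_mono order_trans[OF epowr_mono epowr_sum_subadditive]) auto
    also have "\<dots> = (\<Sum>k\<in>Q. \<integral>\<^sup>+z. epowr (ennreal (?P k z)) p \<partial>lborel)"
      by (rule nn_integral_sum) measurable
    also have "\<dots> \<le> (\<Sum>k\<in>Q. ennreal (K * r k powr (real ?n - p)))"
    proof (rule sum_mono)
      fix k assume k: "k \<in> Q"
      have "epowr (ennreal (?P k z)) p = ennreal ((\<Lambda> * C / r k) powr p) * ennreal ((1 + dist z (a k) / r k) powr (- (?e * p)))" for z
      proof -
        have "epowr (ennreal (?P k z)) p = ennreal (?P k z powr p)" by (rule epowr_ennreal[OF P0[OF k]])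
        also have "?P k z powr p = (\<Lambda> * C / r k) powr p * (1 + dist z (a k) / r k) powr (- (?e * p))"
          using L C r[OF k] by (subst powr_mult) (simp only: powr_powr mult_minus_left)
        finally show ?thesis by (simp add: ennreal_mult)
      qed
      then have "(\<integral>\<^sup>+z. epowr (ennreal (?P k z)) p \<partial>lborel) =
          ennreal ((\<Lambda> * C / r k) powr p) * (\<integral>\<^sup>+z. ennreal ((1 + dist z (a k) / r k) powr (- (?e * p))) \<partial>lborel)"
        by (simp add: nn_integral_cmult)
      also have "\<dots> \<le> ennreal ((\<Lambda> * C / r k) powr p) * ennreal (J * r k ^ ?n)"
        by (intro mult_left_mono J(2) r[OF k]) simp
      also have "\<dots> = ennreal (K * r k powr (real ?n - p))"
        using L C J r[OF k] by (simp add: K_def powr_divide powr_diff powr_realpow flip: ennreal_mult)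
      finally show "(\<integral>\<^sup>+z. epowr (ennreal (?P k z)) p \<partial>lborel) \<le> ennreal (K * r k powr (real ?n - p))" .
    qed
    also have "\<dots> = ennreal (K * (\<Sum>k\<in>Q. r k powr (real ?n - p)))"
      using \<open>K > 0\<close> by (simp add: sum_ennreal sum_distrib_left)
    finally show "(\<integral>\<^sup>+z. epowr (maximal \<psi> (partial i (\<lambda>y. \<Sum>k\<in>Q. w k * ?b k y)) z) p \<partial>lborel) \<le> \<dots>" .
  qed
qed

end

section \<open>Hardy capacity and Hausdorff content\<close>

text \<open>M + 1 distinct points of [5/4, 3/2). The lower end keeps the corrected centres clear of
  the ball of radius \<rho>; the upper end keeps them well inside the ball of radius 2
  \<rho>.\<close>

definition node :: "nat \<Rightarrow> nat \<Rightarrow> real" where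
  "node M j = 5 / 4 + real j / (4 * real (Suc M))"

lemma inj_node: "inj_on (node M) {..M}"
  by (auto simp: inj_on_def node_def)

lemma node_bounds: "j \<le> M \<Longrightarrow> 5 / 4 \<le> node M j \<and> node M j \<le> 3 / 2"
  by (auto simp: node_def field_simps)

text \<open>The extrapolation point ranges over [-2, 2] only, so compactness gives a bound that does
  not depend on the ball. \<Lambda> \<ge> 1 makes it cover the weight 1 of the original bump as
  well.\<close>

lemma lagrange_node_bounded:
  obtains \<Lambda> where "\<Lambda> \<ge> 1" "\<And>j y. j \<le> M \<Longrightarrow> \<bar>y\<bar> \<le> 2 \<Longrightarrow> \<bar>poly (lagrange (node M) M j) y\<bar> \<le> \<Lambda>"
proof -
  have "\<exists>B. \<forall>y\<in>{-2..2}. \<bar>poly (lagrange (node M) M j) y\<bar> \<le> B" for j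
  proof -
    have "compact (poly (lagrange (node M) M j) ` {-2..2})"
      by (intro compact_continuous_image continuous_intros) auto
    from compact_imp_bounded[OF this] show ?thesis by (auto simp: bounded_real)
  qed
  then obtain B where B: "\<And>j y. y \<in> {-2..2} \<Longrightarrow> \<bar>poly (lagrange (node M) M j) y\<bar> \<le> B j" by metis
  have B0: "B j \<ge> 0" for j using B[of 0 j] by simp
  show ?thesis
  proof (rule that)
    show "1 + sum B {..M} \<ge> 1" by (simp add: B0 sum_nonneg)
    fix j y assume "j \<le> M" "\<bar>y\<bar> \<le> (2 :: real)"
    then have "\<bar>poly (lagrange (node M) M j) y\<bar> \<le> B j" by (intro B) auto
    also have "\<dots> \<le> sum B {..M}" using \<open>j \<le> M\<close> B0 by (intro member_le_sum) auto
    finally show "\<bar>poly (lagrange (node M) M j) y\<bar> \<le> 1 + sum B {..M}" by simp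
  qed
qed

text \<open>Index 0 is the bump itself and index \<open>Suc j\<close> the translate at node
  \<open>j\<close>, with a minus sign because the extrapolated value is subtracted.\<close>

definition corr_weight :: "nat \<Rightarrow> real \<Rightarrow> nat \<Rightarrow> real" where
  "corr_weight M \<sigma> m = (case m of 0 \<Rightarrow> 1 | Suc j \<Rightarrow> - poly (lagrange (node M) M j) \<sigma>)"

text \<open>With \<sigma> the d-th coordinate of (a - x) / \<rho>, the translate has d-th coordinate
  \<open>\<rho> * node M j\<close> relative to \<open>x\<close>, whatever \<open>a\<close>
  is.\<close>

definition corr_center :: "nat \<Rightarrow> 'n \<Rightarrow> real \<Rightarrow> real \<Rightarrow> real^'n \<Rightarrow> nat \<Rightarrow> real^'n" where
  "corr_center M d \<rho> \<sigma> a m = (case m of 0 \<Rightarrow> a | Suc j \<Rightarrow> a + (\<rho> * (node M j - \<sigma>)) *\<^sub>R axis d 1)"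

text \<open>A bump from which extrapolating multiples of its translates in direction \<open>d\<close> are
  subtracted, so that all its moments up to order \<open>M\<close> in that direction vanish. The translates sit
  at distance at least \<open>5 \<rho> / 4\<close> from the reference point, hence off the set to be covered.\<close>

definition corr_bump :: "(real^'n \<Rightarrow> real) \<Rightarrow> nat \<Rightarrow> 'n \<Rightarrow> real \<Rightarrow> real \<Rightarrow> real^'n \<Rightarrow> real \<Rightarrow> real^'n \<Rightarrow> real" where
  "corr_bump \<beta> M d \<rho> \<sigma> a r y =
     (\<Sum>m\<le>Suc M. corr_weight M \<sigma> m * bump \<beta> (corr_center M d \<rho> \<sigma> a m) r y)"

lemma smooth_corr_bump: "smooth \<beta> \<Longrightarrow> smooth (corr_bump \<beta> M d \<rho> \<sigma> a r)"
  unfolding corr_bump_def[abs_def] by (intro smooth_sum smooth_cmult smooth_bump) auto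

text \<open>Only the d-th coordinate changes, and it becomes \<open>\<rho> * node M j\<close>. The
  lower bound reads off this coordinate; the upper one is Pythagoras, with (17/16)^2 + (3/2)^2 \<le>
  (15/8)^2.\<close>

lemma norm_corr_center:
  fixes a x :: "real^'n"
  assumes rho: "\<rho> > 0" and a: "norm (a - x) \<le> 17 / 16 * \<rho>" and j: "j \<le> M"
  shows "5 / 4 * \<rho> \<le> dist (corr_center M d \<rho> ((a - x) $ d / \<rho>) a (Suc j)) x"
    and "dist (corr_center M d \<rho> ((a - x) $ d / \<rho>) a (Suc j)) x \<le> 15 / 8 * \<rho>"
proof -
  let ?v = "a - x" and ?c = "\<rho> * node M j"
  let ?w = "?v + (?c - ?v $ d) *\<^sub>R axis d 1"
  have "\<rho> * (node M j - ?v $ d / \<rho>) = ?c - ?v $ d" using rho by (simp only: right_diff_distrib[of \<rho>] nonzero_mult_div_cancel_left) (simp add: field_simps)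
  then have w: "dist (corr_center M d \<rho> (?v $ d / \<rho>) a (Suc j)) x = norm ?w"
    by (simp only: corr_center_def dist_norm nat.case) (simp add: algebra_simps)
  have nb: "5 / 4 * \<rho> \<le> ?c" "?c \<le> 3 / 2 * \<rho>" "?c \<ge> 0"
    using node_bounds[OF j] rho by auto
  have "?w $ d = ?c" by (simp add: axis_def)
  then show "5 / 4 * \<rho> \<le> dist (corr_center M d \<rho> (?v $ d / \<rho>) a (Suc j)) x"
    unfolding w using component_le_norm_cart[of ?w d] nb by linarith
  have "(norm ?w)\<^sup>2 = (norm ?v)\<^sup>2 + 2 * (?c - ?v $ d) * (?v $ d) + (?c - ?v $ d)\<^sup>2"
    by (simp only: power2_norm_eq_inner inner_add_left inner_add_right inner_scaleR_left inner_scaleR_right inner_axis inner_axis')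
       (simp add: power2_eq_square algebra_simps inner_axis_axis)
  also have "\<dots> = (norm ?v)\<^sup>2 - (?v $ d)\<^sup>2 + ?c\<^sup>2" by (simp add: power2_eq_square algebra_simps)
  also have "\<dots> \<le> (17 / 16 * \<rho>)\<^sup>2 + (3 / 2 * \<rho>)\<^sup>2"
    using power_mono[OF a norm_ge_zero, of 2] power_mono[OF nb(2) nb(3), of 2] zero_le_power2[of "?v $ d"] by linarith
  also have "\<dots> \<le> (15 / 8 * \<rho>)\<^sup>2" by (simp add: power2_eq_square)
  finally show "dist (corr_center M d \<rho> (?v $ d / \<rho>) a (Suc j)) x \<le> 15 / 8 * \<rho>"
    unfolding w by (rule power2_le_imp_le) (use rho in auto)
qed

text \<open>Passes from exponent \<open>p\<close> to a smaller \<open>q\<close> on a set of finite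
  measure: values up to \<open>l\<close> are bounded trivially, larger ones lose only a power of
  \<open>l\<close>.\<close>

lemma epowr_le_split:
  assumes "l > 0" "0 < q" "q \<le> p"
  shows "epowr x q \<le> ennreal (l powr q) + ennreal (l powr (q - p)) * epowr x p"
proof (cases x)
  case (real v)
  show ?thesis
  proof (cases "v \<le> l")
    case True
    then have "epowr x q \<le> ennreal (l powr q)"
      using real assms by (auto simp: epowr_ennreal intro!: powr_mono2)
    then show ?thesis by (simp add: add_increasing2)
  next
    case False
    then have "v powr q = v powr (q - p) * v powr p" using assms by (simp flip: powr_add)
    also have "\<dots> \<le> l powr (q - p) * v powr p"
      using False assms by (intro mult_right_mono powr_mono2') auto
    finally have "epowr x q \<le> ennreal (l powr (q - p)) * epowr x p"
      using real by (simp add: epowr_ennreal ennreal_leI flip: ennreal_mult)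
    then show ?thesis by (simp add: add_increasing)
  qed
next
  case top
  then show ?thesis using assms by (simp add: epowr_def ennreal_mult_top)
qed

context mollifier
begin

text \<open>The translations are moved from the bump to the kernel, where the weights form the
  extrapolation error of a derivative of \<psi>_t along direction \<open>d\<close>. Its M + 1 extra
  derivatives sharpen t^(-n-1) to t^(-n-M-2), at the price of \<rho>^(M+1).\<close>

lemma convolve_corr_bump:
  fixes \<beta> :: "real^'n \<Rightarrow> real"
  assumes b: "smooth \<beta>" "cont_supp l \<beta>"
  obtains E where "E > 0" "\<And>d i \<rho> \<sigma> a r t z. \<rho> > 0 \<Longrightarrow> \<bar>\<sigma>\<bar> \<le> 2 \<Longrightarrow> r > 0 \<Longrightarrow> t > 0 \<Longrightarrow>
    \<bar>convolve (partial i (corr_bump \<beta> M d \<rho> \<sigma> a r)) (dilate \<psi> t) z\<bar>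
      \<le> E * \<rho> ^ Suc M * r ^ CARD('n) / t ^ (CARD('n) + M + 2)"
proof -
  let ?n = "CARD('n)"
  obtain \<Lambda> where L: "\<Lambda> \<ge> 1" "\<And>j y. j \<le> M \<Longrightarrow> \<bar>y\<bar> \<le> 2 \<Longrightarrow> \<bar>poly (lagrange (node M) M j) y\<bar> \<le> \<Lambda>"
    using lagrange_node_bounded[of M] by blast
  have "\<exists>B. \<forall>d i. B d i \<ge> 0 \<and> (\<forall>x. \<bar>(partial d ^^ Suc M) (partial i \<psi>) x\<bar> \<le> B d i)"
    by (intro choice allI)
       (metis cont_supp_bounded cont_supp_partial_iterate[OF smooth_partial[OF smooth_psi] cont_supp_partial[OF smooth_psi cont_supp_psi]])
  then obtain B where B: "\<And>d i. B d i \<ge> 0" "\<And>d i x. \<bar>(partial d ^^ Suc M) (partial i \<psi>) x\<bar> \<le> B d i" by blast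
  define B0 where "B0 = (\<Sum>d\<in>UNIV. \<Sum>i\<in>UNIV. B d i)"
  have B0: "B d i \<le> B0" for d i
  proof -
    have "B d i \<le> (\<Sum>i\<in>UNIV. B d i)" using B by (intro member_le_sum) auto
    also have "\<dots> \<le> B0" unfolding B0_def using B by (intro member_le_sum) (auto intro: sum_nonneg)
    finally show ?thesis .
  qed
  have B00: "B0 \<ge> 0" using B B0 by (meson order_trans)
  define I where "I = (LINT y|lborel. \<bar>\<beta> y\<bar>)"
  have I: "I \<ge> 0" by (simp add: I_def)
  define E where "E = real (Suc M) * \<Lambda> * 4 ^ Suc M * B0 * I"
  have E: "E \<ge> 0" using L B00 I by (simp add: E_def)
  show ?thesis
  proof (rule that)
    show "E + 1 > 0" using E by simp
    fix d i :: 'n and \<rho> \<sigma> r t :: real and a z :: "real^'n" assume rho: "\<rho> > 0" and s: "\<bar>\<sigma>\<bar> \<le> 2" and r: "r > 0" and t: "t > 0"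
    let ?\<kappa> = "partial i (dilate \<psi> t)"
    let ?w = "corr_weight M \<sigma>" and ?c = "corr_center M d \<rho> \<sigma> a"
    let ?h = "\<lambda>j. (\<rho> * (node M j - \<sigma>)) *\<^sub>R axis d (1 :: real)"
    let ?P = "\<lambda>j. poly (lagrange (node M) M j) \<sigma>"
    have sk: "smooth ?\<kappa>" by (rule smooth_partial[OF smooth_psi_t])
    note ck = smooth_continuous[OF sk]
    have mk: "?\<kappa> \<in> borel_measurable borel" by (rule borel_measurable_continuous_onI[OF ck])
    have mb: "\<beta> \<in> borel_measurable borel" by (rule cont_supp_measurable[OF b(2)])
    have cb: "\<exists>R. \<forall>m\<le>Suc M. cont_supp R (bump \<beta> (?c m) r)"
    proof -
      define R where "R = (\<Sum>m\<le>Suc M. norm (?c m)) + l * r"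
      have "norm (?c m) + l * r \<le> R" if "m \<le> Suc M" for m
        unfolding R_def by (intro add_right_mono member_le_sum) (use that in auto)
      then show ?thesis using cont_supp_mono[OF cont_supp_bump[OF b r]] by blast
    qed
    then obtain R where R: "\<And>m. m \<le> Suc M \<Longrightarrow> cont_supp R (bump \<beta> (?c m) r)" by blast
    have ccb: "cont_supp R (corr_bump \<beta> M d \<rho> \<sigma> a r)"
      unfolding corr_bump_def[abs_def] by (intro cont_supp_sum cont_supp_cmult R) auto
    have "convolve (partial i (corr_bump \<beta> M d \<rho> \<sigma> a r)) (dilate \<psi> t) z = convolve (corr_bump \<beta> M d \<rho> \<sigma> a r) ?\<kappa> z"
      using convolve_partial_swap[OF smooth_corr_bump[OF b(1)] ccb smooth_psi_t cont_supp_psi_t[OF t]] by simp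
    also have "\<dots> = (\<Sum>m\<le>Suc M. convolve (\<lambda>y. ?w m * bump \<beta> (?c m) r y) ?\<kappa> z)"
      unfolding corr_bump_def[abs_def] by (rule convolve_sum_left[OF cont_supp_cmult[OF R] ck]) auto
    also have "\<dots> = (\<Sum>m\<le>Suc M. ?w m * convolve (bump \<beta> (?c m) r) ?\<kappa> z)"
      by (simp only: convolve_cmult_left)
    also have "\<dots> = convolve (bump \<beta> a r) ?\<kappa> z - (\<Sum>j\<le>M. ?P j * convolve (bump \<beta> a r) (\<lambda>v. ?\<kappa> (v - ?h j)) z)"
      unfolding sum.atMost_Suc_shift
      by (simp add: corr_weight_def corr_center_def convolve_bump_translate[OF mb mk] sum_negf)
    also have "\<dots> = convolve (bump \<beta> a r) (\<lambda>v. ?\<kappa> v - (\<Sum>j\<le>M. ?P j * ?\<kappa> (v - ?h j))) z"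
    proof -
      have ct: "continuous_on UNIV (\<lambda>v. ?\<kappa> (v - h))" for h
        by (rule continuous_on_compose2[OF ck[of UNIV]]) (auto intro!: continuous_intros)
      note ib = conv_integrable[OF cont_supp_bump[OF b r]]
      have "convolve (bump \<beta> a r) (\<lambda>v. ?\<kappa> v - (\<Sum>j\<le>M. ?P j * ?\<kappa> (v - ?h j))) z =
          (LINT y|lborel. bump \<beta> a r y * ?\<kappa> (z - y) - (\<Sum>j\<le>M. ?P j * (bump \<beta> a r y * ?\<kappa> (z - y - ?h j))))"
        unfolding convolve_def
        by (intro Bochner_Integration.integral_cong) (auto simp: right_diff_distrib sum_distrib_left mult_ac)
      also have "\<dots> = (LINT y|lborel. bump \<beta> a r y * ?\<kappa> (z - y)) - (\<Sum>j\<le>M. ?P j * (LINT y|lborel. bump \<beta> a r y * ?\<kappa> (z - y - ?h j)))"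
        using ib[OF ck] ib[OF ct] by (simp add: diff_right_commute)
      finally show ?thesis by (simp only: convolve_def)
    qed
    also have "\<bar>\<dots>\<bar> \<le> real (Suc M) * (\<Lambda> * (\<rho> ^ Suc M * (B0 / t ^ (?n + M + 2)) * 4 ^ Suc M)) * (LINT y|lborel. \<bar>bump \<beta> a r y\<bar>)"
    proof (rule convolve_bound[OF cont_supp_bump[OF b r]])
      show "continuous_on UNIV (\<lambda>v. ?\<kappa> v - (\<Sum>j\<le>M. ?P j * ?\<kappa> (v - ?h j)))"
        by (intro continuous_intros ck continuous_on_compose2[OF ck[of UNIV]]) auto
      show "\<bar>?\<kappa> (z - y) - (\<Sum>j\<le>M. ?P j * ?\<kappa> (z - y - ?h j))\<bar> \<le> real (Suc M) * (\<Lambda> * (\<rho> ^ Suc M * (B0 / t ^ (?n + M + 2)) * 4 ^ Suc M))" for y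
      proof (rule translated_extrapolation_error[OF inj_node sk])
        have eq: "?\<kappa> = (\<lambda>x. (1 / t) * dilate (partial i \<psi>) t x)"
          using partial_dilate[OF smooth_psi t] by simp
        show "\<bar>(partial d ^^ Suc M) ?\<kappa> x\<bar> \<le> B0 / t ^ (?n + M + 2)" for x
        proof -
          have "(partial d ^^ Suc M) ?\<kappa> x = 1 / t / t ^ Suc M * ((partial d ^^ Suc M) (partial i \<psi>) (x /\<^sub>R t) / t ^ ?n)"
            unfolding eq partial_iterate_dilate[OF smooth_partial[OF smooth_psi] t] by (simp only: dilate_def)
          also have "\<bar>\<dots>\<bar> = \<bar>(partial d ^^ Suc M) (partial i \<psi>) (x /\<^sub>R t)\<bar> / t ^ (?n + M + 2)"
            using t by (simp add: abs_mult power_add field_simps del: funpow.simps)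
          also have "\<dots> \<le> B0 / t ^ (?n + M + 2)"
            using t order_trans[OF B(2) B0] by (intro divide_right_mono) auto
          finally show ?thesis .
        qed
        \<comment> \<open>The nodes are at most 3/2 and \<sigma> lies in [-2, 2].\<close>
        show "\<bar>node M j - \<sigma>\<bar> \<le> 4" if "j \<le> M" for j
          using node_bounds[OF that] s by linarith
      qed (use L s rho in auto)
    qed
    also have "\<dots> = E * \<rho> ^ Suc M * r ^ ?n / t ^ (?n + M + 2)"
      using integral_bump[OF mb r] by (simp add: E_def I_def)
    also have "\<dots> \<le> (E + 1) * \<rho> ^ Suc M * r ^ ?n / t ^ (?n + M + 2)"
      using rho r t by (intro divide_right_mono mult_right_mono) auto
    finally show "\<bar>convolve (partial i (corr_bump \<beta> M d \<rho> \<sigma> a r)) (dilate \<psi> t) z\<bar> \<le> (E + 1) * \<rho> ^ Suc M * r ^ ?n / t ^ (?n + M + 2)" .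
  qed
qed

text \<open>The competitor is the sum of the corrected bumps of the covering balls. Inside
  \<open>ball x (4 * \<rho>)\<close> the exponent \<open>p\<close> is available and is lowered to
  \<open>q\<close> by splitting at level \<eta>/\<rho>; outside, the vanishing moments make the q-th
  power integrable. Every contribution scales like \<rho>^(n-q).\<close>

lemma hardy_cap_le_content:
  assumes q: "0 < q" "q < p" and p: "real CARD('n) / (real CARD('n) + 1) < p" "p \<le> 1" and c: "c > 0"
  obtains \<epsilon> where "\<epsilon> > 0" "\<And>(x :: real^'n) \<rho> K (I :: nat set) a r. \<lbrakk>\<rho> > 0; finite I; \<And>k. k \<in> I \<Longrightarrow> r k > 0; K \<subseteq> cball x \<rho>;
      K \<subseteq> (\<Union>k\<in>I. ball (a k) (r k)); \<And>k. k \<in> I \<Longrightarrow> dist (a k) x \<le> \<rho> + r k;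
      (\<Sum>k\<in>I. (r k / \<rho>) powr (real CARD('n) - p)) \<le> \<epsilon>\<rbrakk>
      \<Longrightarrow> hardy_cap \<psi> q K (ball x (2 * \<rho>)) \<le> ennreal (c * \<rho> powr (real CARD('n) - q))"
proof -
  let ?n = "CARD('n)" and ?N = "real CARD('n)"
  let ?s = "?N - p"
  have n1: "1 \<le> ?N" by (simp add: Suc_leI)
  obtain \<beta> :: "real^'n \<Rightarrow> real" and l where b: "smooth \<beta>" "cont_supp l \<beta>" "l \<ge> 1" and b0: "\<And>x. \<beta> x \<ge> 0" and b1: "\<And>x. norm x < 1 \<Longrightarrow> \<beta> x \<ge> 1"
    using bump_exists by blast
  \<comment> \<open>The far decay has order n + M + 2, and its q-th power must be integrable however
    small \<open>q\<close> is.\<close>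
  obtain M :: nat where M: "?N / q < real M" using reals_Archimedean2 by blast
  let ?m = "?n + M + 2"
  have mq: "real ?m * q > ?N"
  proof -
    have "?N < real M * q" using M q by (simp add: field_simps)
    also have "\<dots> \<le> real ?m * q" using q by (intro mult_right_mono) auto
    finally show ?thesis .
  qed
  obtain \<Lambda> where L: "\<Lambda> \<ge> 1" "\<And>j y. j \<le> M \<Longrightarrow> \<bar>y\<bar> \<le> 2 \<Longrightarrow> \<bar>poly (lagrange (node M) M j) y\<bar> \<le> \<Lambda>"
    using lagrange_node_bounded[of M] by blast
  have "\<Lambda> > 0" using L by simp
  obtain K1 where K1: "K1 > 0" "\<And>i (Q :: (nat \<times> nat) set) w a r. finite Q \<Longrightarrow> (\<And>k. k \<in> Q \<Longrightarrow> r k > 0) \<Longrightarrow> (\<And>k. k \<in> Q \<Longrightarrow> \<bar>w k\<bar> \<le> \<Lambda>) \<Longrightarrow>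
     (\<integral>\<^sup>+z. epowr (maximal \<psi> (partial i (\<lambda>y. \<Sum>k\<in>Q. w k * bump \<beta> (a k) (r k) y)) z) p \<partial>lborel)
       \<le> ennreal (K1 * (\<Sum>k\<in>Q. r k powr ?s))"
    by (rule maximal_bump_sum[OF b p \<open>\<Lambda> > 0\<close>, where 'q = "nat \<times> nat"]) (rule that; blast)
  obtain E where E: "E > 0" "\<And>d i \<rho> \<sigma> a r t z. \<rho> > 0 \<Longrightarrow> \<bar>\<sigma>\<bar> \<le> 2 \<Longrightarrow> r > 0 \<Longrightarrow> t > 0 \<Longrightarrow>
    \<bar>convolve (partial i (corr_bump \<beta> M d \<rho> \<sigma> a r)) (dilate \<psi> t) z\<bar> \<le> E * \<rho> ^ Suc M * r ^ ?n / t ^ ?m"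
    by (rule convolve_corr_bump[OF b(1,2), of M]) (rule that; blast)
  obtain J where J: "J > 0" "\<And>(a :: real^'n) r. r > 0 \<Longrightarrow>
    (\<integral>\<^sup>+z. ennreal ((1 + dist z a / r) powr (- (real ?m * q))) \<partial>lborel) \<le> ennreal (J * r ^ ?n)"
    using decay_integral[OF mq] by metis
  define V where "V = vol TYPE('n) * 4 ^ ?n"
  have V: "V > 0" using vol_pos[where 'n='n] by (simp add: V_def)
  \<comment> \<open>The budget c / (3 n) is shared by three contributions in each of n derivatives.
    This one pays for values below the splitting level on the ball of radius 4 \<rho>, whose volume
    is \<open>V\<close> times \<rho>^n.\<close>
  define \<eta> where "\<eta> = (c / (3 * ?N * V)) powr (1 / q)"
  have eta: "\<eta> > 0" "V * \<eta> powr q = c / (3 * ?N)"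
    using c V n1 q by (auto simp: \<eta>_def powr_powr)
  define A where "A = \<eta> powr (q - p) * (K1 * real (M + 2))"
  define D where "D = (E * 4 ^ ?m) powr q * J"
  have A: "A > 0" and D: "D > 0" using eta K1 E J by (auto simp: A_def D_def)
  have sp: "?s \<ge> 0" using p n1 by linarith
  \<comment> \<open>The first bound forces all radii below \<rho> / (16 l); the other two pay for
    the values above the splitting level and for the far region. The \<open>+ 1\<close> in the
    exponent keeps the first bound below 1 even when n = p = 1.\<close>
  define \<epsilon> where "\<epsilon> = min ((1 / (16 * l)) powr (?s + 1)) (min (c / (3 * ?N * A)) ((c / (3 * ?N * D)) powr (1 / q)))"
  have eps: "\<epsilon> > 0" "\<epsilon> \<le> (1 / (16 * l)) powr (?s + 1)" "A * \<epsilon> \<le> c / (3 * ?N)" "D * \<epsilon> powr q \<le> c / (3 * ?N)"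
  proof -
    show e0: "\<epsilon> > 0" using b(3) A D c n1 by (auto simp: \<epsilon>_def)
    show "\<epsilon> \<le> (1 / (16 * l)) powr (?s + 1)" by (simp add: \<epsilon>_def)
    have "\<epsilon> \<le> c / (3 * ?N * A)" by (simp add: \<epsilon>_def)
    then show "A * \<epsilon> \<le> c / (3 * ?N)" using A n1 by (simp add: field_simps)
    have "\<epsilon> \<le> (c / (3 * ?N * D)) powr (1 / q)" by (simp add: \<epsilon>_def)
    then have "\<epsilon> powr q \<le> ((c / (3 * ?N * D)) powr (1 / q)) powr q"
      using e0 q by (intro powr_mono2) auto
    then have "\<epsilon> powr q \<le> c / (3 * ?N * D)" using q c D n1 by (simp add: powr_powr)
    then show "D * \<epsilon> powr q \<le> c / (3 * ?N)" using D n1 by (simp add: field_simps)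
  qed
  show ?thesis
  proof (rule that[OF eps(1)])
    fix x :: "real^'n" and \<rho> K and I :: "nat set" and a r
    assume rho: "\<rho> > 0" and I: "finite I" and r: "\<And>k. k \<in> I \<Longrightarrow> r k > 0" and Kx: "K \<subseteq> cball x \<rho>"
      and cov: "K \<subseteq> (\<Union>k\<in>I. ball (a k) (r k))" and near: "\<And>k. k \<in> I \<Longrightarrow> dist (a k) x \<le> \<rho> + r k"
      and sum: "(\<Sum>k\<in>I. (r k / \<rho>) powr ?s) \<le> \<epsilon>"
    \<comment> \<open>Any fixed coordinate direction will do; all corrections are made along
      it.\<close>
    define d where "d = (undefined :: 'n)"
    have small: "l * r k \<le> \<rho> / 16" "r k \<le> \<rho> / 16" if k: "k \<in> I" for k
    proof -
      let ?y = "r k / \<rho>"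
      have y: "?y > 0" using r[OF k] rho by simp
      have "?y powr ?s \<le> (\<Sum>k\<in>I. (r k / \<rho>) powr ?s)"
        using I k by (intro member_le_sum) auto
      then have ys: "?y powr ?s \<le> (1 / (16 * l)) powr (?s + 1)" using sum eps by linarith
      have "?y \<le> 1 / (16 * l)"
      \<comment> \<open>For n = p = 1 each summand equals 1, which already exceeds \<epsilon>, so a
        ball cannot be present at all.\<close>
      proof (cases "?s = 0")
        case True
        then have "?y powr ?s = 1" using r[OF k] rho by simp
        moreover have "(1 / (16 * l)) powr (?s + 1) < 1" using True b(3) by (simp add: field_simps)
        ultimately show ?thesis using ys by linarith
      next
        case False
        then have s: "?s > 0" using sp by simp
        have "(1 / (16 * l)) powr (?s + 1) \<le> (1 / (16 * l)) powr ?s"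
          using b(3) by (intro powr_mono') auto
        then have "?y powr ?s \<le> (1 / (16 * l)) powr ?s" using ys by linarith
        then show ?thesis
          using powr_less_mono2[OF s, of "1 / (16 * l)" ?y] b(3) by fastforce
      qed
      then show lr: "l * r k \<le> \<rho> / 16" using rho b(3) by (simp add: field_simps)
      have "1 * r k \<le> l * r k" using b(3) r[OF k] by (intro mult_right_mono) auto
      then show "r k \<le> \<rho> / 16" using lr by simp
    qed
    have na: "norm (a k - x) \<le> 17 / 16 * \<rho>" if "k \<in> I" for k
      using near[OF that] small[OF that] by (simp add: dist_norm)
    define \<sigma> where "\<sigma> k = (a k - x) $ d / \<rho>" for k
    have sg: "\<bar>\<sigma> k\<bar> \<le> 2" if "k \<in> I" for k
    proof -
      have "\<bar>(a k - x) $ d\<bar> \<le> 17 / 16 * \<rho>" using component_le_norm_cart[of "a k - x" d] na[OF that] by linarith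
      then show ?thesis using rho by (simp add: \<sigma>_def abs_divide divide_le_eq)
    qed
    let ?w = "\<lambda>k. corr_weight M (\<sigma> k)" and ?c = "\<lambda>k. corr_center M d \<rho> (\<sigma> k) (a k)"
    let ?f = "\<lambda>k. corr_bump \<beta> M d \<rho> (\<sigma> k) (a k) (r k)"
    define \<phi> where "\<phi> y = (\<Sum>k\<in>I. ?f k y)" for y
    \<comment> \<open>The double sum over balls and correction indices is flattened to a single
      family of weighted bumps.\<close>
    define Q where "Q = I \<times> {..Suc M}"
    have phiQ: "\<phi> = (\<lambda>y. \<Sum>km\<in>Q. (case km of (k, m) \<Rightarrow> ?w k m) * bump \<beta> (case km of (k, m) \<Rightarrow> ?c k m) (case km of (k, m) \<Rightarrow> r k) y)"
      unfolding \<phi>_def[abs_def] corr_bump_def Q_def sum.cartesian_product by (simp add: case_prod_beta)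
    have wL: "\<bar>?w k m\<bar> \<le> \<Lambda>" if "k \<in> I" "m \<le> Suc M" for k m
      using that L sg[OF that(1)] by (cases m) (auto simp: corr_weight_def)
    have sf: "smooth (?f k)" for k by (rule smooth_corr_bump[OF b(1)])
    have sphi: "smooth \<phi>" unfolding \<phi>_def[abs_def] by (intro smooth_sum I sf)
    have cdist: "dist (?c k m) x + l * r k \<le> 31 / 16 * \<rho>" if k: "k \<in> I" and m: "m \<le> Suc M" for k m
    proof (cases m)
      case 0
      then show ?thesis using near[OF k] small[OF k] rho by (simp add: corr_center_def)
    next
      case (Suc j)
      then show ?thesis
        using norm_corr_center(2)[OF rho na[OF k], of j M d] m small[OF k] by (simp add: \<sigma>_def)
    qed
    have fz: "?f k y = 0" if k: "k \<in> I" and y: "dist y x > 31 / 16 * \<rho>" for k y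
    proof -
      have "bump \<beta> (?c k m) (r k) y = 0" if "m \<le> Suc M" for m
        using cdist[OF k that] y dist_triangle[of y x "?c k m"] by (intro bump_zero[OF b(2) r[OF k]]) linarith
      then show ?thesis by (simp add: corr_bump_def)
    qed
    have phz: "\<phi> y = 0" if "dist y x > 31 / 16 * \<rho>" for y using fz that by (simp add: \<phi>_def)
    have tphi: "test_function (ball x (2 * \<rho>)) \<phi>"
    proof -
      have s: "supp \<phi> \<subseteq> cball x (31 / 16 * \<rho>)"
        unfolding supp_subset_iff[OF closed_cball] using phz by (force simp: dist_commute)
      moreover have "compact (supp \<phi>)"
        using s by (metis bounded_cball bounded_subset closed_closure compact_eq_bounded_closed supp_def)
      moreover have "cball x (31 / 16 * \<rho>) \<subseteq> ball x (2 * \<rho>)" using rho by auto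
      ultimately show ?thesis using sphi unfolding test_function_def smooth_def by blast
    qed
    have phi1: "\<phi> y \<ge> 1" if y: "y \<in> K" for y
    proof -
      have yx: "dist y x \<le> \<rho>" using Kx y by (auto simp: dist_commute)
      \<comment> \<open>On \<open>K\<close> the corrections are invisible: their centres are at
        least 5/4 \<rho> from \<open>x\<close> and their supports have radius at most \<rho>/16.
        Only the nonnegative original bumps remain.\<close>
      have fb: "?f k y = bump \<beta> (a k) (r k) y" if k: "k \<in> I" for k
      proof -
        have "bump \<beta> (?c k (Suc j)) (r k) y = 0" if "j \<le> M" for j
        proof (rule bump_zero[OF b(2) r[OF k]])
          have "5 / 4 * \<rho> \<le> dist (?c k (Suc j)) x"
            using norm_corr_center(1)[OF rho na[OF k] that, of d] by (simp add: \<sigma>_def)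
          then show "l * r k < dist y (?c k (Suc j))"
            using yx small[OF k] rho dist_triangle[of "?c k (Suc j)" x y] dist_commute[of y "?c k (Suc j)"] by linarith
        qed
        then show ?thesis
          unfolding corr_bump_def sum.atMost_Suc_shift by (simp add: corr_weight_def corr_center_def)
      qed
      obtain k where k: "k \<in> I" "y \<in> ball (a k) (r k)" using cov y by blast
      have "1 \<le> bump \<beta> (a k) (r k) y"
        unfolding bump_def
      proof (rule b1)
        show "norm ((y - a k) /\<^sub>R r k) < 1"
          using k r[OF k(1)] by (simp add: dist_norm norm_minus_commute divide_inverse[symmetric] mult.commute[of "inverse _"] del: scaleR_diff_right)
      qed
      also have "\<dots> \<le> (\<Sum>k\<in>I. bump \<beta> (a k) (r k) y)"
        using I k by (intro member_le_sum) (auto simp: bump_def b0)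
      also have "\<dots> = \<phi> y" by (simp add: \<phi>_def fb)
      finally show ?thesis .
    qed
    have main: "(\<integral>\<^sup>+z. epowr (maximal \<psi> (partial i \<phi>) z) q \<partial>lborel) \<le> ennreal (c / ?N * \<rho> powr (?N - q))" for i
    proof -
      let ?m' = "maximal \<psi> (partial i \<phi>)"
      obtain R where cphi: "cont_supp R \<phi>" using test_function_cc[OF tphi] by blast
      have mm [measurable]: "?m' \<in> borel_measurable borel" by (rule maximal_measurable[OF cont_supp_partial[OF sphi cphi]])
      define \<mu> where "\<mu> = \<eta> / \<rho>"
      have lam: "\<mu> > 0" using eta rho by (simp add: \<mu>_def)
      \<comment> \<open>The factor \<epsilon> comes from the sum of r^n, at most \<rho>^n \<epsilon>
        since all radii are below \<rho>; it makes the far part small.\<close>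
      define G where "G = E * 4 ^ ?m * \<epsilon> / \<rho>"
      have G: "G \<ge> 0" using E eps rho by (simp add: G_def)
      have far: "?m' z \<le> ennreal (G * (1 + dist z x / \<rho>) powr (- real ?m))" if z: "z \<notin> ball x (4 * \<rho>)" for z
        unfolding maximal_def
      proof (rule SUP_least)
        fix t :: real assume "t \<in> {0<..}"
        then have t: "t > 0" by simp
        have zx: "4 * \<rho> \<le> dist z x" using z by (simp add: dist_commute)
        show "ennreal \<bar>convolve (partial i \<phi>) (dilate \<psi> t) z\<bar> \<le> ennreal (G * (1 + dist z x / \<rho>) powr (- real ?m))"
        proof (cases "t < dist z x - 31 / 16 * \<rho>")
          case True
          have "partial i \<phi> y = 0" if y: "dist y x > 31 / 16 * \<rho>" for y
          proof -
            have "((\<lambda>x. 0) has_derivative (\<lambda>h. 0)) (at y)" by simp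
            then have "(\<phi> has_derivative (\<lambda>h. 0)) (at y)"
              by (rule has_derivative_transform_within_open[where s = "- cball x (31 / 16 * \<rho>)"])
                 (use y phz in \<open>auto simp: dist_commute not_le\<close>)
            then show ?thesis by (rule partial_eq)
          qed
          then have "convolve (partial i \<phi>) (dilate \<psi> t) z = 0"
            by (rule convolve_bump_small_scale[OF _ t True])
          then show ?thesis by simp
        next
          case False
          \<comment> \<open>The support has radius 31/16 \<rho>, which is below half of
            \<open>dist z x\<close> because that distance is at least 4 \<rho>.\<close>
          then have tz: "dist z x / 2 \<le> t" using zx rho by linarith
          let ?g = "\<lambda>k. partial i (?f k)"
          have der: "partial i \<phi> = (\<lambda>y. \<Sum>k\<in>I. ?g k y)"
            unfolding \<phi>_def[abs_def] using partial_sum[OF I sf] by (simp add: fun_eq_iff)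
          have cg: "cont_supp (norm x + 2 * \<rho>) (?g k)" if k: "k \<in> I" for k
          proof (rule cont_supp_partial[OF sf])
            show "cont_supp (norm x + 2 * \<rho>) (?f k)"
              unfolding cont_supp_alt
            proof safe
              show "continuous_on UNIV (?f k)" by (rule smooth_continuous[OF sf])
              fix y :: "real^'n" assume "norm x + 2 * \<rho> < norm y"
              then show "?f k y = 0"
                using norm_triangle_ineq2[of y x] rho by (intro fz[OF k]) (simp add: dist_norm)
            qed
          qed
          have "\<bar>convolve (partial i \<phi>) (dilate \<psi> t) z\<bar> = \<bar>\<Sum>k\<in>I. convolve (?g k) (dilate \<psi> t) z\<bar>"
            unfolding der by (subst convolve_sum_left[OF cg smooth_continuous[OF smooth_psi_t]]) auto
          also have "\<dots> \<le> (\<Sum>k\<in>I. E * \<rho> ^ Suc M * r k ^ ?n / t ^ ?m)"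
            by (rule order_trans[OF sum_abs sum_mono]) (intro E(2) rho sg r t)
          also have "\<dots> = E * \<rho> ^ Suc M * (\<Sum>k\<in>I. r k ^ ?n) / t ^ ?m"
            by (simp add: sum_distrib_left sum_divide_distrib)
          also have "(\<Sum>k\<in>I. r k ^ ?n) \<le> \<rho> ^ ?n * \<epsilon>"
          proof -
            have "(\<Sum>k\<in>I. r k ^ ?n) \<le> (\<Sum>k\<in>I. \<rho> ^ ?n * (r k / \<rho>) powr ?s)"
            proof (rule sum_mono)
              fix k assume k: "k \<in> I"
              have "r k ^ ?n = \<rho> ^ ?n * (r k / \<rho>) powr ?N"
                using r[OF k] rho by (simp add: powr_realpow power_divide)
              also have "\<dots> \<le> \<rho> ^ ?n * (r k / \<rho>) powr ?s"
                using r[OF k] rho small[OF k] p q by (intro mult_left_mono powr_mono') auto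
              finally show "r k ^ ?n \<le> \<rho> ^ ?n * (r k / \<rho>) powr ?s" .
            qed
            also have "\<dots> \<le> \<rho> ^ ?n * \<epsilon>"
              unfolding sum_distrib_left[symmetric] using sum rho by (intro mult_left_mono) auto
            finally show ?thesis .
          qed
          also have "E * \<rho> ^ Suc M * (\<rho> ^ ?n * \<epsilon>) / t ^ ?m \<le> G * (1 + dist z x / \<rho>) powr (- real ?m)"
          proof -
            let ?X = "1 + dist z x / \<rho>"
            have X: "?X > 0" using rho by (simp add: add_pos_nonneg)
            have "\<rho> * ?X = \<rho> + dist z x" using rho by (simp add: field_simps)
            then have "\<rho> * ?X \<le> 4 * t" using zx tz rho by linarith
            then have "(\<rho> * ?X) ^ ?m \<le> (4 * t) ^ ?m" using rho X by (intro power_mono) auto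
            then have "1 / t ^ ?m \<le> 4 ^ ?m / (\<rho> * ?X) ^ ?m"
              unfolding power_mult_distrib using t rho X by (simp add: divide_simps del: power_Suc power_add)
            then have "E * \<rho> ^ Suc M * (\<rho> ^ ?n * \<epsilon>) * (1 / t ^ ?m) \<le> E * \<rho> ^ Suc M * (\<rho> ^ ?n * \<epsilon>) * (4 ^ ?m / (\<rho> * ?X) ^ ?m)"
              using E eps rho by (intro mult_left_mono) auto
            also have "\<dots> = E * \<epsilon> * 4 ^ ?m * (\<rho> ^ Suc M * \<rho> ^ ?n / \<rho> ^ ?m) * (1 / ?X ^ ?m)"
              unfolding power_mult_distrib by (simp add: mult_ac)
            also have "\<rho> ^ Suc M * \<rho> ^ ?n / \<rho> ^ ?m = 1 / \<rho>"
              using rho by (simp add: power_add)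
            also have "1 / ?X ^ ?m = ?X powr (- real ?m)"
              using X by (simp only: powr_minus powr_realpow inverse_eq_divide)
            finally show ?thesis by (simp add: G_def mult_ac)
          qed
          finally show ?thesis
            by (intro ennreal_leI) (use E eps rho t in \<open>auto simp: divide_right_mono mult_left_mono\<close>)
        qed
      qed
      \<comment> \<open>The middle term is kept on the whole space, where its integral is already
        under control, so only the constant level needs the indicator of the ball.\<close>
      have pw: "epowr (?m' z) q \<le> (ennreal (\<mu> powr q) * indicator (ball x (4 * \<rho>)) z + ennreal (\<mu> powr (q - p)) * epowr (?m' z) p)
          + ennreal (G powr q) * ennreal ((1 + dist z x / \<rho>) powr (- (real ?m * q)))" for z
      proof (cases "z \<in> ball x (4 * \<rho>)")
        case True
        then show ?thesis using epowr_le_split[OF lam q(1), of p "?m' z"] q by (simp add: add_increasing2 del: mem_ball)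
      next
        case False
        have "epowr (?m' z) q \<le> epowr (ennreal (G * (1 + dist z x / \<rho>) powr (- real ?m))) q"
          using q by (intro epowr_mono far[OF False]) auto
        also have "\<dots> = ennreal (G powr q) * ennreal ((1 + dist z x / \<rho>) powr (- (real ?m * q)))"
        proof -
          have "(G * (1 + dist z x / \<rho>) powr (- real ?m)) powr q = G powr q * (1 + dist z x / \<rho>) powr (- (real ?m * q))"
            by (subst powr_mult) (simp only: powr_powr mult_minus_left)
          then show ?thesis using G by (subst epowr_ennreal) (auto simp flip: ennreal_mult)
        qed
        finally show ?thesis by (simp add: add_increasing del: mem_ball)
      qed
      have "(\<integral>\<^sup>+z. epowr (?m' z) q \<partial>lborel) \<le>
        (\<integral>\<^sup>+z. (ennreal (\<mu> powr q) * indicator (ball x (4 * \<rho>)) z + ennreal (\<mu> powr (q - p)) * epowr (?m' z) p)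
          + ennreal (G powr q) * ennreal ((1 + dist z x / \<rho>) powr (- (real ?m * q))) \<partial>lborel)"
        by (rule nn_integral_mono) (rule pw)
      also have "\<dots> = (ennreal (\<mu> powr q) * emeasure lborel (ball x (4 * \<rho>)) + ennreal (\<mu> powr (q - p)) * (\<integral>\<^sup>+z. epowr (?m' z) p \<partial>lborel))
          + ennreal (G powr q) * (\<integral>\<^sup>+z. ennreal ((1 + dist z x / \<rho>) powr (- (real ?m * q))) \<partial>lborel)"
      proof -
        have 1: "(\<lambda>z. ennreal (\<mu> powr q) * indicator (ball x (4 * \<rho>)) z) \<in> borel_measurable lborel"
          by (intro borel_measurable_times_ennreal borel_measurable_indicator borel_measurable_const) simp
        have 2: "(\<lambda>z. ennreal (\<mu> powr (q - p)) * epowr (?m' z) p) \<in> borel_measurable lborel" by measurable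
        have 3: "(\<lambda>z. ennreal (G powr q) * ennreal ((1 + dist z x / \<rho>) powr (- (real ?m * q)))) \<in> borel_measurable lborel" by measurable
        have 4: "(\<lambda>z. ennreal ((1 + dist z x / \<rho>) powr (- (real ?m * q)))) \<in> borel_measurable lborel" by measurable
        have 5: "(\<lambda>z. epowr (?m' z) p) \<in> borel_measurable lborel" by measurable
        show ?thesis
          unfolding nn_integral_add[OF borel_measurable_add[OF 1 2] 3] nn_integral_add[OF 1 2]
            nn_integral_cmult[OF 4] nn_integral_cmult[OF 5]
          by (subst nn_integral_cmult_indicator) simp_all
      qed
      also have "\<dots> \<le> (ennreal (c / (3 * ?N) * \<rho> powr (?N - q)) + ennreal (c / (3 * ?N) * \<rho> powr (?N - q))) + ennreal (c / (3 * ?N) * \<rho> powr (?N - q))"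
      proof (intro add_mono)
        have "ennreal (\<mu> powr q) * emeasure lborel (ball x (4 * \<rho>)) = ennreal (\<mu> powr q * (vol TYPE('n) * (4 * \<rho>) ^ ?n))"
          using rho vol_pos[where 'n='n] by (simp add: emeasure_ball_vol flip: ennreal_mult)
        also have "\<mu> powr q * (vol TYPE('n) * (4 * \<rho>) ^ ?n) = (V * \<eta> powr q) * \<rho> powr (?N - q)"
          using rho eta(1) by (simp add: \<mu>_def V_def powr_divide powr_diff powr_realpow power_mult_distrib mult_ac)
        finally show "ennreal (\<mu> powr q) * emeasure lborel (ball x (4 * \<rho>)) \<le> ennreal (c / (3 * ?N) * \<rho> powr (?N - q))"
          by (simp add: eta(2))
        have "ennreal (\<mu> powr (q - p)) * (\<integral>\<^sup>+z. epowr (?m' z) p \<partial>lborel) \<le>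
            ennreal (\<mu> powr (q - p)) * ennreal (K1 * (\<Sum>km\<in>Q. (case km of (k, m) \<Rightarrow> r k) powr ?s))"
          unfolding phiQ by (intro mult_left_mono K1(2)) (use I r wL in \<open>auto simp: Q_def\<close>)
        also have "(\<Sum>km\<in>Q. (case km of (k, m) \<Rightarrow> r k) powr ?s) = real (M + 2) * \<rho> powr ?s * (\<Sum>k\<in>I. (r k / \<rho>) powr ?s)"
        proof -
          have "(\<Sum>km\<in>Q. (case km of (k, m) \<Rightarrow> r k) powr ?s) = (\<Sum>k\<in>I. \<Sum>m\<le>Suc M. r k powr ?s)"
            unfolding Q_def sum.cartesian_product by (intro sum.cong) auto
          also have "\<dots> = (\<Sum>k\<in>I. real (M + 2) * \<rho> powr ?s * (r k / \<rho>) powr ?s)"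
          proof (rule sum.cong[OF refl])
            fix k assume k: "k \<in> I"
            have "r k powr ?s = \<rho> powr ?s * (r k / \<rho>) powr ?s"
              using r[OF k] rho by (simp add: powr_divide)
            then show "(\<Sum>m\<le>Suc M. r k powr ?s) = real (M + 2) * \<rho> powr ?s * (r k / \<rho>) powr ?s" by simp
          qed
          finally show ?thesis by (simp only: sum_distrib_left)
        qed
        also have "ennreal (\<mu> powr (q - p)) * ennreal (K1 * (real (M + 2) * \<rho> powr ?s * (\<Sum>k\<in>I. (r k / \<rho>) powr ?s)))
            \<le> ennreal (\<mu> powr (q - p)) * ennreal (K1 * (real (M + 2) * \<rho> powr ?s * \<epsilon>))"
          using K1 sum by (intro mult_left_mono ennreal_leI) auto
        also have "\<dots> = ennreal (\<mu> powr (q - p) * (K1 * (real (M + 2) * \<rho> powr ?s * \<epsilon>)))"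
          using K1 eps by (simp flip: ennreal_mult)
        also have "\<mu> powr (q - p) * (K1 * (real (M + 2) * \<rho> powr ?s * \<epsilon>)) = (A * \<epsilon>) * (\<rho> powr ?s / \<rho> powr (q - p))"
          using eta rho by (simp add: \<mu>_def A_def powr_divide)
        also have "\<rho> powr ?s / \<rho> powr (q - p) = \<rho> powr (?N - q)"
          by (simp flip: powr_diff)
        also have "ennreal (A * \<epsilon> * \<rho> powr (?N - q)) \<le> ennreal (c / (3 * ?N) * \<rho> powr (?N - q))"
          using eps(3) by (intro ennreal_leI mult_right_mono) auto
        finally show "ennreal (\<mu> powr (q - p)) * (\<integral>\<^sup>+z. epowr (?m' z) p \<partial>lborel) \<le> ennreal (c / (3 * ?N) * \<rho> powr (?N - q))" .
        have "ennreal (G powr q) * (\<integral>\<^sup>+z. ennreal ((1 + dist z x / \<rho>) powr (- (real ?m * q))) \<partial>lborel) \<le> ennreal (G powr q) * ennreal (J * \<rho> ^ ?n)"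
          by (intro mult_left_mono J(2) rho) simp
        also have "\<dots> = ennreal (G powr q * (J * \<rho> ^ ?n))" using J rho by (simp flip: ennreal_mult)
        also have "G powr q * (J * \<rho> ^ ?n) = D * \<epsilon> powr q * \<rho> powr (?N - q)"
        proof -
          have "G powr q = (E * 4 ^ ?m) powr q * \<epsilon> powr q / \<rho> powr q"
            unfolding G_def using E eps rho by (simp only: powr_divide powr_mult)
          then show ?thesis using rho by (simp add: D_def powr_diff powr_realpow)
        qed
        also have "ennreal (D * \<epsilon> powr q * \<rho> powr (?N - q)) \<le> ennreal (c / (3 * ?N) * \<rho> powr (?N - q))"
          using eps(4) by (intro ennreal_leI mult_right_mono) auto
        finally show "ennreal (G powr q) * (\<integral>\<^sup>+z. ennreal ((1 + dist z x / \<rho>) powr (- (real ?m * q))) \<partial>lborel) \<le> ennreal (c / (3 * ?N) * \<rho> powr (?N - q))" .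
      qed
      also have "\<dots> = ennreal (c / ?N * \<rho> powr (?N - q))"
        using c n1 by (simp add: field_simps flip: ennreal_plus)
      finally show ?thesis .
    qed
    have "hardy_cap \<psi> q K (ball x (2 * \<rho>)) \<le> (\<Sum>i\<in>UNIV. epowr (hardy_norm \<psi> q (partial i \<phi>)) q)"
      unfolding hardy_cap_def by (rule INF_lower) (use tphi phi1 in auto)
    also have "\<dots> \<le> (\<Sum>i\<in>(UNIV :: 'n set). ennreal (c / ?N * \<rho> powr (?N - q)))"
      unfolding hardy_norm_powr[OF q(1)] by (intro sum_mono main)
    also have "\<dots> = ennreal (c * \<rho> powr (?N - q))"
      using c n1 by (simp add: ennreal_of_nat_eq_real_of_nat flip: ennreal_mult)
    finally show "hardy_cap \<psi> q K (ball x (2 * \<rho>)) \<le> ennreal (c * \<rho> powr (?N - q))" .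
  qed
qed

text \<open>A cover whose normalised sum is at most \<epsilon> would push the capacity down to half
  the value that fatness guarantees. The new exponent \<open>p\<close> exceeds \<open>q\<close>, and
  the room between them pays for the passage from capacity to content.\<close>

lemma fat_imp_content_thick:
  fixes \<Omega> :: "(real^'n) set"
  assumes fat: "uniformly_fat_complement \<psi> q \<Omega>" and Om: "open \<Omega>" and c0: "c\<^sub>0 > 0"
    and q: "0 < q" "q < p" and p: "real CARD('n) / (real CARD('n) + 1) < p" "p \<le> 1"
  shows "content_thick_complement c\<^sub>0 (real CARD('n) - p) \<Omega>"
proof -
  let ?N = "real CARD('n)"
  let ?s = "?N - p"
  obtain c where c: "c > 0" "\<And>x r. x \<in> -\<Omega> \<Longrightarrow> r > 0 \<Longrightarrow>
      ennreal (c * r powr (?N - q)) \<le> hardy_cap \<psi> q (-\<Omega> \<inter> cball x r) (ball x (2 * r))"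
    using fat unfolding uniformly_fat_complement_def by blast
  have "c / 2 > 0" using c by simp
  then obtain \<epsilon> where e: "\<epsilon> > 0" "\<And>(x :: real^'n) \<rho> K (I :: nat set) a r. \<lbrakk>\<rho> > 0; finite I; \<And>k. k \<in> I \<Longrightarrow> r k > 0; K \<subseteq> cball x \<rho>;
      K \<subseteq> (\<Union>k\<in>I. ball (a k) (r k)); \<And>k. k \<in> I \<Longrightarrow> dist (a k) x \<le> \<rho> + r k;
      (\<Sum>k\<in>I. (r k / \<rho>) powr ?s) \<le> \<epsilon>\<rbrakk>
      \<Longrightarrow> hardy_cap \<psi> q K (ball x (2 * \<rho>)) \<le> ennreal (c / 2 * \<rho> powr (?N - q))"
    by (rule hardy_cap_le_content[OF q p]) (rule that; blast)
  have "ennreal (c\<^sub>0 * \<epsilon> / 2 powr ?s * R powr ?s) \<le> hausdorff_content c\<^sub>0 ?s (-\<Omega> \<inter> ball x R)" if x: "x \<in> -\<Omega>" and R: "R > 0" for x R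
  proof (rule hausdorff_content_geI[OF c0])
    fix a :: "nat \<Rightarrow> real^'n" and r :: "nat \<Rightarrow> real"
    assume r: "\<And>k. r k > 0" and cov: "-\<Omega> \<inter> ball x R \<subseteq> (\<Union>k. ball (a k) (r k))"
    \<comment> \<open>Capacity is tested on closed balls and content on open ones: the closed ball
      of half the radius lies inside the open ball that is covered, and its compactness gives a
      finite subcover.\<close>
    define \<rho> where "\<rho> = R / 2"
    have rho: "\<rho> > 0" "\<rho> < R" using R by (auto simp: \<rho>_def)
    let ?K = "-\<Omega> \<inter> cball x \<rho>"
    have cK: "compact ?K" using Om by (intro closed_Int_compact) auto
    have cU: "?K \<subseteq> (\<Union>k\<in>UNIV. ball (a k) (r k))" using cov rho by force
    obtain I0 where I0: "finite I0" "?K \<subseteq> (\<Union>k\<in>I0. ball (a k) (r k))"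
      by (rule compactE_image[OF cK _ cU]) auto
    \<comment> \<open>Balls that miss the compact set are discarded, so that the remaining centres
      are within \<rho> + r of \<open>x\<close>.\<close>
    define I where "I = {k\<in>I0. ball (a k) (r k) \<inter> ?K \<noteq> {}}"
    have I: "finite I" "?K \<subseteq> (\<Union>k\<in>I. ball (a k) (r k))" using I0 unfolding I_def by (simp, blast)
    have near: "dist (a k) x \<le> \<rho> + r k" if "k \<in> I" for k
    proof -
      obtain y where "y \<in> ball (a k) (r k)" "y \<in> cball x \<rho>" using \<open>k \<in> I\<close> unfolding I_def by blast
      then show ?thesis using dist_triangle[of "a k" x y] by (simp add: dist_commute)
    qed
    have big: "\<epsilon> < (\<Sum>k\<in>I. (r k / \<rho>) powr ?s)"
    proof (rule ccontr)
      assume "\<not> ?thesis"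
      then have "hardy_cap \<psi> q ?K (ball x (2 * \<rho>)) \<le> ennreal (c / 2 * \<rho> powr (?N - q))"
        by (intro e(2)[OF rho(1) I(1) r _ I(2) near]) auto
      then have "ennreal (c * \<rho> powr (?N - q)) \<le> ennreal (c / 2 * \<rho> powr (?N - q))"
        using c(2)[OF x rho(1)] by (rule order_trans[rotated])
      then show False using c rho by simp
    qed
    have "c\<^sub>0 * \<epsilon> / 2 powr ?s * R powr ?s = c\<^sub>0 * (\<rho> powr ?s * \<epsilon>)"
      using R by (simp add: \<rho>_def powr_divide)
    also have "\<dots> \<le> c\<^sub>0 * (\<rho> powr ?s * (\<Sum>k\<in>I. (r k / \<rho>) powr ?s))"
      using big c0 by (intro mult_left_mono) auto
    also have "\<rho> powr ?s * (\<Sum>k\<in>I. (r k / \<rho>) powr ?s) = (\<Sum>k\<in>I. r k powr ?s)"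
      unfolding sum_distrib_left by (rule sum.cong) (use rho r in \<open>auto simp: powr_divide less_imp_le\<close>)
    finally have "ennreal (c\<^sub>0 * \<epsilon> / 2 powr ?s * R powr ?s) \<le> ennreal (c\<^sub>0 * (\<Sum>k\<in>I. r k powr ?s))"
      by (rule ennreal_leI)
    also have "\<dots> = ennreal c\<^sub>0 * (\<Sum>k\<in>I. ennreal (r k powr ?s))"
      using c0 by (simp add: ennreal_mult sum_nonneg sum_ennreal)
    also have "\<dots> \<le> ennreal c\<^sub>0 * (\<Sum>k. ennreal (r k powr ?s))"
      by (intro mult_left_mono sum_le_suminf I) auto
    finally show "ennreal (c\<^sub>0 * \<epsilon> / 2 powr ?s * R powr ?s) \<le> ennreal c\<^sub>0 * (\<Sum>k. ennreal (r k powr ?s))" .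
  qed
  then show ?thesis
    unfolding content_thick_complement_def using c0 e(1) by (intro exI[of _ "c\<^sub>0 * \<epsilon> / 2 powr ?s"]) auto
qed

end

theorem theorem27:
  fixes \<psi> :: "real^'n \<Rightarrow> real" and p c\<^sub>0 :: real
  assumes "test_function UNIV \<psi>" and "(LINT x|lborel. \<psi> x) = 1" and "supp \<psi> \<subseteq> cball 0 1"
    and "c\<^sub>0 > 0"
    and "real CARD('n) / (real CARD('n) + 1) < p" and "p \<le> 1"
  shows "(\<forall>\<Omega> :: (real^'n) set.
            domain \<Omega> \<and> bounded \<Omega> \<and> (\<exists>q. 0 < q \<and> q < p \<and> uniformly_fat_complement \<psi> q \<Omega>)
              \<longrightarrow> carries_hardy_inequality \<psi> p \<Omega>) \<and>
         (\<forall>\<Omega> :: (real^'n) set.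
            domain \<Omega> \<and> \<Omega> \<noteq> UNIV \<and>
            (\<exists>q. q < p \<and> content_thick_complement c\<^sub>0 (real CARD('n) - q) \<Omega>)
              \<longrightarrow> carries_hardy_inequality \<psi> p \<Omega>)"
proof -
  let ?N = "real CARD('n)"
  have smooth: "smooth \<psi>" by (rule test_function_smooth[OF assms(1)])
  have supp_psi: "cont_supp 1 \<psi>"
    using assms(3) smooth_continuous[OF smooth] by (auto simp: cont_supp_def supp_subset_iff)
  interpret mollifier \<psi>
    by standard (fact smooth supp_psi assms(2))+
  have N: "0 < ?N / (?N + 1)" "1 \<le> ?N" by (auto simp: Suc_leI)
  show ?thesis
  proof (intro conjI allI impI; elim conjE exE)
    fix \<Omega> :: "(real^'n) set" and q
    assume Om: "domain \<Omega>" "bounded \<Omega>" and q: "0 < q" "q < p" and fat: "uniformly_fat_complement \<psi> q \<Omega>"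
    \<comment> \<open>An exponent strictly below \<open>p\<close> is sought that exceeds both
      \<open>q\<close> and n/(n+1), so that fatness gives content thickness for it and room below
      \<open>p\<close> remains for the Hardy inequality.\<close>
    define m where "m = max q (?N / (?N + 1))"
    have m: "q \<le> m" "?N / (?N + 1) \<le> m" "m < p" using q assms(5) by (auto simp: m_def)
    define q' where "q' = (m + p) / 2"
    have mq: "m < q'" "q' < p" using m(3) by (auto simp: q'_def)
    have q': "q < q'" "?N / (?N + 1) < q'" "q' < p"
      using le_less_trans[OF m(1) mq(1)] le_less_trans[OF m(2) mq(1)] mq(2) by auto
    have "open \<Omega>" "\<Omega> \<noteq> UNIV" using Om not_bounded_UNIV by (auto simp: domain_def)
    moreover have "content_thick_complement c\<^sub>0 (?N - q') \<Omega>"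
      by (rule fat_imp_content_thick[OF fat _ assms(4) q(1) q'(1,2)]) (use \<open>open \<Omega>\<close> q' assms(6) in auto)
    ultimately show "carries_hardy_inequality \<psi> p \<Omega>"
      using q q' by (intro hardy_of_content_thick[OF assms(4) _ q'(3) assms(6)]) auto
  next
    fix \<Omega> :: "(real^'n) set" and q
    assume Om: "domain \<Omega>" "\<Omega> \<noteq> UNIV" and q: "q < p" and thick: "content_thick_complement c\<^sub>0 (?N - q) \<Omega>"
    \<comment> \<open>Here \<open>q\<close> may be zero or negative, whereas the Hardy argument
      needs a positive exponent. Raising \<open>q\<close> lowers the content exponent, which stays
      positive because q' < p \<le> 1 \<le> n.\<close>
    define q' where "q' = max q (p / 2)"
    have p0: "p > 0" using N assms(5) by linarith
    then have q': "q \<le> q'" "0 < q'" "q' < p" using q by (auto simp: q'_def)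
    have "content_thick_complement c\<^sub>0 (?N - q') \<Omega>"
      by (rule content_thick_mono[OF thick assms(4)]) (use q' assms(6) N in linarith)+
    then show "carries_hardy_inequality \<psi> p \<Omega>"
      using Om by (intro hardy_of_content_thick[OF assms(4) q'(2,3) assms(6)]) (auto simp: domain_def)
  qed
qed

end
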